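(* Suppose there exist constants $a_1,a_2>0$ and $\alpha_2\ge\alpha_1>0$ such that $$a_1\Big(\frac Rr\Big)^{1+\alpha_1}\le\frac{\nu(r)}{\nu(R)}\le a_2\Big(\frac Rr\Big)^{1+\alpha_2}\quad\text{for all }0<r\le R<\infty.$$ Then there exist constants $c_1,c_2,c_3,c_5>1$ and $c_4>0$ such that for all $t\in(0,\infty)$: (i) for all $x\in(0,tb(t)]$, with $\sigma=(\phi')^{-1}(x/t)$, $$\frac{c_1^{-1}}{\sqrt{t(-\phi''(\sigma))}}\exp(-tH(\sigma))\le p(t,x)\le\frac{c_1}{\sqrt{t(-\phi''(\sigma))}}\exp(-tH(\sigma))$$ and $$c_2^{-1}H^{-1}(1/t)\exp(-2tH(\sigma))\le p(t,x)\le c_2H^{-1}(1/t)\exp\big(-\tfrac t2H(\sigma)\big);$$ (ii) for all $y\in[0,\infty)$, $$c_3^{-1}H^{-1}(1/t)\min\Big\{1,\frac{t\nu(y)}{H^{-1}(1/t)}+\exp\Big(-\frac{c_4y}{\theta(t,y/(8e^2))}\Big)\Big\}\le p(t,tb(t)+y)\le c_3H^{-1}(1/t)\min\Big\{1,\frac{t\nu(y)}{H^{-1}(1/t)}+\exp\Big(-\frac{y}{8\theta(t,y/(8e^2))}\Big)\Big\};$$ (iii) for all $y\in(D(t),\infty)$, $$c_5^{-1}t\nu(y)\le p(t,tb(t)+y)\le c_5t\nu(y).$$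
   Context: $S=(S_t)_{t\ge0}$ is a subordinator (non-decreasing Lévy process on $\mathbb R$ with $S_0=0$) without drift. Its Laplace exponent $\phi$ is given by $\mathbb E e^{-\lambda S_t}=e^{-t\phi(\lambda)}$ and $\phi(\lambda)=\int_0^\infty(1-e^{-\lambda s})\nu(s)\,ds$, where the Lévy measure has a density $\nu:(0,\infty)\to[0,\infty)$ with $\int_0^\infty\min\{1,s\}\nu(s)ds<\infty$. (Inequalities on quotients of $\nu$ presuppose $\nu>0$ on the stated range.) Standing assumption: there is $T_0\in[0,\infty)$ with $\liminf_{x\to0}x\nu(x)=1/T_0$, where $1/0=\infty$. (The hypothesis of the claim implies this with $T_0=0$.) For $t>T_0$, $S_t$ has a transition density $p(t,\cdot)$, continuous and bounded on $(0,\infty)$. Notation: $H(\lambda)=\phi(\lambda)-\lambda\phi'(\lambda)$, a strictly increasing bijection of $(0,\infty)$ with inverse $H^{-1}$; $b(t)=\phi'(H^{-1}(1/t))$; $w(r)=\int_r^\infty\nu(s)ds$; $w^{-1}(u)=\inf\{r>0:w(r)\le u\}$ for $u>0$; $\phi'(0)=\lim_{\lambda\downarrow0}\phi'(\lambda)\in(0,\infty]$; $\sigma=\sigma(t,x)=(\phi')^{-1}(x/t)$ for $t>0$, $0<x<t\phi'(0)$. Convention: $\nu(0)=\infty$. One has $w^{-1}(2e/t)\le H^{-1}(1/t)^{-1}$ for all $t>0$, where $H^{-1}(1/t)^{-1}=1/H^{-1}(1/t)$. Define $$D(t)=t\max_{s\in[w^{-1}(2e/t),\,H^{-1}(1/t)^{-1}]}sH(s^{-1}),$$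 and $\theta:(0,\infty)\times[0,\infty)\to(0,\infty)$ by $\theta(t,y)=H^{-1}(1/t)^{-1}$ if $y\in[0,H^{-1}(1/t)^{-1})$; $\theta(t,y)=\min\{s\in[w^{-1}(2e/t),H^{-1}(1/t)^{-1}]:tsH(s^{-1})=y\}$ if $y\in[H^{-1}(1/t)^{-1},D(t)]$; $\theta(t,y)=w^{-1}(2e/t)$ if $y\in(D(t),\infty)$. *)

theory Defs
  imports "HOL-Probability.Probability"
begin

definition levy_process :: "'a measure \<Rightarrow> (real \<Rightarrow> 'a \<Rightarrow> real) \<Rightarrow> bool" where
  "levy_process M X \<longleftrightarrow>
     prob_space M \<and>
     (\<forall>t\<ge>0. X t \<in> borel_measurable M) \<and>
     (AE \<omega> in M. X 0 \<omega> = 0) \<and>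
     (\<forall>(n::nat) (\<tau>::nat \<Rightarrow> real). 0 \<le> \<tau> 0 \<and> (\<forall>i<n. \<tau> i \<le> \<tau> (Suc i)) \<longrightarrow>
        prob_space.indep_vars M (\<lambda>_. borel) (\<lambda>i \<omega>. X (\<tau> (Suc i)) \<omega> - X (\<tau> i) \<omega>) {..<n}) \<and>
     (\<forall>s t. 0 \<le> s \<and> s \<le> t \<longrightarrow>
        distr M borel (\<lambda>\<omega>. X t \<omega> - X s \<omega>) = distr M borel (X (t - s))) \<and>
     (AE \<omega> in M. (\<forall>t\<ge>0. continuous (at_right t) (\<lambda>s. X s \<omega>)) \<and>
                  (\<forall>t>0. \<exists>l. ((\<lambda>s. X s \<omega>) \<longlongrightarrow> l) (at_left t)))"

definition subordinator :: "'a measure \<Rightarrow> (real \<Rightarrow> 'a \<Rightarrow> real) \<Rightarrow> bool" where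
  "subordinator M S \<longleftrightarrow> levy_process M S \<and> (AE \<omega> in M. mono_on {0..} (\<lambda>t. S t \<omega>))"

text \<open>Densities \<open>\<nu>\<close> live on \<open>(0,\<infinity>)\<close>; their values on \<open>(-\<infinity>,0]\<close> are irrelevant throughout.
  Measurability of \<open>\<nu>\<close> on \<open>(0,\<infinity>)\<close> is part of the integrability condition.\<close>

definition levy_density :: "(real \<Rightarrow> real) \<Rightarrow> bool" where
  "levy_density \<nu> \<longleftrightarrow> (\<forall>s>0. \<nu> s \<ge> 0) \<and> set_integrable lborel {0<..} (\<lambda>s. min 1 s * \<nu> s)"

definition laplace_exponent :: "(real \<Rightarrow> real) \<Rightarrow> real \<Rightarrow> real" where
  "laplace_exponent \<nu> u = (LINT s:{0<..}|lborel. (1 - exp (- (u * s))) * \<nu> s)"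

text \<open>The absence of drift is expressed by the Laplace exponent having no linear term.\<close>

definition driftless_subordinator ::
  "'a measure \<Rightarrow> (real \<Rightarrow> 'a \<Rightarrow> real) \<Rightarrow> (real \<Rightarrow> real) \<Rightarrow> bool" where
  "driftless_subordinator M S \<nu> \<longleftrightarrow>
     subordinator M S \<and> levy_density \<nu> \<and>
     (\<forall>t\<ge>0. \<forall>u\<ge>0. (LINT \<omega>|M. exp (- (u * S t \<omega>))) = exp (- (t * laplace_exponent \<nu> u)))"

text \<open>The continuous version of the density of \<open>S\<^sub>t\<close>, \<open>t > 0\<close>. Continuity determines
  \<open>p t\<close> uniquely on \<open>(0,\<infinity>)\<close>; values on \<open>(-\<infinity>,0]\<close> are irrelevant.\<close>

definition transition_density ::
  "'a measure \<Rightarrow> (real \<Rightarrow> 'a \<Rightarrow> real) \<Rightarrow> (real \<Rightarrow> real \<Rightarrow> real) \<Rightarrow> bool" where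
  "transition_density M S p \<longleftrightarrow>
     (\<forall>t>0. (\<forall>x>0. p t x \<ge> 0) \<and>
            continuous_on {0<..} (p t) \<and>
            bounded (p t ` {0<..}) \<and>
            distributed M lborel (S t) (\<lambda>x. ennreal (indicator {0<..} x * p t x)))"

definition H_fun :: "(real \<Rightarrow> real) \<Rightarrow> real \<Rightarrow> real" where
  "H_fun \<nu> u = laplace_exponent \<nu> u - u * deriv (laplace_exponent \<nu>) u"

definition H_inv :: "(real \<Rightarrow> real) \<Rightarrow> real \<Rightarrow> real" where
  "H_inv \<nu> = inv_into {0<..} (H_fun \<nu>)"

definition b_fun :: "(real \<Rightarrow> real) \<Rightarrow> real \<Rightarrow> real" where
  "b_fun \<nu> t = deriv (laplace_exponent \<nu>) (H_inv \<nu> (1 / t))"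

definition w_fun :: "(real \<Rightarrow> real) \<Rightarrow> real \<Rightarrow> real" where
  "w_fun \<nu> r = (LINT s:{r<..}|lborel. \<nu> s)"

definition w_inv :: "(real \<Rightarrow> real) \<Rightarrow> real \<Rightarrow> real" where
  "w_inv \<nu> u = Inf {r. r > 0 \<and> w_fun \<nu> r \<le> u}"

definition sigma_fun :: "(real \<Rightarrow> real) \<Rightarrow> real \<Rightarrow> real \<Rightarrow> real" where
  "sigma_fun \<nu> t x = inv_into {0<..} (deriv (laplace_exponent \<nu>)) (x / t)"

definition D_fun :: "(real \<Rightarrow> real) \<Rightarrow> real \<Rightarrow> real" where
  "D_fun \<nu> t = t * (GREATEST v. v \<in> (\<lambda>s. s * H_fun \<nu> (inverse s)) `
                       {w_inv \<nu> (2 * exp 1 / t) .. inverse (H_inv \<nu> (1 / t))})"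

definition theta_fun :: "(real \<Rightarrow> real) \<Rightarrow> real \<Rightarrow> real \<Rightarrow> real" where
  "theta_fun \<nu> t y =
     (if y < inverse (H_inv \<nu> (1 / t)) then inverse (H_inv \<nu> (1 / t))
      else if y \<le> D_fun \<nu> t then
        (LEAST s. s \<in> {w_inv \<nu> (2 * exp 1 / t) .. inverse (H_inv \<nu> (1 / t))} \<and>
                  t * s * H_fun \<nu> (inverse s) = y)
      else w_inv \<nu> (2 * exp 1 / t))"

text \<open>The convention \<open>\<nu>(0) = \<infinity>\<close>.\<close>

definition nu_ext :: "(real \<Rightarrow> real) \<Rightarrow> real \<Rightarrow> ereal" where
  "nu_ext \<nu> y = (if y = 0 then \<infinity> else ereal (\<nu> y))"

end

theory Submission
  imports Defs "HOL-Complex_Analysis.Complex_Analysis" "HOL-Real_Asymp.Real_Asymp"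
begin

text \<open>
  Only the law of \<open>S\<^sub>t\<close> at a fixed time \<open>t\<close> enters. Its density \<open>p\<close> satisfies the Steutel identity
  \<open>x p(x) = t \<integral> s \<nu>(s) p(x - s) ds\<close>, read off from the Laplace transform by analytic continuation.
  The Esscher transform \<open>exp (t \<phi>(\<sigma>) - \<sigma> x) p(x)\<close> has mean \<open>t \<phi>'(\<sigma>)\<close> and variance \<open>V = - t \<phi>''(\<sigma>)\<close>;
  by Fourier inversion it is bounded by \<open>C / \<surd>V\<close> and Lipschitz with constant \<open>C / V\<close>. Together with
  its first two moments this produces an interval of length of order \<open>\<surd>V\<close>, to the left of the mean, on
  which it is at least \<open>c / \<surd>V\<close>.

  The Steutel identity is a comparison principle for \<open>exp (l x) p(x)\<close>: a lower bound on an interval of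
  length \<open>r\<close> propagates to the right up to \<open>t \<integral>\<^sub>0\<^sup>r s exp (l s) \<nu>(s) ds\<close>. With \<open>r\<close> of order \<open>\<surd>V\<close> and \<open>l\<close> of
  order \<open>1 / \<surd>V\<close> this gives the lower bounds of (i) and of (ii) near \<open>t b(t)\<close>; with \<open>r = \<theta>\<close> and \<open>l\<close> of
  order \<open>1 / \<theta>\<close> it gives the exponential term of (ii). The corresponding minimum principle with a
  single large jump as source gives \<open>p \<ge> c t \<nu>(y)\<close>, and the maximum principle, with jumps truncated at
  a small multiple of \<open>y\<close>, gives the upper bounds to the right of \<open>t b(t)\<close>.
\<close>

section \<open>Differentiation under the integral and Fourier inversion\<close>

text \<open>What makes all constants independent of \<open>t\<close> is one consequence of the lower
  scaling: \<open>r\<^sup>2 * w r\<close> is at most a multiple of the truncated second moment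
  \<open>K r\<close>. Hence \<open>H u\<close> and \<open>u\<^sup>2 * \<phi>2 u\<close> are
  comparable, H grows at least like a power \<gamma> > 0, and the characteristic functions of the
  Esscher transforms share, in units of the standard deviation, one integrable envelope as soon as t
  H(\<sigma>) >= 1. For the tilt with mean x this condition is exactly x <= t b(t).

  The obstacle in the lower bounds is that the Steutel identity carries a bound only to the right,
  and only as far as the truncated mean. So the starting interval must lie to the left of the
  target, and the jumps must be tilted further to raise the truncated mean; an extra tilt l over a
  distance d costs exp(-l d). With l of order 1 / d the loss is bounded, with l of order 1 /
  \<theta> it is the exponential in (ii). The scale \<theta> is where t \<theta> H(1/\<theta>)
  balances y. The identity holds only almost everywhere, so each use passes through
  continuity.\<close>

lemma has_field_derivative_integral:
  fixes f :: "'a::{real_normed_field,banach,second_countable_topology} \<Rightarrow> 'b \<Rightarrow> 'a"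
  assumes e: "e > 0"
    and int: "\<And>z. z \<in> ball z0 e \<Longrightarrow> integrable M (f z)"
    and meas: "f' z0 \<in> borel_measurable M"
    and B: "integrable M B"
    and der: "AE s in M. \<forall>z\<in>ball z0 e. ((\<lambda>z. f z s) has_field_derivative f' z s) (at z) \<and> norm (f' z s) \<le> B s"
  shows "((\<lambda>z. \<integral>s. f z s \<partial>M) has_field_derivative (\<integral>s. f' z0 s \<partial>M)) (at z0)"
proof -
  have "(\<lambda>n. ((\<integral>s. f (z0 + X n) s \<partial>M) - (\<integral>s. f z0 s \<partial>M)) / X n) \<longlonglongrightarrow> (\<integral>s. f' z0 s \<partial>M)"
    if nz: "\<And>n. X n \<noteq> 0" and X: "X \<longlonglongrightarrow> 0" for X :: "nat \<Rightarrow> 'a"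
  proof -
    \<comment> \<open>Domination is wanted for every n, but the mean value inequality bounds the
      difference quotient by \<open>B\<close> only when z0 + X n lies in the ball. The finitely many
      other indices are filled with the limit f' z0.\<close>
    define q where "q n s = (if norm (X n) < e then (f (z0 + X n) s - f z0 s) / X n else f' z0 s)" for n s
    have ev: "eventually (\<lambda>n. norm (X n) < e) sequentially"
      using X e by (metis (no_types, lifting) LIMSEQ_iff_nz eventually_sequentially diff_zero norm_conv_dist dist_norm tendstoD eventually_mono)
    have inball: "z0 + X n \<in> ball z0 e" if "norm (X n) < e" for n
      using that by (simp add: dist_norm)
    have "(\<lambda>n. \<integral>s. q n s \<partial>M) \<longlonglongrightarrow> (\<integral>s. f' z0 s \<partial>M)"
    proof (rule integral_dominated_convergence[where w=B])
      show "q n \<in> borel_measurable M" for n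
      proof (cases "norm (X n) < e")
        case True
        have "integrable M (f (z0 + X n))" "integrable M (f z0)"
          using int[OF inball[OF True]] int[of z0] e by auto
        then show ?thesis unfolding q_def using True by (auto dest!: borel_measurable_integrable)
      next
        case False then show ?thesis unfolding q_def using meas by simp
      qed
      show "AE s in M. (\<lambda>n. q n s) \<longlonglongrightarrow> f' z0 s"
        using der
      proof eventually_elim
        case (elim s)
        then have "((\<lambda>z. f z s) has_field_derivative f' z0 s) (at z0)" using e by auto
        then have "((\<lambda>h. (f (z0 + h) s - f z0 s) / h) \<longlongrightarrow> f' z0 s) (at 0)"
          by (simp add: DERIV_def)
        then have "(\<lambda>n. (f (z0 + X n) s - f z0 s) / X n) \<longlonglongrightarrow> f' z0 s"
          using nz X unfolding tendsto_at_iff_sequentially by (auto simp: o_def)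
        moreover have "\<forall>\<^sub>F n in sequentially. (f (z0 + X n) s - f z0 s) / X n = q n s"
          using ev by eventually_elim (simp add: q_def)
        ultimately show ?case by (rule Lim_transform_eventually)
      qed
      show "AE s in M. norm (q n s) \<le> B s" for n
        using der
      proof eventually_elim
        case (elim s)
        show ?case
        proof (cases "norm (X n) < e")
          case True
          have "norm (f (z0 + X n) s - f z0 s) \<le> B s * norm (z0 + X n - z0)"
            by (rule field_differentiable_bound[of "ball z0 e" "\<lambda>z. f z s" "\<lambda>z. f' z s"])
               (use elim inball[OF True] e in \<open>auto intro: has_field_derivative_at_within\<close>)
          then show ?thesis using nz[of n] True by (simp add: q_def norm_divide field_simps)
        next
          case False then show ?thesis using elim e by (simp add: q_def)
        qed
      qed
    qed (use meas B in auto)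
    moreover have "\<forall>\<^sub>F n in sequentially. (\<integral>s. q n s \<partial>M) = ((\<integral>s. f (z0 + X n) s \<partial>M) - (\<integral>s. f z0 s \<partial>M)) / X n"
      using ev
    proof eventually_elim
      case (elim n)
      have "integrable M (f (z0 + X n))" "integrable M (f z0)"
        using int[OF inball[OF elim]] int[of z0] e by auto
      then show ?case using elim by (simp add: q_def)
    qed
    ultimately show ?thesis by (rule Lim_transform_eventually)
  qed
  then show ?thesis
    unfolding DERIV_def tendsto_at_iff_sequentially by (auto simp: o_def)
qed

text \<open>The integral of \<open>iexp (-(t * u))\<close> over u from a to b, the kernel of Levy's
  inversion formula. At \<open>t = 0\<close> division by zero makes it 0 instead of b - a, hence the
  separate treatment of t = 0 in the bounds below.\<close>

definition levy_kernel :: "real \<Rightarrow> real \<Rightarrow> real \<Rightarrow> complex" where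
  "levy_kernel a b t = (iexp (-(t * a)) - iexp (-(t * b))) / (\<i> * t)"

lemma norm_iexp_diff: "cmod (iexp a - iexp b) \<le> \<bar>a - b\<bar>"
proof -
  have "iexp a - iexp b = iexp b * (iexp (a - b) - 1)"
    by (simp add: algebra_simps flip: exp_add)
  then have "cmod (iexp a - iexp b) = cmod (iexp (a - b) - 1)"
    by (simp add: norm_mult)
  also have "\<dots> \<le> \<bar>a - b\<bar>" using iexp_approx1[of "a - b" 0] by simp
  finally show ?thesis .
qed

text \<open>Levy inversion gives each probability as a limit of integrals over [-n, n]. The
  difference is taken before the limit, so that only the difference of the two kernels has to be
  dominated. An empty second interval then yields a sup bound, a shifted one a Lipschitz
  bound.\<close>

lemma (in real_distribution) interval_diff_le_char_integral:
  assumes ab: "a \<le> b" "c \<le> d"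
    and at: "\<And>x. measure M {x} = 0"
    and W: "integrable lborel W"
    and le: "\<And>t. t \<noteq> 0 \<Longrightarrow> cmod (levy_kernel a b t - levy_kernel c d t) * cmod (char M t) \<le> W t"
    and W0: "W 0 \<ge> 0"
  shows "\<bar>measure M {a<..b} - measure M {c<..d}\<bar> \<le> 1 / (2 * pi) * (\<integral>t. W t \<partial>lborel)"
proof -
  have *: "(\<lambda>n. 1 / (2 * pi) * (CLBINT t=ereal(-real n)..ereal (real n). levy_kernel u v t * char M t)) \<longlonglongrightarrow> complex_of_real (measure M {u<..v})"
    if "u \<le> v" for u v
    using Levy_Inversion[OF that at at] unfolding levy_kernel_def by simp
  have kint: "interval_lebesgue_integrable lborel (ereal (-real n)) (ereal (real n)) (\<lambda>t. levy_kernel u v t * char M t)" if "u \<le> v" for u v n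
  proof -
    have "set_integrable lborel (einterval (ereal (-real n)) (ereal (real n))) (\<lambda>t. levy_kernel u v t * char M t)"
      unfolding set_integrable_def
    proof (rule Bochner_Integration.integrable_bound[where f="\<lambda>t. indicator (einterval (ereal (-real n)) (ereal (real n))) t * (v - u)"])
      have "set_integrable lborel (einterval (ereal (-real n)) (ereal (real n))) (\<lambda>t. (v - u))"
        by (rule set_integrable_subset[of _ "{-real n..real n}"])
           (auto simp: einterval_def intro!: borel_integrable_atLeastAtMost' continuous_intros)
      then show "integrable lborel (\<lambda>t. indicator (einterval (ereal (-real n)) (ereal (real n))) t * (v - u))"
        unfolding set_integrable_def by simp
      show "AE t in lborel. norm (indicator (einterval (ereal (-real n)) (ereal (real n))) t *\<^sub>R (levy_kernel u v t * char M t)) \<le> norm (indicator (einterval (ereal (-real n)) (ereal (real n))) t * (v - u))"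
      proof (rule AE_I2)
        fix t :: real
        have "cmod (levy_kernel u v t) \<le> v - u"
        proof (cases "t = 0")
          case False
          have "\<bar>-(t * u) - -(t * v)\<bar> = \<bar>t\<bar> * (v - u)"
            using that by (simp add: abs_mult flip: right_diff_distrib)
          then show ?thesis unfolding levy_kernel_def norm_divide
            using norm_iexp_diff[of "-(t * u)" "-(t * v)"] False
            by (simp add: norm_mult divide_simps mult.commute)
        qed (use that in \<open>simp add: levy_kernel_def\<close>)
        moreover have "cmod (char M t) \<le> 1" by (rule cmod_char_le_1)
        ultimately have "cmod (levy_kernel u v t) * cmod (char M t) \<le> (v - u) * 1"
          by (intro mult_mono) (use that in auto)
        then show "norm (indicator (einterval (ereal (-real n)) (ereal (real n))) t *\<^sub>R (levy_kernel u v t * char M t)) \<le> norm (indicator (einterval (ereal (-real n)) (ereal (real n))) t * (v - u))"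
          using that by (auto simp: indicator_def norm_mult)
      qed
      show "(\<lambda>t. indicator (einterval (ereal (-real n)) (ereal (real n))) t *\<^sub>R (levy_kernel u v t * char M t)) \<in> borel_measurable lborel"
        unfolding levy_kernel_def by measurable
    qed
    then show ?thesis by (simp add: interval_lebesgue_integrable_def)
  qed
  have bd: "cmod (1 / (2 * pi) * (CLBINT t=ereal(-real n)..ereal (real n). levy_kernel a b t * char M t)
      - 1 / (2 * pi) * (CLBINT t=ereal(-real n)..ereal (real n). levy_kernel c d t * char M t))
     \<le> 1 / (2 * pi) * (\<integral>t. W t \<partial>lborel)" for n
  proof -
    let ?E = "einterval (ereal (-real n)) (ereal (real n))"
    have "(CLBINT t=ereal(-real n)..ereal (real n). levy_kernel a b t * char M t)
      - (CLBINT t=ereal(-real n)..ereal (real n). levy_kernel c d t * char M t)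
      = (CLBINT t=ereal(-real n)..ereal (real n). levy_kernel a b t * char M t - levy_kernel c d t * char M t)"
      by (rule interval_lebesgue_integral_diff(2)[symmetric]) (use kint ab in auto)
    also have "\<dots> = (\<integral>t. indicator ?E t *\<^sub>R ((levy_kernel a b t - levy_kernel c d t) * char M t) \<partial>lborel)"
      by (simp add: interval_lebesgue_integral_def set_lebesgue_integral_def algebra_simps)
    also have "cmod \<dots> \<le> (\<integral>t. W t \<partial>lborel)"
    proof (rule Bochner_Integration.integral_norm_bound_integral)
      show I: "norm (indicator ?E t *\<^sub>R ((levy_kernel a b t - levy_kernel c d t) * char M t)) \<le> W t" for t
      proof (cases "t = 0")
        case True then show ?thesis using W0 by (simp add: levy_kernel_def)
      next
        case False then have "0 \<le> W t" using le[OF False] by (smt (verit) mult_nonneg_nonneg norm_ge_zero)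
        then show ?thesis using le[OF False] by (auto simp: indicator_def norm_mult)
      qed
      show "integrable lborel (\<lambda>t. indicator ?E t *\<^sub>R ((levy_kernel a b t - levy_kernel c d t) * char M t))"
      proof (rule Bochner_Integration.integrable_bound[OF W])
        show "(\<lambda>t. indicator ?E t *\<^sub>R ((levy_kernel a b t - levy_kernel c d t) * char M t)) \<in> borel_measurable lborel"
          unfolding levy_kernel_def by measurable
      qed (use I in \<open>auto intro!: AE_I2 order_trans[OF _ abs_ge_self]\<close>)
    qed (use W in auto)
    finally show ?thesis by (simp add: norm_divide norm_mult divide_right_mono flip: right_diff_distrib diff_divide_distrib)
  qed
  have "(\<lambda>n. cmod (1 / (2 * pi) * (CLBINT t=ereal(-real n)..ereal (real n). levy_kernel a b t * char M t)
      - 1 / (2 * pi) * (CLBINT t=ereal(-real n)..ereal (real n). levy_kernel c d t * char M t)))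
     \<longlonglongrightarrow> cmod (complex_of_real (measure M {a<..b}) - complex_of_real (measure M {c<..d}))"
    by (intro tendsto_intros *) (use ab in auto)
  then have "cmod (complex_of_real (measure M {a<..b}) - complex_of_real (measure M {c<..d})) \<le> 1 / (2 * pi) * (\<integral>t. W t \<partial>lborel)"
    by (rule LIMSEQ_le_const2) (use bd in blast)
  then show ?thesis by (simp flip: of_real_diff)
qed


lemma measure_density_singleton:
  fixes g :: "real \<Rightarrow> ennreal"
  assumes "g \<in> borel_measurable borel"
  shows "measure (density lborel g) {x} = 0"
proof -
  have "emeasure (density lborel g) {x} = (\<integral>\<^sup>+y. g y * indicator {x} y \<partial>lborel)"
    by (rule emeasure_density) (use assms in auto)
  also have "\<dots> = (\<integral>\<^sup>+(y::real). 0 \<partial>lborel)"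
    by (rule nn_integral_cong_AE) (use AE_lborel_singleton[of x] in \<open>auto simp: indicator_def\<close>)
  finally show ?thesis by (simp add: measure_def)
qed

text \<open>Isolated from the subordinator because every Esscher transform is again an instance. The
  indicator discards the values on (-\<infinity>,0], about which nothing is assumed.\<close>

locale cont_density =
  fixes p :: "real \<Rightarrow> real" and M :: "real measure"
  assumes p_nonneg: "x > 0 \<Longrightarrow> p x \<ge> 0"
    and p_cont: "continuous_on {0<..} p"
    and M_eq: "M = density lborel (\<lambda>x. ennreal (indicator {0<..} x * p x))"
    and M_dist: "real_distribution M"
begin

lemma p0_measurable [measurable]: "(\<lambda>x. indicator {0<..} x * p x) \<in> borel_measurable borel"
proof -
  have "(\<lambda>x. indicator {0<..} x *\<^sub>R p x) \<in> borel_measurable borel"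
    by (rule borel_measurable_continuous_on_indicator) (use p_cont in auto)
  then show ?thesis by simp
qed

lemma measure_interval:
  assumes "x > 0" "e \<ge> 0"
  shows "measure M {x<..x+e} = integral {x..x+e} p"
proof -
  have si: "set_integrable lborel {x..x+e} p"
    by (rule borel_integrable_atLeastAtMost') (use p_cont assms in \<open>auto intro: continuous_on_subset\<close>)
  interpret real_distribution M by (rule M_dist)
  have "measure M {x<..x+e} = (\<integral>y. indicator {x<..x+e} y \<partial>M)" by simp
  also have "\<dots> = (\<integral>y. (indicator {0<..} y * p y) *\<^sub>R indicator {x<..x+e} y \<partial>lborel)"
    unfolding M_eq
  proof (rule integral_density)
    show "AE x in lborel. 0 \<le> indicator {0<..} x * p x"
      using p_nonneg by (auto simp: indicator_def)
  qed measurable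
  also have "\<dots> = (\<integral>y. indicator {x..x+e} y *\<^sub>R p y \<partial>lborel)"
  proof (rule integral_cong_AE)
    show "(\<lambda>y. indicator {x..x+e} y *\<^sub>R p y) \<in> borel_measurable lborel"
      using si unfolding set_integrable_def by (rule borel_measurable_integrable)
    show "AE y in lborel. (indicator {0<..} y * p y) *\<^sub>R indicator {x<..x+e} y = indicator {x..x+e} y *\<^sub>R p y"
      using AE_lborel_singleton[of x] by eventually_elim (use assms in \<open>auto simp: indicator_def\<close>)
  qed measurable
  also have "\<dots> = integral {x..x+e} p"
    using set_borel_integral_eq_integral(2)[OF si] unfolding set_lebesgue_integral_def .
  finally show ?thesis .
qed

text \<open>Inversion controls interval probabilities only; differentiating them at the left
  endpoint returns the pointwise values of p.\<close>

lemma measure_interval_tendsto: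
  assumes "x > 0"
  shows "((\<lambda>e. measure M {x<..x+e} / e) \<longlongrightarrow> p x) (at_right 0)"
proof -
  have "((\<lambda>u. integral {x..u} p) has_real_derivative p x) (at x within {x..x+1})"
    by (rule integral_has_real_derivative) (use p_cont assms in \<open>auto intro: continuous_on_subset\<close>)
  then have "((\<lambda>u. (integral {x..u} p - integral {x..x} p) / (u - x)) \<longlongrightarrow> p x) (at x within {x..x+1})"
    by (simp add: has_field_derivative_iff)
  then have "((\<lambda>u. integral {x..u} p / (u - x)) \<longlongrightarrow> p x) (at_right x)"
    by (simp add: at_within_Icc_at_right)
  then have "((\<lambda>e. integral {x..x+e} p / e) \<longlongrightarrow> p x) (at_right 0)"
    by (simp add: filterlim_at_right_to_0[of _ _ x] add.commute)
  then show ?thesis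
    by (rule Lim_transform_eventually)
       (auto simp: eventually_at_filter measure_interval[OF assms] intro!: always_eventually)
qed

lemma M_singleton: "measure M {x} = 0"
  unfolding M_eq by (rule measure_density_singleton) measurable

lemma p_le_char_integral:
  assumes G: "integrable lborel G" and le: "\<And>t. cmod (char M t) \<le> G t" and x: "x > 0"
  shows "p x \<le> (\<integral>t. G t \<partial>lborel) / (2 * pi)"
proof -
  interpret real_distribution M by (rule M_dist)
  have "measure M {x<..x+e} / e \<le> (\<integral>t. G t \<partial>lborel) / (2 * pi)" if e: "e > 0" for e
  proof -
    \<comment> \<open>The second interval is empty, and the kernel of an interval of length e is at
      most e.\<close>
    have "\<bar>measure M {x<..x+e} - measure M {x<..x}\<bar> \<le> 1 / (2 * pi) * (\<integral>t. e * G t \<partial>lborel)"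
    proof (rule interval_diff_le_char_integral)
      fix t :: real assume t: "t \<noteq> 0"
      have "\<bar>-(t * x) - -(t * (x + e))\<bar> = \<bar>t\<bar> * e" using e by (simp add: algebra_simps abs_mult)
      then have "cmod (levy_kernel x (x+e) t) \<le> e" unfolding levy_kernel_def norm_divide
        using norm_iexp_diff[of "-(t * x)" "-(t * (x+e))"] t by (simp add: norm_mult divide_simps mult.commute)
      moreover have "levy_kernel x x t = 0" by (simp add: levy_kernel_def)
      ultimately show "cmod (levy_kernel x (x+e) t - levy_kernel x x t) * cmod (char M t) \<le> e * G t"
        using le[of t] e by (auto intro: mult_mono)
    next
      show "0 \<le> e * G 0" using order_trans[OF norm_ge_zero le[of 0]] e by simp
    qed (use e G M_singleton in auto)
    then show ?thesis using e by (simp add: field_simps)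
  qed
  then have "eventually (\<lambda>e. measure M {x<..x+e} / e \<le> (\<integral>t. G t \<partial>lborel) / (2 * pi)) (at_right 0)"
    by (auto simp: eventually_at_filter)
  then show ?thesis using tendsto_upperbound[OF measure_interval_tendsto[OF x]] by simp
qed

lemma p_lipschitz_char_integral:
  assumes G: "integrable lborel (\<lambda>t. \<bar>t\<bar> * G t)" and le: "\<And>t. cmod (char M t) \<le> G t" and x: "x > 0" "y > 0"
  shows "\<bar>p x - p y\<bar> \<le> \<bar>x - y\<bar> * (\<integral>t. \<bar>t\<bar> * G t \<partial>lborel) / (2 * pi)"
proof -
  interpret real_distribution M by (rule M_dist)
  have *: "\<bar>measure M {x<..x+e} / e - measure M {y<..y+e} / e\<bar> \<le> \<bar>x - y\<bar> * (\<integral>t. \<bar>t\<bar> * G t \<partial>lborel) / (2 * pi)" if e: "e > 0" for e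
  proof -
    have "\<bar>measure M {x<..x+e} - measure M {y<..y+e}\<bar> \<le> 1 / (2 * pi) * (\<integral>t. (e * \<bar>x-y\<bar>) * (\<bar>t\<bar> * G t) \<partial>lborel)"
    proof (rule interval_diff_le_char_integral)
      fix t :: real assume t: "t \<noteq> 0"
      \<comment> \<open>The kernel difference factors into a spatial increment, at most |t| |x - y|,
        and a length increment, at most |t| e. One |t| cancels against the denominator, the other
        becomes the weight in the integral.\<close>
      have "levy_kernel x (x+e) t - levy_kernel y (y+e) t
          = (iexp (-(t * x)) - iexp (-(t * y))) * (iexp 0 - iexp (-(t * e))) / (\<i> * t)"
        unfolding levy_kernel_def diff_divide_distrib[symmetric]
        by (rule arg_cong2[where f="(/)"]) (simp_all add: algebra_simps flip: exp_add)
      then have "cmod (levy_kernel x (x+e) t - levy_kernel y (y+e) t)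
          = cmod (iexp (-(t * x)) - iexp (-(t * y))) * cmod (iexp 0 - iexp (-(t * e))) / \<bar>t\<bar>"
        by (simp add: norm_mult norm_divide)
      also have "\<dots> \<le> (\<bar>t\<bar> * \<bar>x - y\<bar>) * (\<bar>t\<bar> * e) / \<bar>t\<bar>"
      proof (intro divide_right_mono mult_mono)
        show "cmod (iexp (-(t * x)) - iexp (-(t * y))) \<le> \<bar>t\<bar> * \<bar>x - y\<bar>"
        proof -
          have "\<bar>-(t * x) - -(t * y)\<bar> = \<bar>t\<bar> * \<bar>x - y\<bar>"
            by (subst abs_minus_commute[of x y]) (simp flip: abs_mult right_diff_distrib)
          then show ?thesis using norm_iexp_diff[of "-(t * x)" "-(t * y)"] by simp
        qed
        show "cmod (iexp 0 - iexp (-(t * e))) \<le> \<bar>t\<bar> * e"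
          using norm_iexp_diff[of 0 "-(t * e)"] e by (simp add: abs_mult)
      qed (use e in auto)
      also have "\<dots> = e * \<bar>x-y\<bar> * \<bar>t\<bar>" using t by simp
      finally have "cmod (levy_kernel x (x+e) t - levy_kernel y (y+e) t) * cmod (char M t) \<le> (e * \<bar>x-y\<bar> * \<bar>t\<bar>) * G t"
        using le[of t] e by (intro mult_mono) auto
      then show "cmod (levy_kernel x (x+e) t - levy_kernel y (y+e) t) * cmod (char M t) \<le> (e * \<bar>x-y\<bar>) * (\<bar>t\<bar> * G t)"
        by (simp add: mult.assoc)
    qed (use e G M_singleton in auto)
    then have "\<bar>measure M {x<..x+e} - measure M {y<..y+e}\<bar> / e \<le> \<bar>x - y\<bar> * (\<integral>t. \<bar>t\<bar> * G t \<partial>lborel) / (2 * pi)"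
      using e unfolding integral_mult_right_zero
      by (simp only: pos_divide_le_eq) (simp add: ac_simps)
    moreover have "\<bar>measure M {x<..x+e} / e - measure M {y<..y+e} / e\<bar> = \<bar>measure M {x<..x+e} - measure M {y<..y+e}\<bar> / e"
      using e by (simp add: abs_divide flip: diff_divide_distrib)
    ultimately show ?thesis by simp
  qed
  have "((\<lambda>e. \<bar>measure M {x<..x+e} / e - measure M {y<..y+e} / e\<bar>) \<longlongrightarrow> \<bar>p x - p y\<bar>) (at_right 0)"
    by (intro tendsto_intros measure_interval_tendsto x)
  moreover have "eventually (\<lambda>e. \<bar>measure M {x<..x+e} / e - measure M {y<..y+e} / e\<bar> \<le> \<bar>x - y\<bar> * (\<integral>t. \<bar>t\<bar> * G t \<partial>lborel) / (2 * pi)) (at_right 0)"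
    using * by (auto simp: eventually_at_filter)
  ultimately show ?thesis by (rule tendsto_upperbound) simp
qed

end

section \<open>Levy densities and Laplace exponents\<close>

lemma mult_exp_minus_le_1: "x \<ge> 0 \<Longrightarrow> x * exp (- x) \<le> (1::real)"
proof -
  have "x \<le> exp x" using exp_ge_add_one_self[of x] by linarith
  then show ?thesis by (simp add: exp_minus divide_simps)
qed

lemma s_exp_bound:
  assumes "a > 0" "s > (0::real)"
  shows "s * exp (- (a * s)) \<le> 1 / a" "s\<^sup>2 * exp (- (a * s)) \<le> 4 / a\<^sup>2"
proof -
  have *: "b * s * exp (- (b * s)) \<le> 1" if "b > 0" for b using mult_exp_minus_le_1[of "b * s"] that assms by simp
  show "s * exp (- (a * s)) \<le> 1 / a" using *[of a] assms by (simp add: field_simps)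
  have "(a/2 * s * exp (- (a/2 * s)))^2 \<le> 1^2"
    by (rule power_mono) (use *[of "a/2"] assms in auto)
  moreover have "(exp (- (a/2 * s)))^2 = exp (- (a * s))" by (simp flip: exp_of_nat_mult)
  ultimately show "s\<^sup>2 * exp (- (a * s)) \<le> 4 / a\<^sup>2" using assms
    by (simp add: power_mult_distrib power_divide field_simps)
qed

text \<open>The Levy measure is known to integrate \<open>min 1 s\<close>, so integrability against
  it typically comes from a linear bound near 0 combined with a constant bound.\<close>

lemma le_mult_min:
  assumes "f \<le> A * s" "f \<le> B" "0 \<le> A" "0 \<le> B" "0 < (s::real)"
  shows "f \<le> (A + B) * min 1 s"
proof (cases "s \<le> 1")
  case True
  have "0 \<le> B * s" using assms by (intro mult_nonneg_nonneg) auto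
  then have "f \<le> A * s + B * s" using assms(1) by linarith
  then show ?thesis using True by (simp add: min_def distrib_right)
next
  case False
  then show ?thesis using assms by (simp add: min_def)
qed

lemma s_exp_min:
  assumes a: "a > 0" and s: "s > (0::real)"
  shows "s * exp (- (a * s)) \<le> (1 + 1 / a) * min 1 s"
    "s\<^sup>2 * exp (- (a * s)) \<le> (1 / a + 4 / a\<^sup>2) * min 1 s"
proof -
  have e1: "exp (- (a * s)) \<le> 1" using a s by simp
  have "s * exp (- (a * s)) \<le> s * 1" using e1 s by (intro mult_left_mono) auto
  then show "s * exp (- (a * s)) \<le> (1 + 1 / a) * min 1 s"
    using a s s_exp_bound(1)[OF a s] by (intro le_mult_min) auto
  have "s * (s * exp (- (a * s))) \<le> s * (1 / a)"
    using s_exp_bound(1)[OF a s] s by (intro mult_left_mono) auto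
  then show "s\<^sup>2 * exp (- (a * s)) \<le> (1 / a + 4 / a\<^sup>2) * min 1 s"
    using a s s_exp_bound(2)[OF a s] by (intro le_mult_min) (auto simp: power2_eq_square mult_ac)
qed

text \<open>Mean value inequality on the convex right half-plane, where the derivative has modulus
  at most 1.\<close>

lemma norm_one_minus_cexp:
  assumes "Re z \<ge> 0"
  shows "cmod (1 - exp (- z)) \<le> cmod z"
proof -
  have "norm (exp (-z) - exp (-0)) \<le> 1 * norm (z - 0)"
    by (rule field_differentiable_bound[of "{z. Re z \<ge> 0}" "\<lambda>z. exp (- z)" "\<lambda>z. - exp (- z)"])
       (auto intro!: derivative_eq_intros convex_halfspace_Re_ge simp: assms)
  then show ?thesis by (simp add: norm_minus_commute)
qed

lemma ball_Re: "z \<in> ball z0 (Re z0 / 2) \<Longrightarrow> Re z > Re z0 / 2"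
  using abs_Re_le_cmod[of "z0 - z"] by (simp add: dist_norm)

text \<open>For an arbitrary measure on (0,\<infinity>), since the Levy measure \<open>N\<close> and
  the law \<open>Q\<close> are both differentiated in this way.\<close>

lemma laplace_moment_deriv:
  fixes M :: "real measure"
  assumes [measurable_cong]: "sets M = sets borel" and pos: "AE s in M. s > 0" and u: "u > 0"
    and int: "\<And>v. v > 0 \<Longrightarrow> integrable M (\<lambda>s. s ^ k * exp (- (v * s)))"
      "\<And>v. v > 0 \<Longrightarrow> integrable M (\<lambda>s. s ^ Suc k * exp (- (v * s)))"
  shows "((\<lambda>u. \<integral>s. s ^ k * exp (- (u * s)) \<partial>M) has_real_derivative - (\<integral>s. s ^ Suc k * exp (- (u * s)) \<partial>M)) (at u)"
proof -
  have half: "u / 2 < z" if "z \<in> ball u (u/2)" for z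
  proof -
    have "\<bar>u - z\<bar> < u / 2" using that by (simp add: dist_real_def)
    then show ?thesis by linarith
  qed
  have "((\<lambda>u. \<integral>s. s ^ k * exp (- (u * s)) \<partial>M) has_real_derivative (\<integral>s. - (s ^ Suc k * exp (- (u * s))) \<partial>M)) (at u)"
  proof (rule has_field_derivative_integral[where f="\<lambda>u s. s ^ k * exp (- (u * s))" and e="u/2"
      and f'="\<lambda>u s. - (s ^ Suc k * exp (- (u * s)))" and B="\<lambda>s. s ^ Suc k * exp (- (u/2 * s))"])
    show "AE s in M. \<forall>z\<in>ball u (u / 2). ((\<lambda>z. s ^ k * exp (- (z * s))) has_real_derivative - (s ^ Suc k * exp (- (z * s)))) (at z) \<and>
          norm (- (s ^ Suc k * exp (- (z * s)))) \<le> s ^ Suc k * exp (- (u / 2 * s))"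
      using pos
    proof eventually_elim
      case (elim s)
      show ?case
      proof (intro ballI conjI)
        fix z assume "z \<in> ball u (u / 2)"
        then have "u / 2 * s \<le> z * s" using half[of z] elim by (intro mult_right_mono) auto
        then show "norm (- (s ^ Suc k * exp (- (z * s)))) \<le> s ^ Suc k * exp (- (u / 2 * s))"
          using elim by (simp add: abs_mult)
      qed (auto intro!: derivative_eq_intros)
    qed
    show "integrable M (\<lambda>s. s ^ k * exp (- (z * s)))" if "z \<in> ball u (u/2)" for z
      using int(1)[of z] half[OF that] u by simp
    show "integrable M (\<lambda>s. s ^ Suc k * exp (- (u/2 * s)))" by (rule int(2)) (use u in simp)
  qed (use u in auto)
  then show ?thesis by simp
qed

locale levy_dens =
  fixes \<nu> :: "real \<Rightarrow> real"
  assumes levy_density: "levy_density \<nu>" and nu_pos: "s > 0 \<Longrightarrow> \<nu> s > 0"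
begin

text \<open>Extension by zero: \<nu> is unconstrained on (-\<infinity>,0]. With the Levy measure
  \<open>N\<close> as a genuine measure, the later functionals are plain integrals against
  \<open>N\<close>.\<close>

definition \<nu>0 :: "real \<Rightarrow> real" where "\<nu>0 s = indicator {0<..} s * \<nu> s"

definition N :: "real measure" where "N = density lborel (\<lambda>s. ennreal (\<nu>0 s))"

lemma nu_nonneg: "s > 0 \<Longrightarrow> \<nu> s \<ge> 0"
  using levy_density by (simp add: levy_density_def)

lemma nu0_nonneg [simp]: "0 \<le> \<nu>0 s"
  using nu_nonneg by (auto simp: indicator_def \<nu>0_def)

text \<open>Measurability of \<nu> is available only through the integrability of
  \<open>min 1 s * \<nu> s\<close>; dividing by \<open>min 1 s\<close>, which is nonzero on the half
  line, recovers it.\<close>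

lemma nu0_measurable [measurable]: "\<nu>0 \<in> borel_measurable borel"
proof -
  have "(\<lambda>s. indicator {0<..} s *\<^sub>R (min 1 s * \<nu> s)) \<in> borel_measurable borel"
    using levy_density unfolding levy_density_def set_integrable_def
    by (auto dest!: borel_measurable_integrable)
  then have "(\<lambda>s. indicator {0<..} s *\<^sub>R (min 1 s * \<nu> s) / min 1 s) \<in> borel_measurable borel"
    by measurable
  also have "(\<lambda>s. indicator {0<..} s *\<^sub>R (min 1 s * \<nu> s) / min 1 s) = \<nu>0"
    by (auto simp: indicator_def \<nu>0_def fun_eq_iff)
  finally show ?thesis .
qed

lemma sets_N [simp, measurable_cong]: "sets N = sets borel"
  by (simp add: N_def)

lemma space_N [simp]: "space N = UNIV"
  by (simp add: N_def)

lemma N_pos: "AE s in N. s > 0"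
proof -
  have "AE s in lborel. 0 < ennreal (\<nu>0 s) \<longrightarrow> s > 0"
    by (auto simp: \<nu>0_def indicator_def)
  then show ?thesis unfolding N_def by (subst AE_density) measurable
qed

lemma integrable_N_min: "integrable N (\<lambda>s. min 1 s)"
proof -
  have "integrable lborel (\<lambda>s. \<nu>0 s *\<^sub>R min 1 s)"
    using levy_density unfolding levy_density_def set_integrable_def \<nu>0_def by (simp add: mult_ac)
  then show ?thesis unfolding N_def
    by (subst integrable_density) auto
qed

lemma integrable_N:
  fixes f :: "real \<Rightarrow> 'b::{banach,second_countable_topology}"
  assumes "f \<in> borel_measurable borel" "\<And>s. s > 0 \<Longrightarrow> norm (f s) \<le> C * min 1 s"
  shows "integrable N f"
proof (rule Bochner_Integration.integrable_bound[where f="\<lambda>s. C * min 1 s"])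
  show "AE s in N. norm (f s) \<le> norm (C * min 1 s)"
    using N_pos by eventually_elim (use assms(2) in force)
qed (use assms integrable_N_min in auto)

lemma integral_N:
  fixes f :: "real \<Rightarrow> real"
  assumes "f \<in> borel_measurable borel"
  shows "(\<integral>s. f s \<partial>N) = (LBINT s:{0<..}. f s * \<nu> s)"
proof -
  have "(\<integral>s. f s \<partial>N) = (\<integral>s. \<nu>0 s *\<^sub>R f s \<partial>lborel)"
    unfolding N_def by (rule integral_density) (use assms in auto)
  then show ?thesis by (simp add: set_lebesgue_integral_def \<nu>0_def mult_ac)
qed

text \<open>Since \<nu> > 0, a property that holds \<open>N\<close>-almost everywhere holds
  Lebesgue-almost everywhere on (0,\<infinity>). A vanishing integral would make (0,1) a null
  set.\<close>

lemma integral_N_pos: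
  fixes f :: "real \<Rightarrow> real"
  assumes "integrable N f" and pos: "\<And>s. s > 0 \<Longrightarrow> f s > 0"
  shows "(\<integral>s. f s \<partial>N) > 0"
proof (rule ccontr)
  have nn: "AE s in N. 0 \<le> f s" using N_pos by eventually_elim (use pos in \<open>auto intro: less_imp_le\<close>)
  assume "\<not> (\<integral>s. f s \<partial>N) > 0"
  moreover have "(\<integral>s. f s \<partial>N) \<ge> 0" by (rule integral_nonneg_AE[OF nn])
  ultimately have "AE s in N. f s = 0" using integral_nonneg_eq_0_iff_AE[OF assms(1) nn] by simp
  then have "AE s in N. False" using N_pos by eventually_elim (use pos in force)
  then have "AE s in lborel. 0 < ennreal (\<nu>0 s) \<longrightarrow> False" unfolding N_def by (subst (asm) AE_density) auto
  then have "AE s in lborel. s \<notin> {0<..<1::real}"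
    by eventually_elim (auto simp: \<nu>0_def nu_pos)
  then have "emeasure lborel {s. \<not> s \<notin> {0<..<1::real}} = 0" by (subst (asm) AE_iff_measurable[OF _ refl]) auto
  also have "{s. \<not> s \<notin> {0<..<1::real}} = {0<..<1}" by auto
  finally show False by simp
qed

text \<open>\<open>\<phi>1\<close> and \<open>\<phi>2\<close> will be \<phi>' and -\<phi>'', and
  \<open>H\<close> will be \<phi> - u \<phi>'. Writing each as one integral with a nonnegative
  integrand allows pointwise comparison under the integral sign.\<close>

definition \<phi> :: "real \<Rightarrow> real" where "\<phi> u = (\<integral>s. 1 - exp (- (u * s)) \<partial>N)"
definition \<phi>1 :: "real \<Rightarrow> real" where "\<phi>1 u = (\<integral>s. s * exp (- (u * s)) \<partial>N)"
definition \<phi>2 :: "real \<Rightarrow> real" where "\<phi>2 u = (\<integral>s. s\<^sup>2 * exp (- (u * s)) \<partial>N)"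
definition H :: "real \<Rightarrow> real" where "H u = (\<integral>s. 1 - (1 + u * s) * exp (- (u * s)) \<partial>N)"

definition \<Phi> :: "complex \<Rightarrow> complex" where "\<Phi> z = (\<integral>s. 1 - exp (- (z * of_real s)) \<partial>N)"
definition \<Phi>1 :: "complex \<Rightarrow> complex" where "\<Phi>1 z = (\<integral>s. of_real s * exp (- (z * of_real s)) \<partial>N)"

lemma laplace_exponent_eq: "laplace_exponent \<nu> u = \<phi> u"
  unfolding laplace_exponent_def \<phi>_def by (subst integral_N) auto

lemma integrable_s_exp:
  assumes "u > 0"
  shows "integrable N (\<lambda>s. s * exp (- (u * s)))" "integrable N (\<lambda>s. s\<^sup>2 * exp (- (u * s)))"
proof -
  show "integrable N (\<lambda>s. s * exp (- (u * s)))"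
    by (rule integrable_N) (use s_exp_min(1)[OF assms] in \<open>auto simp: abs_mult\<close>)
  show "integrable N (\<lambda>s. s\<^sup>2 * exp (- (u * s)))"
    by (rule integrable_N) (use s_exp_min(2)[OF assms] in \<open>auto simp: abs_mult\<close>)
qed

lemma integrable_one_minus_exp:
  assumes "u \<ge> 0"
  shows "integrable N (\<lambda>s. 1 - exp (- (u * s)))"
proof (rule integrable_N[where C="1 + u"])
  fix s :: real assume s: "s > 0"
  have "1 - exp (- (u * s)) \<le> u * s" using exp_ge_add_one_self[of "- (u * s)"] by simp
  moreover have "1 - exp (- (u * s)) \<le> 1" "1 - exp (- (u * s)) \<ge> 0" using assms s by auto
  moreover have "0 \<le> u * s" using assms s by simp
  ultimately show "norm (1 - exp (- (u * s))) \<le> (1 + u) * min 1 s"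
    using s assms by (auto simp: min_def algebra_simps)
qed measurable

lemma integrable_one_minus_cexp:
  assumes "Re z \<ge> 0"
  shows "integrable N (\<lambda>s. 1 - exp (- (z * of_real s)))"
proof (rule integrable_N[where C="2 + cmod z"])
  fix s :: real assume s: "s > 0"
  have "cmod (1 - exp (- (z * of_real s))) \<le> cmod z * s"
    using norm_one_minus_cexp[of "z * of_real s"] assms s by (simp add: norm_mult)
  moreover have "cmod (1 - exp (- (z * of_real s))) \<le> 1 + cmod (exp (- (z * of_real s)))"
    using norm_triangle_ineq4[of 1 "exp (- (z * of_real s))"] by simp
  moreover have "cmod (exp (- (z * of_real s))) \<le> 1" using assms s by simp
  moreover have "0 \<le> cmod z * s" using s by simp
  ultimately have "cmod (1 - exp (- (z * of_real s))) \<le> cmod z * s" "cmod (1 - exp (- (z * of_real s))) \<le> 2"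
    by linarith+
  then have "cmod (1 - exp (- (z * of_real s))) \<le> (cmod z + 2) * min 1 s"
    using s by (intro le_mult_min) auto
  then show "norm (1 - exp (- (z * of_real s))) \<le> (2 + cmod z) * min 1 s" by (simp add: add.commute)
qed measurable

lemma Phi_deriv:
  assumes "Re z0 > 0"
  shows "(\<Phi> has_field_derivative \<Phi>1 z0) (at z0)"
  unfolding \<Phi>_def \<Phi>1_def
proof (rule has_field_derivative_integral[where f="\<lambda>z s. 1 - exp (- (z * of_real s))" and e="Re z0 / 2"
     and f'="\<lambda>z s. of_real s * exp (- (z * of_real s))" and B="\<lambda>s. s * exp (- (Re z0 / 2 * s))"])
  show "integrable N (\<lambda>s. s * exp (- (Re z0 / 2 * s)))" using integrable_s_exp(1)[of "Re z0 / 2"] assms by simp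
  show "AE s in N. \<forall>z\<in>ball z0 (Re z0 / 2). ((\<lambda>z. 1 - exp (- (z * complex_of_real s))) has_field_derivative complex_of_real s * exp (- (z * complex_of_real s))) (at z)
      \<and> cmod (complex_of_real s * exp (- (z * complex_of_real s))) \<le> s * exp (- (Re z0 / 2 * s))"
    using N_pos
  proof eventually_elim
    case (elim s)
    show ?case
    proof (intro ballI conjI)
      fix z assume z: "z \<in> ball z0 (Re z0 / 2)"
      show "((\<lambda>z. 1 - exp (- (z * complex_of_real s))) has_field_derivative complex_of_real s * exp (- (z * complex_of_real s))) (at z)"
        by (auto intro!: derivative_eq_intros)
      show "cmod (complex_of_real s * exp (- (z * complex_of_real s))) \<le> s * exp (- (Re z0 / 2 * s))"
        using ball_Re[OF z] elim by (simp add: norm_mult)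
    qed
  qed
  show "integrable N (\<lambda>s. 1 - exp (- (z * complex_of_real s)))" if "z \<in> ball z0 (Re z0 / 2)" for z
    by (rule integrable_one_minus_cexp) (use ball_Re[OF that] assms in simp)
qed (use assms in auto)

lemma Phi_of_real: "\<Phi> (of_real u) = of_real (\<phi> u)"
proof -
  have "\<Phi> (of_real u) = (\<integral>s. complex_of_real (1 - exp (- (u * s))) \<partial>N)"
    unfolding \<Phi>_def by (simp flip: exp_of_real)
  then show ?thesis by (simp only: integral_complex_of_real \<phi>_def)
qed

lemma Phi1_of_real: "\<Phi>1 (of_real u) = of_real (\<phi>1 u)"
proof -
  have "\<Phi>1 (of_real u) = (\<integral>s. complex_of_real (s * exp (- (u * s))) \<partial>N)"
    unfolding \<Phi>1_def by (simp flip: exp_of_real)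
  then show ?thesis by (simp only: integral_complex_of_real \<phi>1_def)
qed

end

text \<open>On the ball of radius Re z0 / 2 one has x exp(-Re z x) <= 2 / Re z0, so a constant
  dominates the derivative and the finite mass of \<open>Q\<close> is enough.\<close>

lemma laplace_transform_deriv:
  fixes Q :: "real measure" and z0 :: complex
  assumes "prob_space Q" and [measurable_cong]: "sets Q = sets borel" and pos: "AE x in Q. x > 0" and z0: "Re z0 > 0"
  shows "((\<lambda>z. \<integral>x. exp (- (z * of_real x)) \<partial>Q) has_field_derivative (\<integral>x. - of_real x * exp (- (z0 * of_real x)) \<partial>Q)) (at z0)"
proof (rule has_field_derivative_integral[where f="\<lambda>z x. exp (- (z * of_real x))" and e="Re z0 / 2"
     and f'="\<lambda>z x. - of_real x * exp (- (z * of_real x))" and B="\<lambda>x. 2 / Re z0"])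
  interpret Q: prob_space Q by fact
  show "integrable Q (\<lambda>x. 2 / Re z0)" by simp
  show "AE x in Q. \<forall>z\<in>ball z0 (Re z0 / 2). ((\<lambda>z. exp (- (z * complex_of_real x))) has_field_derivative - complex_of_real x * exp (- (z * complex_of_real x))) (at z)
      \<and> cmod (- complex_of_real x * exp (- (z * complex_of_real x))) \<le> 2 / Re z0"
    using pos
  proof eventually_elim
    case (elim x)
    have "x * exp (- (Re z * x)) \<le> 2 / Re z0" if "z \<in> ball z0 (Re z0 / 2)" for z
    proof -
      have "Re z0 / 2 * x \<le> Re z * x" using ball_Re[OF that] elim by (intro mult_right_mono) auto
      then have "x * exp (- (Re z * x)) \<le> x * exp (- (Re z0 / 2 * x))" using elim by simp
      also have "\<dots> \<le> 2 / Re z0"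
        using exp_ge_add_one_self[of "Re z0 / 2 * x"] z0 by (simp add: exp_minus field_simps)
      finally show ?thesis .
    qed
    then show ?case using elim
      by (auto simp: norm_mult intro!: derivative_eq_intros)
  qed
  show "integrable Q (\<lambda>x. exp (- (z * complex_of_real x)))" if "z \<in> ball z0 (Re z0 / 2)" for z
  proof (rule Q.integrable_const_bound[where B=1])
    show "AE x in Q. cmod (exp (- (z * complex_of_real x))) \<le> 1"
      using pos by eventually_elim (use ball_Re[OF that] z0 in auto)
  qed measurable
qed (use z0 in auto)

section \<open>The Steutel identity\<close>

lemma char_convolution:
  fixes A B :: "real measure"
  assumes "real_distribution A" "real_distribution B"
  shows "char (A \<star> B) t = char A t * char B t"
proof -
  interpret A: real_distribution A by fact
  interpret B: real_distribution B by fact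
  interpret P: pair_prob_space A B ..
  have "char (A \<star> B) t = (\<integral>z. iexp (t * (fst z + snd z)) \<partial>(A \<Otimes>\<^sub>M B))"
    unfolding char_def convolution_def by (subst integral_distr) (auto simp: case_prod_beta)
  also have "\<dots> = (\<integral>x. (\<integral>y. iexp (t * (x + y)) \<partial>B) \<partial>A)"
    by (subst P.integral_fst'[symmetric]) (auto intro!: P.integrable_const_bound[where B=1])
  also have "\<dots> = (\<integral>x. (\<integral>y. iexp (t * x) * iexp (t * y) \<partial>B) \<partial>A)"
    by (simp add: distrib_left exp_add)
  also have "\<dots> = char A t * char B t"
    unfolding char_def by simp
  finally show ?thesis .
qed

lemma real_distribution_convolution:
  fixes A B :: "real measure"
  assumes "real_distribution A" "real_distribution B"
  shows "real_distribution (A \<star> B)"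
proof -
  interpret A: real_distribution A by fact
  interpret B: real_distribution B by fact
  interpret P: pair_prob_space A B ..
  have "prob_space (A \<star> B)" unfolding convolution_def by (rule P.prob_space_distr) measurable
  then show ?thesis by (simp add: real_distribution_def real_distribution_axioms_def)
qed

locale sub_density = levy_dens \<nu> + cont_density p Q for \<nu> p Q +
  fixes t :: real
  assumes t_pos: "t > 0"
    and laplace: "u \<ge> 0 \<Longrightarrow> (\<integral>x. exp (- (u * x)) \<partial>Q) = exp (- (t * \<phi> u))"
begin

lemma sets_Q [measurable_cong, simp]: "sets Q = sets borel"
  by (simp add: M_eq)

lemma prob_Q: "prob_space Q"
  using M_dist by (simp add: real_distribution_def)

text \<open>Extension by zero, so that convolutions with the jumps can be written over the whole
  line.\<close>

definition p0 :: "real \<Rightarrow> real" where "p0 x = indicator {0<..} x * p x"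

lemma p0_nonneg [simp]: "0 \<le> p0 x"
  using p_nonneg by (auto simp: indicator_def p0_def)

lemma p0_meas [measurable]: "p0 \<in> borel_measurable borel"
  unfolding p0_def[abs_def] by (rule p0_measurable)

lemma Q_eq: "Q = density lborel (\<lambda>x. ennreal (p0 x))"
  unfolding M_eq p0_def ..

lemma Q_pos: "AE x in Q. x > 0"
proof -
  have "AE x in lborel. 0 < ennreal (p0 x) \<longrightarrow> x > 0"
    by (auto simp: p0_def indicator_def)
  then show ?thesis unfolding Q_eq by (subst AE_density) measurable
qed

text \<open>Identity theorem on the half-plane Re z > 0: both sides are holomorphic there and agree
  on the positive reals, which accumulate at 1.\<close>

lemma laplace_complex:
  assumes "Re z > 0"
  shows "(\<integral>x. exp (- (z * of_real x)) \<partial>Q) = exp (- (of_real t * \<Phi> z))"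
proof -
  let ?F = "\<lambda>z. (\<integral>x. exp (- (z * of_real x)) \<partial>Q)"
  let ?S = "{z. Re z > 0}"
  let ?U = "complex_of_real ` {0<..}"
  have "?F z - exp (- (of_real t * \<Phi> z)) = 0"
  proof (rule analytic_continuation[of "\<lambda>z. ?F z - exp (- (of_real t * \<Phi> z))" ?S ?U 1 z])
    have "(?F has_field_derivative (\<integral>x. - of_real x * exp (- (w * of_real x)) \<partial>Q)) (at w)" if "w \<in> ?S" for w
      by (rule laplace_transform_deriv) (use that Q_pos prob_Q in auto)
    then have "?F holomorphic_on ?S"
      unfolding holomorphic_on_def field_differentiable_def by (blast intro: has_field_derivative_at_within)
    moreover have "\<Phi> holomorphic_on ?S"
      unfolding holomorphic_on_def field_differentiable_def by (blast intro: has_field_derivative_at_within Phi_deriv)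
    ultimately show "(\<lambda>z. ?F z - exp (- (of_real t * \<Phi> z))) holomorphic_on ?S"
      by (intro holomorphic_intros)
    show "open ?S" by (rule open_halfspace_Re_gt)
    show "connected ?S" by (intro convex_connected convex_halfspace_Re_gt)
    show "?U \<subseteq> ?S" by auto
    show "1 islimpt ?U"
      unfolding islimpt_approachable
    proof (intro allI impI)
      fix e :: real assume "e > 0"
      have "complex_of_real (1 + e/2) - 1 = complex_of_real (e/2)" by simp
      then have "dist (complex_of_real (1 + e/2)) 1 = norm (complex_of_real (e/2))" unfolding dist_norm by (rule arg_cong)
      then have "dist (complex_of_real (1 + e/2)) 1 = e / 2" using \<open>e > 0\<close> by (simp only: norm_of_real abs_of_pos half_gt_zero)
      moreover have "complex_of_real (1 + e/2) \<in> ?U" using \<open>e > 0\<close> by (intro imageI) simp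
      moreover have "complex_of_real (1 + e/2) \<noteq> 1"
        using calculation(1) \<open>e > 0\<close> by auto
      moreover have "e / 2 < e" using \<open>e > 0\<close> by simp
      ultimately show "\<exists>x'\<in>?U. x' \<noteq> 1 \<and> dist x' 1 < e" by (intro bexI[of _ "complex_of_real (1 + e/2)"]) auto
    qed
    show "?F w - exp (- (of_real t * \<Phi> w)) = 0" if w: "w \<in> ?U" for w
    proof -
      obtain u where u: "w = of_real u" "u > 0" using w by auto
      have "?F w = (\<integral>x. complex_of_real (exp (- (u * x))) \<partial>Q)"
        unfolding u by (simp flip: exp_of_real)
      also have "\<dots> = of_real (exp (- (t * \<phi> u)))"
        using laplace[of u] u by (simp only: integral_complex_of_real less_imp_le)
      also have "\<dots> = exp (- (of_real t * \<Phi> w))"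
        unfolding u Phi_of_real by (simp flip: exp_of_real)
      finally show ?thesis by simp
    qed
  qed (use assms in auto)
  then show ?thesis by simp
qed

lemma laplace_complex_deriv:
  assumes "Re z > 0"
  shows "(\<integral>x. of_real x * exp (- (z * of_real x)) \<partial>Q) = of_real t * \<Phi>1 z * exp (- (of_real t * \<Phi> z))"
proof -
  have 1: "((\<lambda>z. \<integral>x. exp (- (z * of_real x)) \<partial>Q) has_field_derivative (\<integral>x. - of_real x * exp (- (z * of_real x)) \<partial>Q)) (at z)"
    by (rule laplace_transform_deriv) (use assms Q_pos prob_Q in auto)
  have "((\<lambda>z. exp (- (of_real t * \<Phi> z))) has_field_derivative exp (- (of_real t * \<Phi> z)) * (- (of_real t * \<Phi>1 z))) (at z)"
    by (auto intro!: derivative_eq_intros Phi_deriv[OF assms])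
  moreover have "open {z. Re z > 0}" by (rule open_halfspace_Re_gt)
  ultimately have 2: "((\<lambda>z. \<integral>x. exp (- (z * of_real x)) \<partial>Q) has_field_derivative exp (- (of_real t * \<Phi> z)) * (- (of_real t * \<Phi>1 z))) (at z)"
    by (rule has_field_derivative_transform_within_open) (use assms laplace_complex in auto)
  show ?thesis using DERIV_unique[OF 1 2] by (simp add: mult_ac)
qed

definition ps :: "real \<Rightarrow> real \<Rightarrow> real" where "ps \<sigma> x = exp (t * \<phi> \<sigma> - \<sigma> * x) * p x"
definition Qs :: "real \<Rightarrow> real measure" where "Qs \<sigma> = density lborel (\<lambda>x. ennreal (indicator {0<..} x * ps \<sigma> x))"

lemma Qs_eq: "Qs \<sigma> = density Q (\<lambda>x. ennreal (exp (t * \<phi> \<sigma> - \<sigma> * x)))"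
proof -
  have "density Q (\<lambda>x. ennreal (exp (t * \<phi> \<sigma> - \<sigma> * x)))
      = density lborel (\<lambda>x. ennreal (p0 x) * ennreal (exp (t * \<phi> \<sigma> - \<sigma> * x)))"
    unfolding Q_eq by (rule density_density_eq) measurable
  also have "\<dots> = Qs \<sigma>" unfolding Qs_def ps_def p0_def
    by (intro arg_cong[where f="density lborel"] ext)
       (use p_nonneg in \<open>auto simp: indicator_def mult.commute simp flip: ennreal_mult\<close>)
  finally show ?thesis by simp
qed

lemma integrable_Q_exp:
  assumes "u \<ge> 0"
  shows "integrable Q (\<lambda>x. exp (- (u * x)))"
proof -
  interpret prob_space Q by (rule prob_Q)
  show ?thesis
    by (rule integrable_const_bound[where B=1])
       (use Q_pos assms in \<open>auto elim!: eventually_mono\<close>)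
qed

lemma tilted:
  assumes "\<sigma> \<ge> 0"
  shows "cont_density (ps \<sigma>) (Qs \<sigma>)"
proof (rule cont_density.intro)
  show "0 \<le> ps \<sigma> x" if "x > 0" for x using p_nonneg[OF that] by (simp add: ps_def)
  show "continuous_on {0<..} (ps \<sigma>)" unfolding ps_def by (intro continuous_intros p_cont)
  show "Qs \<sigma> = density lborel (\<lambda>x. ennreal (indicat_real {0<..} x * ps \<sigma> x))" by (simp add: Qs_def)
  have int: "integrable Q (\<lambda>x. exp (t * \<phi> \<sigma> - \<sigma> * x))"
    using integrable_mult_right[OF integrable_Q_exp[OF assms], of "exp (t * \<phi> \<sigma>)"] by (simp add: exp_diff exp_minus divide_inverse)
  have "(\<integral>\<^sup>+x. ennreal (exp (t * \<phi> \<sigma> - \<sigma> * x)) \<partial>Q) = ennreal (\<integral>x. exp (t * \<phi> \<sigma> - \<sigma> * x) \<partial>Q)"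
    by (rule nn_integral_eq_integral[OF int]) simp
  also have "(\<integral>x. exp (t * \<phi> \<sigma> - \<sigma> * x) \<partial>Q) = exp (t * \<phi> \<sigma>) * (\<integral>x. exp (- (\<sigma> * x)) \<partial>Q)"
    by (simp add: exp_diff exp_minus divide_inverse)
  also have "\<dots> = 1" using laplace[OF assms] by (simp flip: exp_add)
  finally have "emeasure (Qs \<sigma>) UNIV = 1"
    unfolding Qs_eq by (subst emeasure_density) auto
  then have "prob_space (Qs \<sigma>)" by (intro prob_spaceI) (simp add: Qs_def)
  then show "real_distribution (Qs \<sigma>)" by (simp add: real_distribution_def real_distribution_axioms_def Qs_def)
qed

lemma integral_Qs:
  fixes f :: "real \<Rightarrow> 'b::{banach,second_countable_topology}"
  assumes "f \<in> borel_measurable borel"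
  shows "(\<integral>x. f x \<partial>Qs \<sigma>) = (\<integral>x. exp (t * \<phi> \<sigma> - \<sigma> * x) *\<^sub>R f x \<partial>Q)"
  unfolding Qs_eq by (rule integral_density) (use assms in auto)

lemma char_Qs:
  assumes "\<sigma> > 0"
  shows "char (Qs \<sigma>) \<xi> = exp (of_real t * (of_real (\<phi> \<sigma>) - \<Phi> (Complex \<sigma> (- \<xi>))))"
proof -
  have *: "exp (t * \<phi> \<sigma> - \<sigma> * x) *\<^sub>R iexp (\<xi> * x)
      = exp (of_real (t * \<phi> \<sigma>)) * exp (- (Complex \<sigma> (- \<xi>) * of_real x))" for x
  proof -
    have "of_real (t * \<phi> \<sigma> - \<sigma> * x) + \<i> * of_real (\<xi> * x) = of_real (t * \<phi> \<sigma>) + - (Complex \<sigma> (- \<xi>) * of_real x)"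
      by (simp add: complex_eq_iff)
    then show ?thesis by (simp only: scaleR_conv_of_real exp_of_real[symmetric] exp_add[symmetric])
  qed
  have "char (Qs \<sigma>) \<xi> = (\<integral>x. exp (of_real (t * \<phi> \<sigma>)) * exp (- (Complex \<sigma> (- \<xi>) * of_real x)) \<partial>Q)"
    unfolding char_def using integral_Qs[of "\<lambda>x. iexp (\<xi> * x)" \<sigma>] by (simp only: *) simp
  also have "\<dots> = exp (of_real (t * \<phi> \<sigma>)) * exp (- (of_real t * \<Phi> (Complex \<sigma> (- \<xi>))))"
    using laplace_complex[of "Complex \<sigma> (- \<xi>)"] assms by simp
  also have "\<dots> = exp (of_real t * (of_real (\<phi> \<sigma>) - \<Phi> (Complex \<sigma> (- \<xi>))))"
    unfolding exp_add[symmetric] by (simp add: algebra_simps)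
  finally show ?thesis .
qed


text \<open>Tilting by \<sigma> turns the Levy measure into exp(-\<sigma> s) \<nu>(s) ds. This real
  part decides the modulus of the characteristic function, and its nonnegative integrand can be
  bounded below by small jumps alone.\<close>

lemma Re_Phi_diff:
  assumes "\<sigma> > 0"
  shows "Re (\<Phi> (Complex \<sigma> (- \<xi>))) - \<phi> \<sigma> = (\<integral>s. exp (- (\<sigma> * s)) * (1 - cos (\<xi> * s)) \<partial>N)"
proof -
  have i1: "integrable N (\<lambda>s. 1 - exp (- (Complex \<sigma> (- \<xi>) * of_real s)))"
    by (rule integrable_one_minus_cexp) (use assms in simp)
  have "Re (\<Phi> (Complex \<sigma> (- \<xi>))) = (\<integral>s. Re (1 - exp (- (Complex \<sigma> (- \<xi>) * of_real s))) \<partial>N)"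
    unfolding \<Phi>_def by (rule integral_Re[OF i1, symmetric])
  then have "Re (\<Phi> (Complex \<sigma> (- \<xi>))) - \<phi> \<sigma> = (\<integral>s. Re (1 - exp (- (Complex \<sigma> (- \<xi>) * of_real s))) - (1 - exp (- (\<sigma> * s))) \<partial>N)"
    unfolding \<phi>_def
    by (subst Bochner_Integration.integral_diff) (use integrable_Re[OF i1] integrable_one_minus_exp[of \<sigma>] assms in auto)
  also have "\<dots> = (\<integral>s. exp (- (\<sigma> * s)) * (1 - cos (\<xi> * s)) \<partial>N)"
    by (rule Bochner_Integration.integral_cong) (auto simp: Re_exp right_diff_distrib)
  finally show ?thesis .
qed

lemma cmod_char_Qs:
  assumes "\<sigma> > 0"
  shows "cmod (char (Qs \<sigma>) \<xi>) = exp (- (t * (\<integral>s. exp (- (\<sigma> * s)) * (1 - cos (\<xi> * s)) \<partial>N)))"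
  unfolding char_Qs[OF assms] norm_exp_eq_Re Re_Phi_diff[OF assms, symmetric]
  by (simp add: algebra_simps)

lemma phi1_pos: "u > 0 \<Longrightarrow> \<phi>1 u > 0"
  unfolding \<phi>1_def by (rule integral_N_pos[OF integrable_s_exp(1)]) auto

text \<open>Differentiating exp(-t \<Phi>) produces the product t \<Phi>' exp(-t \<Phi>), that is, a
  convolution. Since s \<nu>(s) ds may have infinite mass, both sides are damped by exp(-x) and
  normalised to probability laws: \<open>A\<close> is the damped size-biased Levy measure,
  \<open>B\<close> the Esscher transform at 1, \<open>C\<close> the size-biased \<open>B\<close>.
  The convolution of \<open>A\<close> and \<open>B\<close> is \<open>C\<close> by uniqueness of
  characteristic functions, and densities are then compared up to null sets.\<close>

theorem steutel_identity:
  "AE x in lborel. ennreal (x * p0 x) = (\<integral>\<^sup>+s. ennreal (t * s * \<nu>0 s * p0 (x - s)) \<partial>lborel)"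
proof -
  define c where "c = \<phi>1 1"
  have c: "c > 0" unfolding c_def by (rule phi1_pos) simp
  define fA where "fA s = s * exp (- s) * \<nu>0 s / c" for s
  define gB where "gB x = exp (t * \<phi> 1 - x) * p0 x" for x
  define gC where "gC x = x * exp (t * \<phi> 1 - x) * p0 x / (t * c)" for x
  have fA0: "fA s \<ge> 0" for s using c by (auto simp: fA_def \<nu>0_def indicator_def nu_nonneg)
  have gC0: "gC x \<ge> 0" for x using c t_pos by (auto simp: gC_def p0_def indicator_def p_nonneg)
  have gB0: "gB x \<ge> 0" for x by (auto simp: gB_def)
  have [measurable]: "fA \<in> borel_measurable borel" "gB \<in> borel_measurable borel" "gC \<in> borel_measurable borel"
    unfolding fA_def[abs_def] gB_def[abs_def] gC_def[abs_def] by measurable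
  define A where "A = density lborel (\<lambda>s. ennreal (fA s))"
  define B where "B = density lborel (\<lambda>s. ennreal (gB s))"
  define C where "C = density lborel (\<lambda>s. ennreal (gC s))"
  have sets[simp]: "sets A = sets borel" "sets B = sets borel" "sets C = sets borel"
    by (simp_all add: A_def B_def C_def)
  have B_Qs: "B = Qs 1"
    unfolding B_def Qs_def by (simp add: gB_def ps_def p0_def mult_ac)
  have RB: "real_distribution B" unfolding B_Qs by (rule cont_density.M_dist[OF tilted]) simp
  have intA: "(\<integral>s. f s \<partial>A) = (\<integral>s. (s * exp (- s) / c) *\<^sub>R f s \<partial>N)" if [measurable]: "f \<in> borel_measurable borel" for f :: "real \<Rightarrow> complex"
  proof -
    have "(\<integral>s. f s \<partial>A) = (\<integral>s. fA s *\<^sub>R f s \<partial>lborel)"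
      unfolding A_def by (rule integral_density) (use fA0 in auto)
    also have "\<dots> = (\<integral>s. \<nu>0 s *\<^sub>R ((s * exp (- s) / c) *\<^sub>R f s) \<partial>lborel)"
      by (simp add: fA_def mult_ac)
    also have "\<dots> = (\<integral>s. (s * exp (- s) / c) *\<^sub>R f s \<partial>N)"
      unfolding N_def by (rule integral_density[symmetric]) auto
    finally show ?thesis .
  qed
  have intC: "(\<integral>x. f x \<partial>C) = (\<integral>x. (x * exp (t * \<phi> 1 - x) / (t * c)) *\<^sub>R f x \<partial>Q)" if [measurable]: "f \<in> borel_measurable borel" for f :: "real \<Rightarrow> complex"
  proof -
    have "(\<integral>s. f s \<partial>C) = (\<integral>s. gC s *\<^sub>R f s \<partial>lborel)"
      unfolding C_def by (rule integral_density) (use gC0 in auto)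
    also have "\<dots> = (\<integral>x. p0 x *\<^sub>R ((x * exp (t * \<phi> 1 - x) / (t * c)) *\<^sub>R f x) \<partial>lborel)"
      by (simp add: gC_def mult_ac)
    also have "\<dots> = (\<integral>x. (x * exp (t * \<phi> 1 - x) / (t * c)) *\<^sub>R f x \<partial>Q)"
      unfolding Q_eq by (rule integral_density[symmetric]) auto
    finally show ?thesis .
  qed
  have charA: "char A \<xi> = \<Phi>1 (Complex 1 (- \<xi>)) / c" for \<xi>
  proof -
    have *: "(s * exp (- s) / c) *\<^sub>R iexp (\<xi> * s) = of_real s * exp (- (Complex 1 (- \<xi>) * of_real s)) / c" for s
    proof -
      have "of_real (- s) + \<i> * of_real (\<xi> * s) = - (Complex 1 (- \<xi>) * of_real s)" by (simp add: complex_eq_iff)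
      then have "of_real (exp (- s)) * iexp (\<xi> * s) = exp (- (Complex 1 (- \<xi>) * of_real s))"
        by (simp only: exp_of_real[symmetric] exp_add[symmetric])
      then show ?thesis by (simp add: scaleR_conv_of_real mult_ac)
    qed
    show ?thesis unfolding char_def using intA[of "\<lambda>s. iexp (\<xi> * s)"] by (simp only: *) (simp add: \<Phi>1_def)
  qed
  have charC: "char C \<xi> = of_real (exp (t * \<phi> 1)) * (of_real t * \<Phi>1 (Complex 1 (- \<xi>)) * exp (- (of_real t * \<Phi> (Complex 1 (- \<xi>))))) / (t * c)" for \<xi>
  proof -
    have *: "(x * exp (t * \<phi> 1 - x) / (t * c)) *\<^sub>R iexp (\<xi> * x)
       = of_real (exp (t * \<phi> 1)) / (t * c) * (of_real x * exp (- (Complex 1 (- \<xi>) * of_real x)))" for x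
    proof -
      have "of_real (t * \<phi> 1 - x) + \<i> * of_real (\<xi> * x) = of_real (t * \<phi> 1) + - (Complex 1 (- \<xi>) * of_real x)" by (simp add: complex_eq_iff)
      then have "of_real (exp (t * \<phi> 1 - x)) * iexp (\<xi> * x) = of_real (exp (t * \<phi> 1)) * exp (- (Complex 1 (- \<xi>) * of_real x))"
        by (simp only: exp_of_real[symmetric] exp_add[symmetric])
      then show ?thesis by (simp add: scaleR_conv_of_real mult_ac)
    qed
    show ?thesis unfolding char_def using intC[of "\<lambda>s. iexp (\<xi> * s)"] laplace_complex_deriv[of "Complex 1 (- \<xi>)"]
      by (simp only: *) simp
  qed
  \<comment> \<open>The mass is finite by integrability, and it equals 1 because it is the value of
    the characteristic function at 0.\<close>
  have char0: "prob_space D" if D: "D = density lborel (\<lambda>x. ennreal (g x))" and [measurable]: "g \<in> borel_measurable borel"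
    and g0: "\<And>x. g x \<ge> 0" and int: "integrable lborel g" and ch: "char D 0 = 1" for D g
  proof -
    have "char D 0 = (\<integral>x. of_real (g x) \<partial>lborel)"
      unfolding char_def D by (subst integral_density) (use g0 in \<open>auto simp: scaleR_conv_of_real\<close>)
    then have "(\<integral>x. g x \<partial>lborel) = 1" using ch by (simp add: integral_complex_of_real)
    then have "emeasure D UNIV = 1" unfolding D
      by (subst emeasure_density) (auto simp: nn_integral_eq_integral[OF int] g0)
    then show ?thesis by (intro prob_spaceI) (simp add: D)
  qed
  have RA: "real_distribution A"
  proof -
    have "integrable N (\<lambda>s. s * exp (- s) / c)" using integrable_s_exp(1)[of 1] by simp
    then have "integrable lborel fA" unfolding N_def
      by (subst (asm) integrable_density) (auto simp: fA_def[abs_def] mult_ac)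
    moreover have "char A 0 = 1" using charA[of 0] c Phi1_of_real[of 1] by (simp add: c_def Complex_eq)
    ultimately have "prob_space A" by (intro char0[OF A_def _ fA0]) auto
    then show ?thesis by (simp add: real_distribution_def real_distribution_axioms_def)
  qed
  have RC: "real_distribution C"
  proof -
    interpret prob_space Q by (rule prob_Q)
    have "integrable Q (\<lambda>x. x * exp (- x))"
      by (rule integrable_const_bound[where B=1]) (use Q_pos in \<open>auto elim!: eventually_mono simp: mult_exp_minus_le_1\<close>)
    then have "integrable Q (\<lambda>x. exp (t * \<phi> 1) / (t * c) * (x * exp (- x)))" by simp
    then have "integrable Q (\<lambda>x. x * exp (t * \<phi> 1 - x) / (t * c))" by (simp add: exp_diff exp_minus divide_inverse mult_ac)
    then have "integrable lborel gC" unfolding Q_eq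
      by (subst (asm) integrable_density) (auto simp: gC_def[abs_def] mult_ac)
    moreover have "char C 0 = 1"
    proof -
      have "Complex 1 0 = of_real 1" by (simp add: complex_eq_iff)
      moreover have "exp (- (complex_of_real t * complex_of_real (\<phi> 1))) = of_real (exp (- (t * \<phi> 1)))"
        unfolding exp_of_real[symmetric] by simp
      ultimately show ?thesis using charC[of 0] c t_pos Phi1_of_real[of 1] Phi_of_real[of 1]
        by (simp add: c_def flip: of_real_mult exp_add)
    qed
    ultimately have "prob_space C" by (intro char0[OF C_def _ gC0]) auto
    then show ?thesis by (simp add: real_distribution_def real_distribution_axioms_def)
  qed
  have "char (A \<star> B) = char C"
  proof
    fix \<xi>
    have "char (A \<star> B) \<xi> = char A \<xi> * char B \<xi>" by (rule char_convolution[OF RA RB])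
    also have "\<dots> = char C \<xi>" unfolding charA charC B_Qs char_Qs[OF zero_less_one]
        right_diff_distrib exp_diff exp_minus of_real_mult[symmetric] exp_of_real using t_pos c
      by (simp add: field_simps)
    finally show "char (A \<star> B) \<xi> = char C \<xi>" .
  qed
  then have "A \<star> B = C" by (rule Levy_uniqueness[OF real_distribution_convolution[OF RA RB] RC])
  then have eq: "density lborel (\<lambda>x. \<integral>\<^sup>+y. ennreal (fA (x - y)) * ennreal (gB y) \<partial>lborel) = density lborel (\<lambda>x. ennreal (gC x))"
    unfolding A_def B_def C_def
    by (subst (asm) convolution_density)
       (use RA RB in \<open>auto simp: A_def B_def real_distribution_def prob_space_def\<close>)
  have "AE x in lborel. (\<integral>\<^sup>+y. ennreal (fA (x - y)) * ennreal (gB y) \<partial>lborel) = ennreal (gC x)"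
    by (rule sigma_finite_measure.density_unique[OF lborel.sigma_finite_measure_axioms _ _ eq]) auto
  then show ?thesis
  proof eventually_elim
    case (elim x)
    \<comment> \<open>Undoes the normalisations and the damping: exp(-s) from \<open>fA\<close> and
      exp(-(x - s)) from \<open>gB\<close> combine to exp(-x), independent of s.\<close>
    define k where "k = t * c * exp (x - t * \<phi> 1)"
    have k: "k > 0" using c t_pos by (simp add: k_def)
    have "(\<integral>\<^sup>+s. ennreal (t * s * \<nu>0 s * p0 (x - s)) \<partial>lborel) = (\<integral>\<^sup>+s. ennreal k * (ennreal (fA s) * ennreal (gB (x - s))) \<partial>lborel)"
    proof (rule nn_integral_cong)
      fix s
      have "exp (x - t * \<phi> 1) * (exp (- s) * exp (t * \<phi> 1 - (x - s))) = 1"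
        unfolding exp_add[symmetric] by simp
      then have "t * s * \<nu>0 s * p0 (x - s) = k * (fA s * gB (x - s))"
        using c by (simp add: k_def fA_def gB_def field_simps)
      then show "ennreal (t * s * \<nu>0 s * p0 (x - s)) = ennreal k * (ennreal (fA s) * ennreal (gB (x - s)))"
        using k fA0 gB0 by (simp add: ennreal_mult)
    qed
    also have "\<dots> = ennreal k * (\<integral>\<^sup>+s. ennreal (fA s) * ennreal (gB (x - s)) \<partial>lborel)"
      by (rule nn_integral_cmult) measurable
    also have "(\<integral>\<^sup>+s. ennreal (fA s) * ennreal (gB (x - s)) \<partial>lborel) = (\<integral>\<^sup>+y. ennreal (fA (x - y)) * ennreal (gB y) \<partial>lborel)"
      by (subst nn_integral_real_affine[where c="-1" and t=x]) auto
    also have "ennreal k * \<dots> = ennreal (k * gC x)"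
      unfolding elim using k gC0 by (simp add: ennreal_mult)
    also have "k * gC x = x * p0 x"
    proof -
      have "exp (x - t * \<phi> 1) * exp (t * \<phi> 1 - x) = 1" unfolding exp_add[symmetric] by simp
      then show ?thesis using c t_pos by (simp add: k_def gC_def)
    qed
    finally show ?case by simp
  qed
qed

end

section \<open>The function H and truncated moments\<close>

text \<open>The integrand of \<open>H\<close> at x = u s; its comparability with
  \<open>min 1 (x\<^sup>2)\<close> is what relates H to truncated moments.\<close>

definition g_fun :: "real \<Rightarrow> real" where "g_fun x = 1 - (1 + x) * exp (- x)"

lemma g_fun_ge: "x \<ge> 0 \<Longrightarrow> x\<^sup>2 * exp (- x) / 2 \<le> g_fun x"
  using exp_lower_Taylor_quadratic[of x] by (simp add: g_fun_def exp_minus field_simps)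

lemma g_fun_le: "x \<ge> 0 \<Longrightarrow> g_fun x \<le> x\<^sup>2" "x \<ge> 0 \<Longrightarrow> g_fun x \<le> 1"
proof -
  assume x: "x \<ge> 0"
  have "(1 + x) * (1 - x) \<le> (1 + x) * exp (- x)"
    using exp_ge_add_one_self[of "-x"] x by (intro mult_left_mono) auto
  then show "g_fun x \<le> x\<^sup>2" by (simp add: g_fun_def algebra_simps power2_eq_square)
  show "g_fun x \<le> 1" using x by (simp add: g_fun_def)
qed

text \<open>Up to 1 the factor exp(-x) is at least 1/e; beyond 1 the maximum 2/e of (1 + x) exp(-x),
  at x = 1, leaves 2e - 4 >= 1, using e >= 5/2. The constant 2e is the one in
  \<open>w_inv \<nu> (2 * exp 1 / t)\<close> and makes that point at most
  \<open>h t\<close>.\<close>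

lemma g_fun_min: assumes "x \<ge> 0" shows "min 1 (x\<^sup>2) \<le> 2 * exp 1 * g_fun x"
proof (cases "x \<le> 1")
  case True
  have "x\<^sup>2 * 1 \<le> x\<^sup>2 * (exp 1 * exp (-x))" unfolding exp_add[symmetric] using True by (intro mult_left_mono) auto
  also have "\<dots> \<le> 2 * exp 1 * g_fun x" using g_fun_ge[OF assms] by (simp add: field_simps)
  finally show ?thesis by simp
next
  case False
  then have x: "x \<ge> 1" by simp
  have "(1 + x) * exp (-x) \<le> 2 * exp (-1)"
  proof -
    have "1 + x \<le> 2 * exp (x - 1)" using exp_ge_add_one_self[of "x - 1"] x by simp
    then have "(1 + x) * exp (-x) \<le> 2 * exp (x - 1) * exp (-x)" by (intro mult_right_mono) auto
    also have "\<dots> = 2 * exp (-1)" by (simp flip: exp_add add: mult.assoc)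
    finally show ?thesis .
  qed
  then have "exp 1 * ((1 + x) * exp (-x)) \<le> exp 1 * (2 * exp (-1))" by (intro mult_left_mono) auto
  also have "\<dots> = (2::real)" by (simp flip: exp_add)
  finally have "2 * exp 1 * g_fun x \<ge> 2 * exp 1 - 4" by (simp add: g_fun_def algebra_simps)
  moreover have "exp 1 \<ge> (1 + 1 + 1 / 2 :: real)" using exp_lower_Taylor_quadratic[of 1] by simp
  ultimately show ?thesis by (simp add: min_def)
qed

lemma g_fun_nonneg: "x \<ge> 0 \<Longrightarrow> g_fun x \<ge> 0"
  using g_fun_ge[of x] by (smt (verit) divide_nonneg_pos mult_nonneg_nonneg exp_ge_zero zero_le_power2)

section \<open>Derivatives of \<phi> and H, and truncated moments of a positive Levy density\<close>

context levy_dens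
begin

lemma phi_deriv:
  assumes "u > 0" shows "(\<phi> has_real_derivative \<phi>1 u) (at u)"
  unfolding \<phi>_def[abs_def] \<phi>1_def
proof (rule has_field_derivative_integral[where f="\<lambda>u s. 1 - exp (- (u * s))" and e="u/2"
    and f'="\<lambda>u s. s * exp (- (u * s))" and B="\<lambda>s. s * exp (- (u/2 * s))"])
  show "AE s in N. \<forall>z\<in>ball u (u / 2). ((\<lambda>z. 1 - exp (- (z * s))) has_real_derivative s * exp (- (z * s))) (at z) \<and>
        norm (s * exp (- (z * s))) \<le> s * exp (- (u / 2 * s))"
    using N_pos
  proof eventually_elim
    case (elim s)
    have "u / 2 * s \<le> z * s" if z: "z \<in> ball u (u/2)" for z
    proof (rule mult_right_mono)
      have "\<bar>u - z\<bar> < u / 2" using z by (simp add: dist_real_def)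
      then show "u / 2 \<le> z" by linarith
    qed (use elim in simp)
    then show ?case using elim by (auto intro!: derivative_eq_intros simp: abs_mult)
  qed
  show "integrable N (\<lambda>s. 1 - exp (- (z * s)))" if "z \<in> ball u (u/2)" for z
  proof -
    have "\<bar>u - z\<bar> < u / 2" using that by (simp add: dist_real_def)
    then have "z > 0" using assms by linarith
    then show ?thesis using integrable_one_minus_exp[of z] by simp
  qed
qed (use assms integrable_s_exp(1)[of "u/2"] in auto)

lemma phi1_deriv:
  assumes "u > 0" shows "(\<phi>1 has_real_derivative - \<phi>2 u) (at u)"
  using laplace_moment_deriv[OF sets_N N_pos assms, of 1] integrable_s_exp
  by (simp add: \<phi>1_def[abs_def] \<phi>2_def numeral_2_eq_2)

lemma H_eq: assumes "u > 0" shows "H u = \<phi> u - u * \<phi>1 u"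
proof -
  have "\<phi> u - u * \<phi>1 u = (\<integral>s. (1 - exp (- (u * s))) - u * (s * exp (- (u * s))) \<partial>N)"
    unfolding \<phi>_def \<phi>1_def
    by (subst Bochner_Integration.integral_diff) (use integrable_one_minus_exp[of u] integrable_s_exp(1)[of u] assms in auto)
  also have "\<dots> = H u" unfolding H_def by (simp add: algebra_simps)
  finally show ?thesis ..
qed

lemma H_g: "H u = (\<integral>s. g_fun (u * s) \<partial>N)"
  unfolding H_def g_fun_def ..

lemma integrable_g: assumes "u > 0" shows "integrable N (\<lambda>s. g_fun (u * s))"
proof -
  have "integrable N (\<lambda>s. (1 - exp (- (u * s))) - u * (s * exp (- (u * s))))"
    using integrable_one_minus_exp[of u] integrable_s_exp(1)[of u] assms by auto
  then show ?thesis by (simp add: g_fun_def algebra_simps)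
qed

lemma H_deriv:
  assumes "u > 0" shows "(H has_real_derivative u * \<phi>2 u) (at u)"
proof -
  have "((\<lambda>u. \<phi> u - u * \<phi>1 u) has_real_derivative u * \<phi>2 u) (at u)"
    by (auto intro!: derivative_eq_intros phi_deriv phi1_deriv assms)
  moreover have "open {0::real<..}" by simp
  ultimately show ?thesis
    by (rule has_field_derivative_transform_within_open) (use assms H_eq in auto)
qed

lemma deriv_laplace: assumes "u > 0" shows "deriv (laplace_exponent \<nu>) u = \<phi>1 u"
proof -
  have "laplace_exponent \<nu> = \<phi>" by (rule ext) (rule laplace_exponent_eq)
  then show ?thesis using DERIV_imp_deriv[OF phi_deriv[OF assms]] by simp
qed

lemma deriv2_laplace: assumes "u > 0" shows "deriv (deriv (laplace_exponent \<nu>)) u = - \<phi>2 u"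
proof (rule DERIV_imp_deriv)
  have "open {0::real<..}" by simp
  then show "(deriv (laplace_exponent \<nu>) has_real_derivative - \<phi>2 u) (at u)"
    by (rule has_field_derivative_transform_within_open[OF phi1_deriv[OF assms]]) (use assms deriv_laplace in auto)
qed

lemma H_fun_eq: "u > 0 \<Longrightarrow> H_fun \<nu> u = H u"
  by (simp add: H_fun_def deriv_laplace laplace_exponent_eq H_eq)

lemma phi2_pos: "u > 0 \<Longrightarrow> \<phi>2 u > 0"
  unfolding \<phi>2_def by (rule integral_N_pos[OF integrable_s_exp(2)]) auto

lemma H_ge_phi2: assumes "u > 0" shows "u\<^sup>2 * \<phi>2 u / 2 \<le> H u"
proof -
  have "u\<^sup>2 * \<phi>2 u / 2 = (\<integral>s. u\<^sup>2 / 2 * (s\<^sup>2 * exp (- (u * s))) \<partial>N)" by (simp add: \<phi>2_def)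
  also have "\<dots> \<le> (\<integral>s. g_fun (u * s) \<partial>N)"
  proof (rule integral_mono_AE)
    show "AE s in N. u\<^sup>2 / 2 * (s\<^sup>2 * exp (- (u * s))) \<le> g_fun (u * s)"
      using N_pos
    proof eventually_elim
      case (elim s) then show ?case using g_fun_ge[of "u * s"] assms by (simp add: power_mult_distrib)
    qed
  qed (use integrable_s_exp(2)[OF assms] integrable_g[OF assms] in auto)
  finally show ?thesis by (simp add: H_g)
qed

lemma H_pos: "u > 0 \<Longrightarrow> H u > 0"
  using H_ge_phi2[of u] phi2_pos[of u] by (smt (verit) divide_pos_pos mult_pos_pos zero_less_power)

lemma H_strict_mono: "0 < u \<Longrightarrow> u < v \<Longrightarrow> H u < H v"
  by (rule DERIV_pos_imp_increasing[of u v H]) (auto intro!: exI H_deriv mult_pos_pos phi2_pos)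

lemma phi1_strict_antimono: "0 < u \<Longrightarrow> u < v \<Longrightarrow> \<phi>1 v < \<phi>1 u"
proof (rule DERIV_neg_imp_decreasing[of u v \<phi>1])
  show "\<exists>y. (\<phi>1 has_real_derivative y) (at x) \<and> y < 0" if "0 < u" "u < v" "u \<le> x" "x \<le> v" for x
    using phi1_deriv[of x] phi2_pos[of x] that by (intro exI[of _ "- \<phi>2 x"]) auto
qed auto

lemma H_isCont: "u > 0 \<Longrightarrow> isCont H u"
  using H_deriv DERIV_isCont by blast

text \<open>Truncated second moment and tail mass of the Levy measure. Up to constants H(1/r) is
  K(r) / r^2 + w(r); the scaling later removes the second term.\<close>

definition K :: "real \<Rightarrow> real" where "K r = (\<integral>s. indicator {..r} s * s\<^sup>2 \<partial>N)"
definition w :: "real \<Rightarrow> real" where "w r = (\<integral>s. indicator {r<..} s \<partial>N)"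

lemma integrable_trunc:
  assumes r: "r > 0" and f: "f \<in> borel_measurable borel" "\<And>s. 0 < s \<Longrightarrow> s \<le> r \<Longrightarrow> \<bar>f s\<bar> \<le> C * s"
  shows "integrable N (\<lambda>s. indicator {..r} s * f s)"
proof (rule integrable_N[where C="\<bar>C\<bar> * (1 + r)"])
  fix s :: real assume s: "s > 0"
  show "norm (indicator {..r} s * f s) \<le> \<bar>C\<bar> * (1 + r) * min 1 s"
  proof (cases "s \<le> r")
    case True
    have "\<bar>f s\<bar> \<le> \<bar>C\<bar> * s" using f(2)[OF s True] s by (smt (verit) mult_right_mono)
    also have "\<dots> \<le> \<bar>C\<bar> * ((1 + r) * min 1 s)"
      using True s r by (intro mult_left_mono) (auto simp: min_def algebra_simps)
    finally show ?thesis using True by simp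
  qed (use s r in auto)
qed (use f in measurable)

lemma integrable_s_exp_trunc:
  assumes r: "r > 0"
  shows "integrable N (\<lambda>s. indicator {..r} s * (s * exp (l * s)))"
proof (rule integrable_trunc[OF r, where C="exp (\<bar>l\<bar> * r)"])
  fix s :: real assume s: "0 < s" "s \<le> r"
  have "l * s \<le> \<bar>l\<bar> * s" using s by (intro mult_right_mono) auto
  also have "\<dots> \<le> \<bar>l\<bar> * r" using s by (intro mult_left_mono) auto
  finally have "exp (l * s) \<le> exp (\<bar>l\<bar> * r)" by simp
  then show "\<bar>s * exp (l * s)\<bar> \<le> exp (\<bar>l\<bar> * r) * s" using s by (simp add: abs_mult mult.commute)
qed simp

lemma s_exp_trunc_nonneg: "0 \<le> (\<integral>s. indicator {..r} s * (s * exp (l * s)) \<partial>N)"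
  by (rule integral_nonneg_AE) (use N_pos in \<open>auto elim!: eventually_mono simp: indicator_def\<close>)

lemma integrable_K: "r > 0 \<Longrightarrow> integrable N (\<lambda>s. indicator {..r} s * s\<^sup>2)"
  by (rule integrable_trunc[where C=r]) (auto simp: power2_eq_square intro!: mult_right_mono)

lemma integrable_w: assumes "r > 0" shows "integrable N (\<lambda>s. indicator {r<..} s :: real)"
proof (rule integrable_N[where C="1 + 1/r"])
  fix s :: real assume s: "s > 0"
  have "(1::real) \<le> (1 + 1 / r) * min 1 s" if "s > r"
  proof (cases "s \<le> 1")
    case True
    have "1 \<le> s / r" using that assms by simp
    also have "\<dots> \<le> (1 + 1 / r) * s" using s by (simp add: distrib_right)
    finally show ?thesis using True by (simp add: min_def)
  qed (use assms in \<open>simp add: min_def\<close>)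
  then show "norm (indicator {r<..} s :: real) \<le> (1 + 1 / r) * min 1 s"
    using assms s by (auto simp: indicator_def)
qed simp

lemma w_fun_eq: assumes "r > 0" shows "w_fun \<nu> r = w r"
proof -
  have "w r = (LBINT s:{0<..}. indicator {r<..} s * \<nu> s)" unfolding w_def by (rule integral_N) simp
  also have "\<dots> = w_fun \<nu> r" unfolding w_fun_def set_lebesgue_integral_def
    using assms by (intro Bochner_Integration.integral_cong) (auto simp: indicator_def)
  finally show ?thesis ..
qed

text \<open>\<open>g_fun_min\<close> at s / r: on s <= r the minimum is (s/r)^2, while on s > r it
  is 1, which gives the companion bound for \<open>w\<close>.\<close>

lemma K_le_H: assumes "r > 0" shows "K r \<le> 2 * exp 1 * r\<^sup>2 * H (1/r)"
proof -
  have "K r \<le> (\<integral>s. 2 * exp 1 * r\<^sup>2 * g_fun (1/r * s) \<partial>N)"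
    unfolding K_def
  proof (rule integral_mono_AE)
    show "AE s in N. indicator {..r} s * s\<^sup>2 \<le> 2 * exp 1 * r\<^sup>2 * g_fun (1/r * s)"
      using N_pos
    proof eventually_elim
      case (elim s)
      show ?case
      proof (cases "s \<le> r")
        case True
        have "(s/r)\<^sup>2 \<le> 1" using True elim assms by (simp add: power_le_one_iff)
        then have "(s/r)\<^sup>2 \<le> 2 * exp 1 * g_fun (s / r)" using g_fun_min[of "s/r"] elim assms by (simp add: min_def split: if_splits)
        then have "r\<^sup>2 * (s/r)\<^sup>2 \<le> r\<^sup>2 * (2 * exp 1 * g_fun (s / r))" by (intro mult_left_mono) auto
        then show ?thesis using True assms by (simp add: power_divide mult_ac)
      qed (use g_fun_nonneg[of "s/r"] elim assms in auto)
    qed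
  qed (use integrable_K[OF assms] integrable_g[of "1/r"] assms in auto)
  then show ?thesis by (simp add: H_g)
qed

lemma w_le_H: assumes "r > 0" shows "w r \<le> 2 * exp 1 * H (1/r)"
proof -
  have "w r \<le> (\<integral>s. 2 * exp 1 * g_fun (1/r * s) \<partial>N)"
    unfolding w_def
  proof (rule integral_mono_AE)
    show "AE s in N. indicator {r<..} s \<le> 2 * exp 1 * g_fun (1/r * s)"
      using N_pos
    proof eventually_elim
      case (elim s)
      show ?case
      proof (cases "s \<le> r")
        case False
        have "(s/r)\<^sup>2 \<ge> 1" using False elim assms by (simp add: one_le_power)
        then have "1 \<le> 2 * exp 1 * g_fun (s / r)" using g_fun_min[of "s/r"] elim assms by (simp add: min_def split: if_splits)
        then show ?thesis using False assms by simp
      qed (use g_fun_nonneg[of "s/r"] elim assms in auto)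
    qed
  qed (use integrable_w[OF assms] integrable_g[of "1/r"] assms in auto)
  then show ?thesis by (simp add: H_g)
qed

lemma H_le_K_w: assumes "r > 0" shows "H (1/r) \<le> K r / r\<^sup>2 + w r"
proof -
  have "H (1/r) \<le> (\<integral>s. indicator {..r} s * s\<^sup>2 / r\<^sup>2 + indicator {r<..} s \<partial>N)"
    unfolding H_g
  proof (rule integral_mono_AE)
    show "AE s in N. g_fun (1/r * s) \<le> indicator {..r} s * s\<^sup>2 / r\<^sup>2 + indicator {r<..} s"
      using N_pos
    proof eventually_elim
      case (elim s)
      then show ?case using g_fun_le[of "s/r"] assms by (auto simp: indicator_def power_divide)
    qed
  qed (use integrable_K[OF assms] integrable_w[OF assms] integrable_g[of "1/r"] assms in auto)
  also have "\<dots> = K r / r\<^sup>2 + w r"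
    using integrable_K[OF assms] integrable_w[OF assms] by (subst Bochner_Integration.integral_add) (auto simp: K_def w_def)
  finally show ?thesis .
qed

text \<open>Beyond r, exp(z) >= z^2 / 2 at z = s / r makes s^2 exp(-s/r) at most 2 r^2; this is the
  factor 2 in front of \<open>w\<close>.\<close>

lemma phi2_le_K_w: assumes "r > 0" shows "\<phi>2 (1/r) \<le> K r + 2 * r\<^sup>2 * w r"
proof -
  have "\<phi>2 (1/r) \<le> (\<integral>s. indicator {..r} s * s\<^sup>2 + 2 * r\<^sup>2 * indicator {r<..} s \<partial>N)"
    unfolding \<phi>2_def
  proof (rule integral_mono_AE)
    show "AE s in N. s\<^sup>2 * exp (- (1 / r * s)) \<le> indicator {..r} s * s\<^sup>2 + 2 * r\<^sup>2 * indicator {r<..} s"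
      using N_pos
    proof eventually_elim
      case (elim s)
      have 1: "s\<^sup>2 * exp (- (1 / r * s)) \<le> s\<^sup>2 * 1" using elim assms by (intro mult_left_mono) auto
      have "(s/r)\<^sup>2 \<le> 2 * exp (s/r)"
      proof -
        have "0 \<le> s/r" using elim assms by simp
        then show ?thesis using exp_lower_Taylor_quadratic[of "s/r"] by linarith
      qed
      then have "s\<^sup>2 * exp (- (1 / r * s)) \<le> 2 * r\<^sup>2" using assms by (simp add: exp_minus power_divide field_simps)
      then show ?case using 1 assms by (auto simp: indicator_def)
    qed
  qed (use integrable_K[OF assms] integrable_w[OF assms] integrable_s_exp(2)[of "1/r"] assms in auto)
  also have "\<dots> = K r + 2 * r\<^sup>2 * w r"
    using integrable_K[OF assms] integrable_w[OF assms] by (subst Bochner_Integration.integral_add) (auto simp: K_def w_def)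
  finally show ?thesis .
qed

lemma K_le_phi2: assumes "r > 0" shows "K r \<le> exp 1 * \<phi>2 (1/r)"
proof -
  have "K r \<le> (\<integral>s. exp 1 * (s\<^sup>2 * exp (- (1/r * s))) \<partial>N)"
    unfolding K_def
  proof (rule integral_mono_AE)
    show "AE s in N. indicator {..r} s * s\<^sup>2 \<le> exp 1 * (s\<^sup>2 * exp (- (1/r * s)))"
      using N_pos
    proof eventually_elim
      case (elim s)
      have "s\<^sup>2 * 1 \<le> s\<^sup>2 * (exp 1 * exp (- (1/r * s)))" if "s \<le> r"
        unfolding exp_add[symmetric] using that assms by (intro mult_left_mono) auto
      then show ?case by (auto simp: indicator_def mult_ac)
    qed
  qed (use integrable_K[OF assms] integrable_s_exp(2)[of "1/r"] assms in auto)
  then show ?thesis by (simp add: \<phi>2_def)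
qed

lemma K_nonneg: "K r \<ge> 0" unfolding K_def by (rule integral_nonneg_AE) (auto simp: indicator_def)

lemma w_nonneg: "w r \<ge> 0" unfolding w_def by (rule integral_nonneg_AE) (auto simp: indicator_def)

text \<open>Evaluates an upper bound by an explicit antiderivative: \<open>g\<close> dominates f
  \<nu> on \<open>A\<close> and is integrated over a larger set \<open>A'\<close>, which may be
  closed or start at 0 as the known primitive requires.\<close>

lemma N_integral_le:
  assumes f: "f \<in> borel_measurable borel" and A: "A \<in> sets borel" "A \<subseteq> {0<..}" "A \<subseteq> A'"
    and f0: "\<And>s. s \<in> A \<Longrightarrow> 0 \<le> f s" and g0: "\<And>s. s \<in> A' \<Longrightarrow> 0 \<le> g s" and I: "(g has_integral I) A'"
    and g: "g \<in> borel_measurable borel" "A' \<in> sets borel"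
    and le: "\<And>s. s \<in> A \<Longrightarrow> f s * \<nu> s \<le> g s"
  shows "integrable N (\<lambda>s. indicator A s * f s)" "(\<integral>s. indicator A s * f s \<partial>N) \<le> I"
proof -
  have hi: "((\<lambda>s. indicator A' s * g s) has_integral I) UNIV"
  proof -
    have "(\<lambda>s. indicator A' s * g s) = (\<lambda>s. if s \<in> A' then g s else 0)" by (auto simp: indicator_def)
    then show ?thesis using I by (simp only: has_integral_restrict_UNIV)
  qed
  have "(\<integral>\<^sup>+s. ennreal (indicator A' s * g s) \<partial>lborel) = ennreal I"
    by (rule nn_integral_has_integral_lborel[OF _ _ hi]) (use g g0 in \<open>auto simp: indicator_def\<close>)
  note gI = this
  have I0: "I \<ge> 0" using has_integral_nonneg[OF I] g0 by auto
  have "(\<integral>\<^sup>+s. ennreal (indicator A s * f s) \<partial>N) = (\<integral>\<^sup>+s. ennreal (\<nu>0 s) * ennreal (indicator A s * f s) \<partial>lborel)"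
    unfolding N_def by (rule nn_integral_density) (use f A in measurable)
  also have "\<dots> \<le> (\<integral>\<^sup>+s. ennreal (indicator A' s * g s) \<partial>lborel)"
  proof (rule nn_integral_mono)
    fix s
    have "\<nu>0 s * (indicator A s * f s) \<le> indicator A' s * g s"
      using le[of s] A g0[of s] by (auto simp: indicator_def \<nu>0_def mult.commute)
    then show "ennreal (\<nu>0 s) * ennreal (indicator A s * f s) \<le> ennreal (indicator A' s * g s)"
      by (simp add: ennreal_mult'[symmetric] ennreal_leI)
  qed
  finally have fin: "(\<integral>\<^sup>+s. ennreal (indicator A s * f s) \<partial>N) \<le> ennreal I" using gI by simp
  have nn: "0 \<le> indicator A s * f s" for s using f0 by (auto simp: indicator_def)
  show int: "integrable N (\<lambda>s. indicator A s * f s)"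
    by (rule integrableI_nonneg) (use f A nn fin in \<open>auto simp: less_top[symmetric] top_unique\<close>)
  show "(\<integral>s. indicator A s * f s \<partial>N) \<le> I"
    using fin I0 by (subst (asm) nn_integral_eq_integral[OF int]) (use nn in auto)
qed

lemma N_integral_ge:
  assumes int: "integrable N f" and A: "0 \<le> a" "a \<le> b"
    and f0: "\<And>s. s > 0 \<Longrightarrow> 0 \<le> f s"
    and le: "\<And>s. a < s \<Longrightarrow> s \<le> b \<Longrightarrow> c \<le> f s * \<nu> s" and c: "c \<ge> 0"
  shows "c * (b - a) \<le> (\<integral>s. f s \<partial>N)"
proof -
  have m: "f \<in> borel_measurable borel" using borel_measurable_integrable[OF int] by simp
  have "ennreal (c * (b - a)) = (\<integral>\<^sup>+s. ennreal c * indicator {a<..b} s \<partial>lborel)"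
    using c A by (simp add: nn_integral_cmult_indicator ennreal_mult)
  also have "\<dots> \<le> (\<integral>\<^sup>+s. ennreal (\<nu>0 s) * ennreal (f s) \<partial>lborel)"
  proof (rule nn_integral_mono)
    fix s
    show "ennreal c * indicator {a<..b} s \<le> ennreal (\<nu>0 s) * ennreal (f s)"
    proof (cases "a < s \<and> s \<le> b")
      case True
      then have "ennreal c \<le> ennreal (\<nu> s * f s)" using le[of s] by (intro ennreal_leI) (simp add: mult.commute)
      also have "\<dots> = ennreal (\<nu> s) * ennreal (f s)" using True A nu_nonneg[of s] by (intro ennreal_mult') simp
      finally show ?thesis using True A by (simp add: \<nu>0_def)
    qed (auto simp: indicator_def)
  qed
  also have "\<dots> = (\<integral>\<^sup>+s. ennreal (f s) \<partial>N)"
    unfolding N_def by (rule nn_integral_density[symmetric]) (use m in measurable)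
  also have "\<dots> = ennreal (\<integral>s. f s \<partial>N)"
    by (rule nn_integral_eq_integral[OF int]) (use N_pos f0 in \<open>auto elim: eventually_mono\<close>)
  finally have le_int: "ennreal (c * (b - a)) \<le> ennreal (\<integral>s. f s \<partial>N)" .
  have "(\<integral>s. f s \<partial>N) \<ge> 0" by (rule integral_nonneg_AE) (use N_pos f0 in \<open>auto elim: eventually_mono\<close>)
  then show ?thesis using le_int by (simp add: ennreal_le_iff)
qed

end

section \<open>Scaling of the Levy density\<close>

locale scaled_dens = levy_dens \<nu> for \<nu> :: "real \<Rightarrow> real" +
  fixes a\<^sub>1 a\<^sub>2 \<alpha>\<^sub>1 \<alpha>\<^sub>2 :: real
  assumes a1: "a\<^sub>1 > 0" and a2: "a\<^sub>2 > 0" and al1: "\<alpha>\<^sub>1 > 0" and al2: "\<alpha>\<^sub>2 \<ge> \<alpha>\<^sub>1"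
    and lower_scaling: "0 < r \<Longrightarrow> r \<le> R \<Longrightarrow> a\<^sub>1 * (R / r) powr (1 + \<alpha>\<^sub>1) \<le> \<nu> r / \<nu> R"
    and upper_scaling: "0 < r \<Longrightarrow> r \<le> R \<Longrightarrow> \<nu> r / \<nu> R \<le> a\<^sub>2 * (R / r) powr (1 + \<alpha>\<^sub>2)"
begin

lemma nu_le: "0 < r \<Longrightarrow> r \<le> R \<Longrightarrow> \<nu> r \<le> a\<^sub>2 * (R / r) powr (1 + \<alpha>\<^sub>2) * \<nu> R"
  using upper_scaling[of r R] nu_pos[of R] by (simp add: pos_divide_le_eq)

lemma nu_ge: "0 < r \<Longrightarrow> r \<le> R \<Longrightarrow> a\<^sub>1 * (R / r) powr (1 + \<alpha>\<^sub>1) * \<nu> R \<le> \<nu> r"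
  using lower_scaling[of r R] nu_pos[of R] by (simp add: pos_le_divide_eq)

lemma nu_antimono: assumes "0 < r" "r \<le> R" shows "a\<^sub>1 * \<nu> R \<le> \<nu> r"
proof -
  have "1 \<le> (R / r) powr (1 + \<alpha>\<^sub>1)" using assms al1 by (intro ge_one_powr_ge_zero) auto
  then have "a\<^sub>1 * 1 * \<nu> R \<le> a\<^sub>1 * (R / r) powr (1 + \<alpha>\<^sub>1) * \<nu> R"
    using a1 nu_pos[of R] assms by (intro mult_right_mono mult_left_mono) auto
  then show ?thesis using nu_ge[OF assms] by simp
qed

text \<open>The hypothesis is used with an exponent \<beta> <= \<open>\<alpha>\<^sub>1\<close>,
  allowed because s / r >= 1. A choice \<beta> < 1 keeps the bound integrable at 0, and \<beta> = 0
  is almost monotonicity of s \<nu>(s).\<close>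

lemma s_nu_le:
  assumes "0 < r" "r \<le> s" "0 \<le> \<beta>" "\<beta> \<le> \<alpha>\<^sub>1"
  shows "s * \<nu> s \<le> r * \<nu> r * (r / s) powr \<beta> / a\<^sub>1"
proof -
  have s: "s > 0" using assms by simp
  have "a\<^sub>1 * ((s / r) * (s / r) powr \<alpha>\<^sub>1) * \<nu> s \<le> \<nu> r"
    using nu_ge[of r s] assms s by (simp add: powr_add)
  moreover have "(s / r) powr \<beta> \<le> (s / r) powr \<alpha>\<^sub>1"
    using assms s by (intro powr_mono) auto
  then have "a\<^sub>1 * ((s / r) * (s / r) powr \<beta>) * \<nu> s \<le> a\<^sub>1 * ((s / r) * (s / r) powr \<alpha>\<^sub>1) * \<nu> s"
    using a1 nu_pos[OF s] assms s by (intro mult_right_mono mult_left_mono) auto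
  ultimately have "a\<^sub>1 * ((s / r) * (s / r) powr \<beta>) * \<nu> s \<le> \<nu> r" by linarith
  then have "a\<^sub>1 * ((s / r) * (s / r) powr \<beta>) * \<nu> s * (r * (r / s) powr \<beta>) \<le> \<nu> r * (r * (r / s) powr \<beta>)"
    using assms by (intro mult_right_mono) auto
  moreover have "(s / r) powr \<beta> * (r / s) powr \<beta> = 1"
    using assms s by (simp add: powr_mult[symmetric])
  then have "a\<^sub>1 * ((s / r) * (s / r) powr \<beta>) * \<nu> s * (r * (r / s) powr \<beta>) = a\<^sub>1 * (s * \<nu> s)"
    using assms s by (simp add: field_simps)
  ultimately show ?thesis using a1 by (simp add: pos_le_divide_eq mult_ac)
qed

lemma s_nu_le': "0 < r \<Longrightarrow> r \<le> s \<Longrightarrow> s * \<nu> s \<le> r * \<nu> r / a\<^sub>1"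
  using s_nu_le[of r s 0] al1 by (simp split: if_splits)

text \<open>Karamata's estimate: the power with exponent \<open>- \<alpha>\<^sub>1 - 1\<close> is
  integrable at infinity because \<open>\<alpha>\<^sub>1 > 0\<close>.\<close>

lemma w_le: assumes r: "r > 0" shows "w r \<le> r * \<nu> r / (a\<^sub>1 * \<alpha>\<^sub>1)"
proof -
  let ?g = "\<lambda>s. r * \<nu> r / a\<^sub>1 * r powr \<alpha>\<^sub>1 * s powr (- \<alpha>\<^sub>1 - 1)"
  have "((\<lambda>s. s powr (- \<alpha>\<^sub>1 - 1)) has_integral - (r powr ((- \<alpha>\<^sub>1 - 1) + 1)) / ((- \<alpha>\<^sub>1 - 1) + 1)) {r..}"
    by (rule has_integral_powr_to_inf) (use r al1 in auto)
  then have I: "(?g has_integral r * \<nu> r / a\<^sub>1 * r powr \<alpha>\<^sub>1 * (- (r powr ((- \<alpha>\<^sub>1 - 1) + 1)) / ((- \<alpha>\<^sub>1 - 1) + 1))) {r..}"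
    by (rule has_integral_mult_right)
  have *: "1 * \<nu> s \<le> ?g s" if "s \<in> {r<..}" for s
  proof -
    have s: "s > 0" "r \<le> s" using that r by auto
    have "s * \<nu> s \<le> r * \<nu> r * (r / s) powr \<alpha>\<^sub>1 / a\<^sub>1" using s_nu_le[of r s \<alpha>\<^sub>1] r s al1 by simp
    also have "(r / s) powr \<alpha>\<^sub>1 = r powr \<alpha>\<^sub>1 * s powr (- \<alpha>\<^sub>1)"
      using r s by (simp add: powr_divide powr_minus_divide)
    also have "r * \<nu> r * (r powr \<alpha>\<^sub>1 * s powr (- \<alpha>\<^sub>1)) / a\<^sub>1 = s * ?g s" using s by (simp add: powr_diff)
    finally have "s * \<nu> s \<le> s * ?g s" .
    then have "\<nu> s \<le> ?g s" by (rule mult_left_le_imp_le[OF _ s(1)])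
    then show ?thesis by simp
  qed
  have "(\<integral>s. indicator {r<..} s * 1 \<partial>N) \<le> r * \<nu> r / a\<^sub>1 * r powr \<alpha>\<^sub>1 * (- (r powr ((- \<alpha>\<^sub>1 - 1) + 1)) / ((- \<alpha>\<^sub>1 - 1) + 1))"
    by (rule N_integral_le(2)[OF _ _ _ _ _ _ I _ _ *]) (use r nu_pos[of r] a1 in auto)
  also have "\<dots> = r * \<nu> r / (a\<^sub>1 * \<alpha>\<^sub>1)"
    using r by (simp add: powr_minus field_simps)
  finally show ?thesis by (simp add: w_def)
qed

text \<open>Only the jumps in (r, 2r] are kept, where \<nu> has dropped at most by the factor
  \<open>a\<^sub>2 * 2 powr (1 + \<alpha>\<^sub>2)\<close>.\<close>

lemma w_ge: assumes r: "r > 0" shows "r * \<nu> r / (a\<^sub>2 * 2 powr (1 + \<alpha>\<^sub>2)) \<le> w r"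
proof -
  have "\<nu> r / (a\<^sub>2 * 2 powr (1 + \<alpha>\<^sub>2)) * (2 * r - r) \<le> w r"
    unfolding w_def
  proof (rule N_integral_ge[OF integrable_w[OF r]])
    fix s assume s: "r < s" "s \<le> 2 * r"
    have "\<nu> r \<le> a\<^sub>2 * (s / r) powr (1 + \<alpha>\<^sub>2) * \<nu> s" using nu_le[of r s] s r by simp
    also have "\<dots> \<le> a\<^sub>2 * 2 powr (1 + \<alpha>\<^sub>2) * \<nu> s"
      using s r a2 nu_pos[of s] al1 al2 by (intro mult_right_mono mult_left_mono powr_mono2) (auto simp: field_simps)
    finally show "\<nu> r / (a\<^sub>2 * 2 powr (1 + \<alpha>\<^sub>2)) \<le> indicat_real {r<..} s * \<nu> s"
      using s a2 by (simp add: field_simps)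
  qed (use r a2 nu_nonneg[of r] in auto)
  then show ?thesis by (simp add: mult.commute)
qed

text \<open>Only the jumps in (r/2, r] are kept: s^2 >= r^2 / 4 over a length r/2, whence the
  8.\<close>

lemma K_ge: assumes r: "r > 0" shows "a\<^sub>1 / 8 * (r ^ 3 * \<nu> r) \<le> K r"
proof -
  have "(r\<^sup>2 / 4 * (a\<^sub>1 * \<nu> r)) * (r - r/2) \<le> K r"
    unfolding K_def
  proof (rule N_integral_ge[OF integrable_K[OF r]])
    fix s assume s: "r/2 < s" "s \<le> r"
    have "(r/2)\<^sup>2 \<le> s\<^sup>2" using s r by (intro power_mono) auto
    then have "r\<^sup>2 / 4 * (a\<^sub>1 * \<nu> r) \<le> s\<^sup>2 * \<nu> s"
      using nu_antimono[of s r] s r a1 nu_pos[of r] by (intro mult_mono) (auto simp: power_divide)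
    then show "r\<^sup>2 / 4 * (a\<^sub>1 * \<nu> r) \<le> indicator {..r} s * s\<^sup>2 * \<nu> s" using s by simp
  qed (use r a1 nu_pos[of r] in \<open>auto simp: indicator_def\<close>)
  then show ?thesis by (simp add: power3_eq_cube power2_eq_square field_simps)
qed

text \<open>\<open>w_le\<close> against \<open>K_ge\<close> bounds r^2 w(r) by
  \<open>8 / (a\<^sub>1 * (a\<^sub>1 * \<alpha>\<^sub>1))\<close> times K(r); the 2 comes from
  \<open>phi2_le_K_w\<close>.\<close>

definition CK :: real where "CK = 1 + 2 * (8 / (a\<^sub>1 * (a\<^sub>1 * \<alpha>\<^sub>1)))"

lemma CK_ge_1: "CK \<ge> 1" using a1 al1 by (simp add: CK_def)

lemma K_w: assumes r: "r > 0" shows "K r + 2 * r\<^sup>2 * w r \<le> CK * K r"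
proof -
  have "r\<^sup>2 * w r \<le> r\<^sup>2 * (r * \<nu> r / (a\<^sub>1 * \<alpha>\<^sub>1))" by (intro mult_left_mono w_le r) auto
  also have "\<dots> = r ^ 3 * \<nu> r / (a\<^sub>1 * \<alpha>\<^sub>1)" by (simp add: power3_eq_cube power2_eq_square)
  also have "\<dots> \<le> (8 / a\<^sub>1 * K r) / (a\<^sub>1 * \<alpha>\<^sub>1)"
    using K_ge[OF r] a1 al1 by (intro divide_right_mono) (auto simp: field_simps)
  finally have "2 * (r\<^sup>2 * w r) \<le> 2 * (8 / (a\<^sub>1 * (a\<^sub>1 * \<alpha>\<^sub>1)) * K r)" by simp
  then show ?thesis unfolding CK_def distrib_right mult_1 by (simp only: mult.assoc)
qed

lemma phi2_le_K: "r > 0 \<Longrightarrow> \<phi>2 (1/r) \<le> CK * K r"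
  using phi2_le_K_w[of r] K_w[of r] by linarith

lemma H_le_K: assumes "r > 0" shows "H (1/r) \<le> CK * K r / r\<^sup>2"
proof -
  have "r\<^sup>2 * w r \<ge> 0" using w_nonneg by simp
  then have "K r + r\<^sup>2 * w r \<le> CK * K r" using K_w[OF assms] by linarith
  moreover have "r\<^sup>2 * H (1/r) \<le> r\<^sup>2 * (K r / r\<^sup>2 + w r)" by (intro mult_left_mono H_le_K_w assms) auto
  then have "r\<^sup>2 * H (1/r) \<le> K r + r\<^sup>2 * w r" using assms by (simp add: distrib_left)
  ultimately have "r\<^sup>2 * H (1/r) \<le> CK * K r" by linarith
  then show ?thesis using assms by (simp add: field_simps)
qed

text \<open>Since u H'(u) = u^2 \<phi>2(u), the bound of H by \<open>CH\<close> times u^2 \<phi>2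
  says that the logarithmic derivative of H is at least \<gamma> / u.\<close>

definition CH :: real where "CH = exp 1 * CK"
definition \<gamma> :: real where "\<gamma> = 1 / CH"

lemma CH_ge_1: "CH \<ge> 1"
proof -
  have "1 * 1 \<le> exp 1 * CK" using CK_ge_1 by (intro mult_mono) auto
  then show ?thesis by (simp add: CH_def)
qed

lemma gamma: "0 < \<gamma>" "\<gamma> \<le> 1" using CH_ge_1 by (auto simp: \<gamma>_def)

lemma H_le_phi2: assumes "u > 0" shows "H u \<le> CH * (u\<^sup>2 * \<phi>2 u)"
proof -
  have "H u \<le> CK * K (1/u) / (1/u)\<^sup>2" using H_le_K[of "1/u"] assms by simp
  also have "\<dots> \<le> CK * (exp 1 * \<phi>2 u) / (1/u)\<^sup>2"
    using K_le_phi2[of "1/u"] assms CK_ge_1 by (intro divide_right_mono mult_left_mono) auto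
  also have "\<dots> = CH * (u\<^sup>2 * \<phi>2 u)" using assms by (simp add: CH_def power_divide field_simps)
  finally show ?thesis .
qed

text \<open>ln H - \<gamma> ln is nondecreasing. This power growth is what makes the tilted
  characteristic functions integrable with bounds uniform in t.\<close>

lemma H_lower: assumes "0 < u" "u \<le> v" shows "(v / u) powr \<gamma> * H u \<le> H v"
proof -
  have "ln (H u) - \<gamma> * ln u \<le> ln (H v) - \<gamma> * ln v"
  proof (rule DERIV_nonneg_imp_nondecreasing[of u v "\<lambda>x. ln (H x) - \<gamma> * ln x"])
    fix x assume x: "u \<le> x" "x \<le> v"
    then have x0: "x > 0" using assms by simp
    have "((\<lambda>x. ln (H x) - \<gamma> * ln x) has_real_derivative (1 / H x * (x * \<phi>2 x) - \<gamma> * (1 / x))) (at x)"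
      using H_deriv[OF x0] H_pos[OF x0] x0 by (auto intro!: derivative_eq_intros)
    moreover have "0 \<le> 1 / H x * (x * \<phi>2 x) - \<gamma> * (1 / x)"
      using H_le_phi2[OF x0] H_pos[OF x0] x0 CH_ge_1 by (simp add: \<gamma>_def field_simps power2_eq_square)
    ultimately show "\<exists>y. ((\<lambda>x. ln (H x) - \<gamma> * ln x) has_real_derivative y) (at x) \<and> 0 \<le> y" by blast
  qed (use assms in auto)
  then have "\<gamma> * ln (v / u) + ln (H u) \<le> ln (H v)" using assms by (simp add: ln_div algebra_simps)
  then have "exp (\<gamma> * ln (v / u) + ln (H u)) \<le> exp (ln (H v))" by simp
  then show ?thesis using assms H_pos[of u] H_pos[of v] by (simp add: exp_add powr_def)
qed

text \<open>The logarithmic derivative of H is at most 2 / u, by \<open>H_ge_phi2\<close>.\<close>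

lemma H_upper: assumes "0 < u" "u \<le> v" shows "H v \<le> (v / u)\<^sup>2 * H u"
proof -
  have "ln (H v) - 2 * ln v \<le> ln (H u) - 2 * ln u"
  proof (rule DERIV_nonpos_imp_nonincreasing[of u v "\<lambda>x. ln (H x) - 2 * ln x"])
    fix x assume x: "u \<le> x" "x \<le> v"
    then have x0: "x > 0" using assms by simp
    have "((\<lambda>x. ln (H x) - 2 * ln x) has_real_derivative (1 / H x * (x * \<phi>2 x) - 2 * (1 / x))) (at x)"
      using H_deriv[OF x0] H_pos[OF x0] x0 by (auto intro!: derivative_eq_intros)
    moreover have "1 / H x * (x * \<phi>2 x) - 2 * (1 / x) \<le> 0"
      using H_ge_phi2[OF x0] H_pos[OF x0] x0 by (simp add: field_simps power2_eq_square)
    ultimately show "\<exists>y. ((\<lambda>x. ln (H x) - 2 * ln x) has_real_derivative y) (at x) \<and> y \<le> 0" by blast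
  qed (use assms in auto)
  then have "ln (H v) \<le> 2 * ln (v / u) + ln (H u)" using assms by (simp add: ln_div algebra_simps)
  then have "exp (ln (H v)) \<le> exp (2 * ln (v / u) + ln (H u))" by simp
  moreover have "exp (2 * ln (v / u)) = (v / u)\<^sup>2" using assms by (metis divide_pos_pos exp_ln exp_of_nat_mult of_nat_numeral order_less_le_trans)
  ultimately show ?thesis using assms H_pos[of u] H_pos[of v] by (simp add: exp_add)
qed

text \<open>\<phi>2 itself decreases; passing through the increasing H shows that it cannot drop by
  more than a multiple of (v/u)^2.\<close>

lemma phi2_lower: assumes "0 < u" "u \<le> v" shows "\<phi>2 u \<le> 2 * CH * (v / u)\<^sup>2 * \<phi>2 v"
proof -
  have v: "v > 0" using assms by simp
  have "u\<^sup>2 * \<phi>2 u / 2 \<le> H u" by (rule H_ge_phi2) (use assms in auto)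
  also have "\<dots> \<le> H v" using H_strict_mono[of u v] assms by (cases "u = v") auto
  also have "\<dots> \<le> CH * (v\<^sup>2 * \<phi>2 v)" by (rule H_le_phi2[OF v])
  finally show ?thesis using assms by (simp add: field_simps power_divide)
qed

lemma H_surj: assumes "y > 0" shows "\<exists>u>0. H u = y"
proof -
  \<comment> \<open>By \<open>H_lower\<close> relative to the point 1, H(k) >= k^\<gamma> H(1) and
    H(1/l) <= H(1) / l^\<gamma>, so these powers put y between H(1/l) and H(k).\<close>
  define k where "k = max 1 ((y / H 1) powr (1/\<gamma>))"
  define l where "l = max 1 ((H 1 / y) powr (1/\<gamma>))"
  have H1: "H 1 > 0" by (rule H_pos) simp
  have k: "k \<ge> 1" "k powr \<gamma> \<ge> y / H 1"
  proof -
    have "((y / H 1) powr (1/\<gamma>)) powr \<gamma> \<le> k powr \<gamma>" unfolding k_def using gamma by (intro powr_mono2) auto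
    then show "k powr \<gamma> \<ge> y / H 1" using gamma assms H1 by (simp add: powr_powr)
  qed (simp add: k_def)
  have l: "l \<ge> 1" "l powr \<gamma> \<ge> H 1 / y"
  proof -
    have "((H 1 / y) powr (1/\<gamma>)) powr \<gamma> \<le> l powr \<gamma>" unfolding l_def using gamma by (intro powr_mono2) auto
    then show "l powr \<gamma> \<ge> H 1 / y" using gamma assms H1 by (simp add: powr_powr)
  qed (simp add: l_def)
  have "y \<le> H k" using H_lower[of 1 k] k H1 by (simp add: pos_divide_le_eq order_trans)
  moreover have "H (1/l) \<le> y"
  proof -
    have "l powr \<gamma> * H (1/l) \<le> H 1" using H_lower[of "1/l" 1] l by simp
    moreover have "H 1 / y * H (1/l) \<le> l powr \<gamma> * H (1/l)"
      using l H_pos[of "1/l"] by (intro mult_right_mono) auto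
    ultimately have "H 1 / y * H (1/l) \<le> H 1" by linarith
    then show ?thesis using H1 assms by (simp add: field_simps)
  qed
  moreover have "1/l \<le> k" using order_trans[of "1/l" 1 k] k(1) l(1) by simp
  ultimately have "\<exists>x\<ge>1/l. x \<le> k \<and> H x = y"
  proof (intro IVT)
    show "\<forall>x. 1/l \<le> x \<and> x \<le> k \<longrightarrow> isCont H x"
    proof (intro allI impI H_isCont)
      fix x assume "1/l \<le> x \<and> x \<le> k"
      moreover have "0 < 1/l" using l by simp
      ultimately show "0 < x" by linarith
    qed
  qed auto
  then show ?thesis using l by (smt (verit) divide_pos_pos)
qed

lemma H_inv: assumes "y > 0" shows "H_inv \<nu> y > 0" "H (H_inv \<nu> y) = y"
proof -
  obtain u where u: "u > 0" "H u = y" using H_surj[OF assms] by blast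
  then have y: "y \<in> H_fun \<nu> ` {0<..}" using H_fun_eq by force
  show p: "H_inv \<nu> y > 0" using inv_into_into[OF y] by (simp add: H_inv_def)
  show "H (H_inv \<nu> y) = y" using f_inv_into_f[OF y] H_fun_eq[OF p] by (simp add: H_inv_def)
qed

lemma phi1_tendsto: "(\<phi>1 \<longlongrightarrow> 0) at_top"
proof -
  have "((\<lambda>u. \<integral>s. s * exp (- (u * s)) \<partial>N) \<longlongrightarrow> (\<integral>s. 0 \<partial>N)) at_top"
  proof (rule integral_dominated_convergence_at_top[where w="\<lambda>s. s * exp (- (1 * s))"])
    show "AE s in N. ((\<lambda>u. s * exp (- (u * s))) \<longlongrightarrow> 0) at_top"
      using N_pos
    proof eventually_elim
      case (elim s) then show ?case by real_asymp
    qed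
    show "\<forall>\<^sub>F u in at_top. AE s in N. norm (s * exp (- (u * s))) \<le> s * exp (- (1 * s))"
      using eventually_ge_at_top[of 1]
    proof eventually_elim
      case (elim u)
      show ?case using N_pos by eventually_elim (use elim in \<open>auto simp: abs_mult intro!: mult_left_mono\<close>)
    qed
  qed (use integrable_s_exp(1)[of 1] in auto)
  then show ?thesis by (simp add: \<phi>1_def[abs_def])
qed

text \<open>The solution of t \<phi>'(z) = x lies between u and a point where \<phi>' has fallen
  below x / t; strict monotonicity makes \<open>inv_into\<close> return it. The bound \<sigma> >= u,
  used at u = 1 / \<open>h t\<close>, later gives t H(\<sigma>) >= 1.\<close>

lemma sigma_fun:
  assumes "t > 0" "x > 0" "u > 0" "x \<le> t * \<phi>1 u"
  shows "sigma_fun \<nu> t x \<ge> u" "t * \<phi>1 (sigma_fun \<nu> t x) = x"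
proof -
  have "eventually (\<lambda>v. \<phi>1 v < x / t) at_top" by (rule order_tendstoD[OF phi1_tendsto]) (use assms in simp)
  then obtain v where v: "v > u" "\<phi>1 v < x / t"
    by (metis (mono_tags, lifting) eventually_at_top_linorder linorder_le_cases order_less_irrefl gt_ex order_le_less_trans less_le_not_le)
  have "\<exists>z\<ge>u. z \<le> v \<and> \<phi>1 z = x / t"
  proof (rule IVT2)
    show "\<forall>z. u \<le> z \<and> z \<le> v \<longrightarrow> isCont \<phi>1 z" using phi1_deriv DERIV_isCont assms by (metis order_less_le_trans)
  qed (use v assms in \<open>auto simp: field_simps\<close>)
  then obtain z where z: "z \<ge> u" "\<phi>1 z = x / t" by blast
  have inj: "inj_on (deriv (laplace_exponent \<nu>)) {0<..}"
  proof (rule linorder_inj_onI')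
    fix a b :: real assume "a \<in> {0<..}" "b \<in> {0<..}" "a < b"
    then show "deriv (laplace_exponent \<nu>) a \<noteq> deriv (laplace_exponent \<nu>) b"
      using phi1_strict_antimono[of a b] by (simp add: deriv_laplace)
  qed
  have "sigma_fun \<nu> t x = inv_into {0<..} (deriv (laplace_exponent \<nu>)) (deriv (laplace_exponent \<nu>) z)"
    using z assms by (simp add: sigma_fun_def deriv_laplace)
  also have "\<dots> = z" by (rule inv_into_f_f[OF inj]) (use z assms in auto)
  finally show "sigma_fun \<nu> t x \<ge> u" "t * \<phi>1 (sigma_fun \<nu> t x) = x" using z assms by auto
qed

text \<open>The spatial scale at time t, normalised by t H(1/h) = 1; t b(t) is the mean of the law
  tilted by 1/h.\<close>

definition h :: "real \<Rightarrow> real" where "h t = 1 / H_inv \<nu> (1 / t)"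

lemma h: assumes "t > 0" shows "h t > 0" "t * H (1 / h t) = 1" "H_inv \<nu> (1/t) = 1 / h t"
  "b_fun \<nu> t = \<phi>1 (1 / h t)"
  using H_inv[of "1/t"] assms by (auto simp: h_def b_fun_def deriv_laplace)

lemma w_strict: assumes "0 < r" "r < s" shows "w s < w r"
proof -
  have "w r - w s = (\<integral>x. indicator {r<..} x - indicator {s<..} x \<partial>N)"
    unfolding w_def using integrable_w assms by (subst Bochner_Integration.integral_diff) auto
  moreover have "(\<nu> s * a\<^sub>1) * (s - r) \<le> \<dots>"
    by (rule N_integral_ge) (use integrable_w assms nu_antimono[of _ s] nu_pos[of s] a1 in \<open>auto simp: indicator_def mult.commute\<close>)
  moreover have "0 < (\<nu> s * a\<^sub>1) * (s - r)" using nu_pos[of s] a1 assms by simp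
  ultimately show ?thesis by linarith
qed

text \<open>On (r/2, \<infinity>) almost monotonicity bounds \<nu> by
  \<open>\<nu> (r/2) / a\<^sub>1\<close>, so \<open>w\<close> is Lipschitz there.\<close>

lemma w_cont: assumes r: "0 < r" shows "isCont w r"
proof -
  have "\<bar>w x - w y\<bar> \<le> \<nu> (r/2) / a\<^sub>1 * \<bar>x - y\<bar>" if "x \<in> {r/2<..}" "y \<in> {r/2<..}" for x y
  proof -
    have *: "w x - w y \<le> \<nu> (r/2) / a\<^sub>1 * (y - x)" if xy: "x > r/2" "x \<le> y" for x y
    proof -
      have "w x - w y = (\<integral>z. indicator {x<..} z - indicator {y<..} z \<partial>N)"
        unfolding w_def using integrable_w xy r by (subst Bochner_Integration.integral_diff) auto
      also have "\<dots> = (\<integral>z. indicator {x<..y} z * 1 \<partial>N)"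
        using xy by (intro Bochner_Integration.integral_cong) (auto simp: indicator_def)
      also have "\<dots> \<le> \<nu> (r/2) / a\<^sub>1 * (y - x)"
      proof (rule N_integral_le(2)[where A'="{x..y}" and g="\<lambda>_. \<nu> (r/2) / a\<^sub>1"])
        show "((\<lambda>_. \<nu> (r/2) / a\<^sub>1) has_integral \<nu> (r/2) / a\<^sub>1 * (y - x)) {x..y}"
          using has_integral_const_real[of "\<nu> (r/2) / a\<^sub>1" x y] xy by (simp add: mult.commute)
        show "1 * \<nu> s \<le> \<nu> (r/2) / a\<^sub>1" if "s \<in> {x<..y}" for s
          using nu_antimono[of "r/2" s] that xy r a1 by (simp add: field_simps)
      qed (use xy r a1 nu_pos[of "r/2"] in auto)
      finally show ?thesis .
    qed
    show ?thesis
    proof (cases "x \<le> y")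
      case True
      then have "w y \<le> w x" using w_strict[of x y] that r by (cases "x = y") auto
      then show ?thesis using *[of x y] True that by simp
    next
      case False
      then have "w x \<le> w y" using w_strict[of y x] that r by auto
      then show ?thesis using *[of y x] False that by simp
    qed
  qed
  then have "(\<nu> (r/2) / a\<^sub>1)-lipschitz_on {r/2<..} w"
    by (intro lipschitz_onI) (use a1 nu_pos[of "r/2"] r in \<open>auto simp: dist_real_def\<close>)
  then have "continuous_on {r/2<..} w" by (rule lipschitz_on_continuous_on)
  then show ?thesis using r by (simp add: continuous_on_eq_continuous_at)
qed

text \<open>Continuity and strict monotonicity reduce the infimum to solving w(x) = 2e/t. On the
  right w(h) <= 2e/t by \<open>w_le_H\<close>; on the left w is unbounded near 0 by the lower
  scaling.\<close>

lemma w_inv: assumes t: "t > 0"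
  shows "w_inv \<nu> (2 * exp 1 / t) > 0" "w (w_inv \<nu> (2 * exp 1 / t)) = 2 * exp 1 / t"
    "w_inv \<nu> (2 * exp 1 / t) \<le> h t"
proof -
  let ?u = "2 * exp 1 / t"
  have u: "?u > 0" using t by simp
  note ht = h[OF t]
  have wh: "w (h t) \<le> ?u"
  proof -
    have "t * w (h t) \<le> t * (2 * exp 1 * H (1 / h t))" using w_le_H[of "h t"] ht t by (intro mult_left_mono) auto
    also have "\<dots> = 2 * exp 1 * (t * H (1 / h t))" by simp
    also have "\<dots> = 2 * exp 1" unfolding ht by simp
    finally show ?thesis using t by (simp add: field_simps)
  qed
  define C where "C = a\<^sub>2 * 2 powr (1 + \<alpha>\<^sub>2)"
  have C: "C > 0" using a2 by (simp add: C_def)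
  have "\<exists>r0>0. r0 \<le> h t \<and> w r0 \<ge> ?u"
  proof -
    \<comment> \<open>For r <= 1, \<open>w_ge\<close> and the lower scaling between r and 1 give
      \<open>a\<^sub>1 * \<nu> 1 / C * (1/r) powr \<alpha>\<^sub>1 \<le> w r\<close>; solving for
      the value 2e/t gives this r.\<close>
    define r where "r = min (min (h t) 1) ((a\<^sub>1 * \<nu> 1 / C / ?u) powr (1 / \<alpha>\<^sub>1))"
    have r: "r > 0" using ht a1 C u nu_pos[of 1] by (auto simp: r_def)
    have r1: "r \<le> 1" "r \<le> h t" by (auto simp: r_def)
    have "r powr \<alpha>\<^sub>1 \<le> ((a\<^sub>1 * \<nu> 1 / C / ?u) powr (1 / \<alpha>\<^sub>1)) powr \<alpha>\<^sub>1"
      by (rule powr_mono2) (use al1 r in \<open>auto simp: r_def\<close>)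
    also have "\<dots> = a\<^sub>1 * \<nu> 1 / C / ?u" using al1 a1 C u t nu_pos[of 1] by (simp add: powr_powr)
    finally have "r powr \<alpha>\<^sub>1 * ?u \<le> a\<^sub>1 * \<nu> 1 / C" by (simp only: pos_le_divide_eq[OF u])
    then have "?u * r powr \<alpha>\<^sub>1 \<le> a\<^sub>1 * \<nu> 1 / C" by (simp only: mult.commute)
    moreover have "r powr \<alpha>\<^sub>1 > 0" using r by simp
    ultimately have "?u \<le> a\<^sub>1 * \<nu> 1 / C / r powr \<alpha>\<^sub>1" by (simp only: pos_le_divide_eq)
    then have "?u \<le> a\<^sub>1 * \<nu> 1 / C * (1/r) powr \<alpha>\<^sub>1" using r by (simp add: powr_divide)
    also have "\<dots> = r * (a\<^sub>1 * (1/r) powr (1 + \<alpha>\<^sub>1) * \<nu> 1) / C" using r by (simp add: powr_add field_simps)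
    also have "\<dots> \<le> r * \<nu> r / C" using nu_ge[of r 1] r r1 C by (intro divide_right_mono mult_left_mono) auto
    also have "\<dots> \<le> w r" unfolding C_def by (rule w_ge[OF r])
    finally show ?thesis using r r1 by blast
  qed
  then obtain r0 where r0: "r0 > 0" "r0 \<le> h t" "w r0 \<ge> ?u" by blast
  have "\<exists>x\<ge>r0. x \<le> h t \<and> w x = ?u"
    by (rule IVT2) (use r0 wh w_cont in auto)
  then obtain x where x: "x \<ge> r0" "x \<le> h t" "w x = ?u" by blast
  have x0: "x > 0" using x r0 by simp
  have "{r. r > 0 \<and> w_fun \<nu> r \<le> ?u} = {x..}"
  proof (intro set_eqI iffI)
    fix r assume "r \<in> {r. r > 0 \<and> w_fun \<nu> r \<le> ?u}"
    then show "r \<in> {x..}" using w_strict[of r x] x w_fun_eq[of r] by force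
  next
    fix r assume "r \<in> {x..}"
    then show "r \<in> {r. r > 0 \<and> w_fun \<nu> r \<le> ?u}" using w_strict[of x r] x x0 w_fun_eq[of r] by (cases "r = x") auto
  qed
  then have "w_inv \<nu> ?u = x" unfolding w_inv_def by simp
  then show "w_inv \<nu> (2 * exp 1 / t) > 0" "w (w_inv \<nu> (2 * exp 1 / t)) = 2 * exp 1 / t"
    "w_inv \<nu> (2 * exp 1 / t) \<le> h t" using x x0 by auto
qed

end

section \<open>Fourier bounds for the Esscher transforms\<close>

lemma one_minus_cos_ge: assumes "\<bar>v\<bar> \<le> 1" shows "v\<^sup>2 / 4 \<le> 1 - cos (v::real)"
proof -
  obtain t where t: "cos v = (\<Sum>m<4. cos_coeff m * v ^ m) + cos (t + 1 / 2 * real 4 * pi) / fact 4 * v ^ 4"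
    using Maclaurin_cos_expansion[of v 4] by blast
  have "\<not> Suc (Suc 0) dvd Suc (Suc (Suc 0))" by presburger
  then have "(\<Sum>m<4. cos_coeff m * v ^ m) = 1 - v\<^sup>2 / 2"
    by (simp add: eval_nat_numeral cos_coeff_def)
  then have "\<bar>cos v - (1 - v\<^sup>2 / 2)\<bar> = \<bar>cos (t + 1 / 2 * real 4 * pi)\<bar> * (\<bar>v\<bar> ^ 4 / fact 4)"
    using t by (simp add: abs_mult power_abs)
  also have "\<dots> \<le> 1 * (\<bar>v\<bar> ^ 4 / fact 4)" by (intro mult_right_mono) auto
  finally have "\<bar>cos v - (1 - v\<^sup>2 / 2)\<bar> \<le> \<bar>v\<bar> ^ 4 / 24" by (simp add: fact_numeral)
  moreover have "\<bar>v\<bar> ^ 4 \<le> v\<^sup>2"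
    using power_decreasing[of 2 4 "\<bar>v\<bar>"] assms by simp
  ultimately show ?thesis using zero_le_power2[of v] by linarith
qed

context scaled_dens
begin

lemma integrable_J: assumes "\<sigma> > 0" shows "integrable N (\<lambda>s. exp (- (\<sigma> * s)) * (1 - cos (\<xi> * s)))"
proof (rule integrable_N[where C="2 * \<bar>\<xi>\<bar> + 2"])
  fix s :: real assume s: "s > 0"
  have e: "exp (- (\<sigma> * s)) \<le> 1" using assms s by simp
  have "1 - cos (\<xi> * s) \<le> 2 * \<bar>\<xi>\<bar> * s"
  proof -
    have "1 - cos (\<xi> * s) = 2 * (sin (\<xi> * s / 2))\<^sup>2" using cos_double_sin[of "\<xi> * s / 2"] by simp
    also have "\<dots> = 2 * (\<bar>sin (\<xi> * s / 2)\<bar> * \<bar>sin (\<xi> * s / 2)\<bar>)" by (simp add: power2_eq_square)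
    also have "\<dots> \<le> 2 * (\<bar>\<xi> * s / 2\<bar> * 1)"
      by (intro mult_left_mono mult_mono abs_sin_x_le_abs_x) auto
    also have "\<dots> \<le> 2 * \<bar>\<xi>\<bar> * s" using s by (simp add: abs_mult)
    finally show ?thesis .
  qed
  moreover have "1 - cos (\<xi> * s) \<le> 2" "0 \<le> 1 - cos (\<xi> * s)" using cos_ge_minus_one[of "\<xi> * s"] by (simp_all del: cos_ge_minus_one)
  ultimately have "1 - cos (\<xi> * s) \<le> (2 * \<bar>\<xi>\<bar> + 2) * min 1 s"
    using s by (intro le_mult_min) auto
  moreover have "exp (- (\<sigma> * s)) * (1 - cos (\<xi> * s)) \<le> 1 * (1 - cos (\<xi> * s))"
    using e by (intro mult_right_mono) auto
  ultimately show "norm (exp (- (\<sigma> * s)) * (1 - cos (\<xi> * s))) \<le> (2 * \<bar>\<xi>\<bar> + 2) * min 1 s"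
    by simp
qed simp

text \<open>Only jumps up to \<rho> are kept: \<rho> \<sigma> <= 1 keeps the tilt factor above 1/e,
  and |\<xi>| \<rho> <= 1 keeps the cosine in its quadratic range, whence 4e.\<close>

lemma J_ge:
  assumes "\<sigma> > 0" "\<rho> > 0" "\<rho> * \<sigma> \<le> 1" "\<bar>\<xi>\<bar> * \<rho> \<le> 1"
  shows "\<xi>\<^sup>2 * K \<rho> / (4 * exp 1) \<le> (\<integral>s. exp (- (\<sigma> * s)) * (1 - cos (\<xi> * s)) \<partial>N)"
proof -
  have "\<xi>\<^sup>2 * K \<rho> / (4 * exp 1) = (\<integral>s. \<xi>\<^sup>2 / (4 * exp 1) * (indicator {..\<rho>} s * s\<^sup>2) \<partial>N)" by (simp add: K_def)
  also have "\<dots> \<le> (\<integral>s. exp (- (\<sigma> * s)) * (1 - cos (\<xi> * s)) \<partial>N)"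
  proof (rule integral_mono_AE)
    show "AE s in N. \<xi>\<^sup>2 / (4 * exp 1) * (indicator {..\<rho>} s * s\<^sup>2) \<le> exp (- (\<sigma> * s)) * (1 - cos (\<xi> * s))"
      using N_pos
    proof eventually_elim
      case (elim s)
      show ?case
      proof (cases "s \<le> \<rho>")
        case True
        have "\<sigma> * s \<le> \<rho> * \<sigma>" using True assms by (simp add: mult.commute)
        then have "exp (-1) \<le> exp (- (\<sigma> * s))" using assms(3) by simp
        moreover have "\<bar>\<xi>\<bar> * s \<le> \<bar>\<xi>\<bar> * \<rho>" using True by (intro mult_left_mono) auto
        then have "(\<xi> * s)\<^sup>2 / 4 \<le> 1 - cos (\<xi> * s)" using assms(4) elim by (intro one_minus_cos_ge) (simp add: abs_mult)
        ultimately have "exp (-1) * ((\<xi> * s)\<^sup>2 / 4) \<le> exp (- (\<sigma> * s)) * (1 - cos (\<xi> * s))"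
          by (intro mult_mono) auto
        then show ?thesis using True by (simp add: exp_minus power_mult_distrib field_simps)
      qed simp
    qed
  qed (use integrable_K[OF assms(2)] integrable_J[OF assms(1)] in auto)
  finally show ?thesis .
qed

text \<open>4e from \<open>J_ge\<close>, \<open>CK\<close> from replacing K by \<phi>2 or H. The two
  regimes below take for \<rho> the smaller of 1/\<sigma> and 1/|\<xi>|.\<close>

definition \<kappa> :: real where "\<kappa> = 1 / (4 * exp 1 * CK)"

lemma kappa_pos: "\<kappa> > 0" using CK_ge_1 by (simp add: \<kappa>_def)

lemma J_ge_near:
  assumes "\<sigma> > 0" "\<bar>\<xi>\<bar> \<le> \<sigma>"
  shows "\<kappa> * (\<xi>\<^sup>2 * \<phi>2 \<sigma>) \<le> (\<integral>s. exp (- (\<sigma> * s)) * (1 - cos (\<xi> * s)) \<partial>N)"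
proof -
  have "\<phi>2 \<sigma> \<le> CK * K (1/\<sigma>)" using phi2_le_K[of "1/\<sigma>"] assms by simp
  then have "\<kappa> * (\<xi>\<^sup>2 * \<phi>2 \<sigma>) \<le> \<kappa> * (\<xi>\<^sup>2 * (CK * K (1/\<sigma>)))" using kappa_pos by (intro mult_left_mono) auto
  also have "\<dots> = \<xi>\<^sup>2 * K (1/\<sigma>) / (4 * exp 1)" using CK_ge_1 by (simp add: \<kappa>_def)
  also have "\<dots> \<le> (\<integral>s. exp (- (\<sigma> * s)) * (1 - cos (\<xi> * s)) \<partial>N)"
    by (rule J_ge) (use assms in \<open>auto simp: field_simps\<close>)
  finally show ?thesis .
qed

lemma J_ge_far:
  assumes "\<sigma> > 0" "\<bar>\<xi>\<bar> \<ge> \<sigma>"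
  shows "\<kappa> * H \<bar>\<xi>\<bar> \<le> (\<integral>s. exp (- (\<sigma> * s)) * (1 - cos (\<xi> * s)) \<partial>N)"
proof -
  have x: "\<bar>\<xi>\<bar> > 0" using assms by simp
  have "H \<bar>\<xi>\<bar> \<le> CK * K (1/\<bar>\<xi>\<bar>) / (1/\<bar>\<xi>\<bar>)\<^sup>2" using H_le_K[of "1/\<bar>\<xi>\<bar>"] x by simp
  then have "\<kappa> * H \<bar>\<xi>\<bar> \<le> \<kappa> * (CK * K (1/\<bar>\<xi>\<bar>) / (1/\<bar>\<xi>\<bar>)\<^sup>2)" using kappa_pos by (intro mult_left_mono) auto
  also have "\<dots> = \<xi>\<^sup>2 * K (1/\<bar>\<xi>\<bar>) / (4 * exp 1)" using CK_ge_1 by (simp add: \<kappa>_def power_divide)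
  also have "\<dots> \<le> (\<integral>s. exp (- (\<sigma> * s)) * (1 - cos (\<xi> * s)) \<partial>N)"
    by (rule J_ge) (use assms x in \<open>auto simp: field_simps\<close>)
  finally show ?thesis .
qed

text \<open>A common envelope for all tilted characteristic functions, with frequency in units of 1
  / sqrt V, or of 1/h in \<open>p_sup\<close>. The factor exp \<kappa> covers low frequencies; the 3
  comes from the far range in \<open>char_tilted_le\<close>.\<close>

definition G0 :: "real \<Rightarrow> real" where "G0 v = exp (\<kappa> - \<kappa> / 3 * \<bar>v\<bar> powr \<gamma>)"

lemma G0_measurable [measurable]: "G0 \<in> borel_measurable borel"
  unfolding G0_def[abs_def] by measurable

lemma G0_integrable: "integrable lborel (\<lambda>v. (1 + \<bar>v\<bar>) * G0 v)"
proof -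
  \<comment> \<open>Cubic decay is enough: the weighted envelope is compared with 1 / (1 + v^2), and
    (1 + v) (1 + v^2) <= 4 v^3 for v >= 1.\<close>
  have "((\<lambda>x::real. x ^ 3 * exp (- (\<kappa> / 3 * x powr \<gamma>))) \<longlongrightarrow> 0) at_top"
    using gamma kappa_pos by real_asymp
  then have "eventually (\<lambda>x::real. x ^ 3 * exp (- (\<kappa> / 3 * x powr \<gamma>)) < 1) at_top"
    by (rule order_tendstoD) simp
  then obtain X0 where X0: "\<And>x. x \<ge> X0 \<Longrightarrow> x ^ 3 * exp (- (\<kappa> / 3 * x powr \<gamma>)) < 1"
    by (auto simp: eventually_at_top_linorder)
  define X where "X = max 1 X0"
  define C where "C = 4 * exp \<kappa> * X ^ 3"
  have X1: "X \<ge> 1" by (simp add: X_def)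
  have pw: "(1 + y) * (1 + y\<^sup>2) \<le> 4 * y ^ 3" if "y \<ge> 1" for y :: real
  proof -
    have "(1 + y) * (1 + y\<^sup>2) \<le> (2 * y) * (2 * y\<^sup>2)" using that by (intro mult_mono) (auto simp: one_le_power)
    then show ?thesis by (simp add: power3_eq_cube power2_eq_square)
  qed
  have main: "(1 + \<bar>v\<bar>) * (1 + v\<^sup>2) * G0 v \<le> C" for v
  proof (cases "\<bar>v\<bar> \<le> X")
    case True
    have "(1 + \<bar>v\<bar>) * (1 + v\<^sup>2) \<le> (1 + X) * (1 + X\<^sup>2)"
      using True power_mono[OF True, of 2] by (intro mult_mono) auto
    also have "\<dots> \<le> 4 * X ^ 3" by (rule pw[OF X1])
    finally have *: "(1 + \<bar>v\<bar>) * (1 + v\<^sup>2) \<le> 4 * X ^ 3" .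
    have "((1 + \<bar>v\<bar>) * (1 + v\<^sup>2)) * G0 v \<le> (4 * X ^ 3) * exp \<kappa>"
      by (rule mult_mono[OF *]) (use kappa_pos X1 in \<open>auto simp: G0_def\<close>)
    then show ?thesis by (simp add: C_def mult_ac)
  next
    case False
    have "(1 + \<bar>v\<bar>) * (1 + \<bar>v\<bar>\<^sup>2) \<le> 4 * \<bar>v\<bar> ^ 3" by (rule pw) (use False X1 in simp)
    then have "(1 + \<bar>v\<bar>) * (1 + v\<^sup>2) * G0 v \<le> 4 * \<bar>v\<bar> ^ 3 * G0 v"
      by (intro mult_right_mono) (auto simp: G0_def)
    also have "\<dots> = 4 * exp \<kappa> * (\<bar>v\<bar> ^ 3 * exp (- (\<kappa> / 3 * \<bar>v\<bar> powr \<gamma>)))"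
      unfolding G0_def diff_conv_add_uminus exp_add by (simp add: mult_ac)
    also have "\<dots> \<le> 4 * exp \<kappa> * 1"
    proof (rule mult_left_mono)
      have "X0 \<le> \<bar>v\<bar>" using False max.cobounded2[of X0 1] unfolding X_def by linarith
      then show "\<bar>v\<bar> ^ 3 * exp (- (\<kappa> / 3 * \<bar>v\<bar> powr \<gamma>)) \<le> 1" using X0[of "\<bar>v\<bar>"] by linarith
    qed simp
    also have "\<dots> \<le> C" using one_le_power[OF X1, of 3] by (simp add: C_def)
    finally show ?thesis .
  qed
  have "integrable lborel (\<lambda>v. C * inverse (1 + v\<^sup>2))"
    using integrable_inverse_1_plus_square by (simp add: set_integrable_def)
  then show ?thesis
  proof (rule Bochner_Integration.integrable_bound)
    show "AE v in lborel. norm ((1 + \<bar>v\<bar>) * G0 v) \<le> norm (C * inverse (1 + v\<^sup>2))"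
    proof (rule AE_I2)
      fix v :: real
      have p: "1 + v\<^sup>2 > 0" by (simp add: add_pos_nonneg)
      have "0 \<le> C" using X1 by (simp add: C_def)
      moreover have "0 \<le> (1 + \<bar>v\<bar>) * G0 v" by (simp add: G0_def)
      moreover have "(1 + \<bar>v\<bar>) * G0 v \<le> C * inverse (1 + v\<^sup>2)"
        using main[of v] p by (simp add: field_simps)
      ultimately show "norm ((1 + \<bar>v\<bar>) * G0 v) \<le> norm (C * inverse (1 + v\<^sup>2))" by simp
    qed
  qed measurable
qed

lemma G0_integrable': "integrable lborel G0" "integrable lborel (\<lambda>v. \<bar>v\<bar> * G0 v)"
  by (rule Bochner_Integration.integrable_bound[OF G0_integrable], measurable, simp add: G0_def abs_mult)+

text \<open>The weight 1 + |v| lets one constant bound both the integral of the envelope and its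
  first absolute moment.\<close>

definition CS :: real where "CS = (\<integral>v. (1 + \<bar>v\<bar>) * G0 v \<partial>lborel)"

lemma CS: "(\<integral>v. G0 v \<partial>lborel) \<le> CS" "(\<integral>v. \<bar>v\<bar> * G0 v \<partial>lborel) \<le> CS"
proof -
  have "0 \<le> G0 v" for v by (simp add: G0_def)
  then have "G0 v \<le> (1 + \<bar>v\<bar>) * G0 v" "\<bar>v\<bar> * G0 v \<le> (1 + \<bar>v\<bar>) * G0 v" for v
    by (simp_all add: distrib_right)
  then show "(\<integral>v. G0 v \<partial>lborel) \<le> CS" "(\<integral>v. \<bar>v\<bar> * G0 v \<partial>lborel) \<le> CS"
    unfolding CS_def using G0_integrable G0_integrable' by (auto intro!: integral_mono)
qed

lemma G0_scaled:
  assumes "c > 0"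
  shows "integrable lborel (\<lambda>\<xi>. G0 (c * \<xi>))" "(\<integral>\<xi>. G0 (c * \<xi>) \<partial>lborel) \<le> CS / c"
    "integrable lborel (\<lambda>\<xi>. \<bar>\<xi>\<bar> * G0 (c * \<xi>))" "(\<integral>\<xi>. \<bar>\<xi>\<bar> * G0 (c * \<xi>) \<partial>lborel) \<le> CS / c\<^sup>2"
proof -
  show "integrable lborel (\<lambda>\<xi>. G0 (c * \<xi>))"
    using lborel_integrable_real_affine[OF G0_integrable'(1), of c 0] assms by simp
  have "integrable lborel (\<lambda>\<xi>. \<bar>c * \<xi>\<bar> * G0 (c * \<xi>))"
    using lborel_integrable_real_affine[OF G0_integrable'(2), of c 0] assms by simp
  then have "integrable lborel (\<lambda>\<xi>. 1/c * (\<bar>c * \<xi>\<bar> * G0 (c * \<xi>)))" by simp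
  then show "integrable lborel (\<lambda>\<xi>. \<bar>\<xi>\<bar> * G0 (c * \<xi>))" using assms by (simp add: abs_mult)
  have "(\<integral>v. G0 v \<partial>lborel) = c * (\<integral>\<xi>. G0 (c * \<xi>) \<partial>lborel)"
    using lborel_integral_real_affine[of c G0 0] assms by simp
  then show "(\<integral>\<xi>. G0 (c * \<xi>) \<partial>lborel) \<le> CS / c" using CS(1) assms by (simp add: field_simps)
  have "(\<integral>v. \<bar>v\<bar> * G0 v \<partial>lborel) = c * (\<integral>\<xi>. \<bar>c * \<xi>\<bar> * G0 (c * \<xi>) \<partial>lborel)"
    using lborel_integral_real_affine[of c "\<lambda>v. \<bar>v\<bar> * G0 v" 0] assms by simp
  also have "\<dots> = c\<^sup>2 * (\<integral>\<xi>. \<bar>\<xi>\<bar> * G0 (c * \<xi>) \<partial>lborel)"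
    using assms by (simp add: abs_mult mult.assoc power2_eq_square)
  finally show "(\<integral>\<xi>. \<bar>\<xi>\<bar> * G0 (c * \<xi>) \<partial>lborel) \<le> CS / c\<^sup>2" using CS(2) assms by (simp add: field_simps)
qed

lemma CS_pos: "CS > 0"
proof -
  have "(\<integral>v. (1 + \<bar>v\<bar>) * G0 v \<partial>lborel) \<noteq> 0"
  proof
    assume "(\<integral>v. (1 + \<bar>v\<bar>) * G0 v \<partial>lborel) = 0"
    then have "AE v in lborel. (1 + \<bar>v\<bar>) * G0 v = 0"
      using integral_nonneg_eq_0_iff_AE[OF G0_integrable] by (simp add: G0_def)
    then have "AE v in (lborel :: real measure). False" by eventually_elim (simp add: G0_def add_nonneg_eq_0_iff)
    then show False by (simp add: trivial_limit_def[symmetric] ae_filter_eq_bot_iff)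
  qed
  moreover have "CS \<ge> 0" unfolding CS_def by (rule integral_nonneg_AE) (auto simp: G0_def)
  ultimately show ?thesis by (simp add: CS_def)
qed

lemma square_ge_powr_gamma: assumes "v \<ge> 0" shows "v powr \<gamma> - 1 \<le> v\<^sup>2"
proof (cases "v \<le> 1")
  case True
  then have "v powr \<gamma> \<le> 1" using gamma assms by (simp add: powr_le1)
  then show ?thesis by (smt (verit) zero_le_power2)
next
  case False
  then have "v powr \<gamma> \<le> v powr 2" using gamma by (intro powr_mono) auto
  also have "v powr 2 = v\<^sup>2" using False by (simp add: powr_numeral)
  finally show ?thesis by simp
qed

end

lemma div_2pi_le: "x \<ge> 0 \<Longrightarrow> x / (2 * pi) \<le> x"
  using pi_gt3 mult_left_mono[of 1 "2 * pi" x] by (simp add: divide_le_eq)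

locale sub_scaled = sub_density \<nu> p Q t + scaled_dens \<nu> a\<^sub>1 a\<^sub>2 \<alpha>\<^sub>1 \<alpha>\<^sub>2
  for \<nu> p Q t a\<^sub>1 a\<^sub>2 \<alpha>\<^sub>1 \<alpha>\<^sub>2
begin

definition V :: "real \<Rightarrow> real" where "V \<sigma> = t * \<phi>2 \<sigma>"

lemma V_pos: "\<sigma> > 0 \<Longrightarrow> V \<sigma> > 0" using phi2_pos t_pos by (simp add: V_def)

text \<open>For |\<xi>| <= \<sigma> the exponent is at least of order V \<xi>^2, which beats the
  power \<gamma> up to the additive \<kappa>. For larger |\<xi>| it is at least of order t
  H(|\<xi>|), and \<open>H_lower\<close> relates this to the frequency \<sigma>, where t H(\<sigma>)
  dominates \<sigma>^2 V / 2.\<close>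

lemma char_tilted_le:
  assumes \<sigma>: "\<sigma> > 0" "t * H \<sigma> \<ge> 1"
  shows "cmod (char (Qs \<sigma>) \<xi>) \<le> G0 (sqrt (V \<sigma>) * \<xi>)"
proof -
  let ?J = "\<integral>s. exp (- (\<sigma> * s)) * (1 - cos (\<xi> * s)) \<partial>N"
  define v where "v = \<bar>sqrt (V \<sigma>) * \<xi>\<bar>"
  have V0: "V \<sigma> > 0" by (rule V_pos[OF \<sigma>(1)])
  have "\<kappa> / 3 * v powr \<gamma> - \<kappa> \<le> t * ?J"
  proof (cases "\<bar>\<xi>\<bar> \<le> \<sigma>")
    case True
    have "v powr \<gamma> / 3 - 1 \<le> v powr \<gamma> - 1" by simp
    also have "\<dots> \<le> v\<^sup>2" by (rule square_ge_powr_gamma) (simp add: v_def)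
    also have "v\<^sup>2 = V \<sigma> * \<xi>\<^sup>2" using V0 by (simp add: v_def power_mult_distrib)
    finally have "\<kappa> * (v powr \<gamma> / 3 - 1) \<le> \<kappa> * (V \<sigma> * \<xi>\<^sup>2)" using kappa_pos by (intro mult_left_mono) auto
    also have "\<dots> = t * (\<kappa> * (\<xi>\<^sup>2 * \<phi>2 \<sigma>))" by (simp add: V_def)
    also have "\<dots> \<le> t * ?J" using J_ge_near[OF \<sigma>(1) True] t_pos by (intro mult_left_mono) auto
    finally show ?thesis by (simp add: algebra_simps)
  next
    case False
    then have xi: "\<bar>\<xi>\<bar> > 0" "\<sigma> \<le> \<bar>\<xi>\<bar>" using \<sigma> by auto
    define n where "n = \<sigma> * sqrt (V \<sigma>)"
    have n0: "n \<ge> 0" using \<sigma> V0 by (simp add: n_def)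
    have "n\<^sup>2 = t * (\<sigma>\<^sup>2 * \<phi>2 \<sigma>)" using V0 by (simp add: n_def power_mult_distrib V_def)
    also have "\<dots> \<le> t * (2 * H \<sigma>)" using H_ge_phi2[OF \<sigma>(1)] t_pos by (intro mult_left_mono) auto
    \<comment> \<open>n^\<gamma> <= n^2 + 1 <= 2 t H(\<sigma>) + 1; the hypothesis t H(\<sigma>) >=
      1 absorbs the 1 and gives the 3.\<close>
    finally have "n powr \<gamma> \<le> 3 * (t * H \<sigma>)" using square_ge_powr_gamma[OF n0] \<sigma> by simp
    moreover have "v powr \<gamma> = (\<bar>\<xi>\<bar> / \<sigma>) powr \<gamma> * n powr \<gamma>"
      using \<sigma> n0 V0 by (simp add: v_def n_def abs_mult powr_mult[symmetric] mult.commute)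
    ultimately have "v powr \<gamma> \<le> (\<bar>\<xi>\<bar> / \<sigma>) powr \<gamma> * (3 * (t * H \<sigma>))"
      by (simp add: mult_left_mono)
    also have "\<dots> = 3 * (t * ((\<bar>\<xi>\<bar> / \<sigma>) powr \<gamma> * H \<sigma>))" by simp
    also have "\<dots> \<le> 3 * (t * H \<bar>\<xi>\<bar>)" using H_lower[OF \<sigma>(1) xi(2)] t_pos by (intro mult_left_mono) auto
    finally have "\<kappa> / 3 * v powr \<gamma> \<le> \<kappa> / 3 * (3 * (t * H \<bar>\<xi>\<bar>))" using kappa_pos by (intro mult_left_mono) auto
    also have "\<dots> = t * (\<kappa> * H \<bar>\<xi>\<bar>)" by simp
    also have "\<dots> \<le> t * ?J" using J_ge_far[OF \<sigma>(1) xi(2)] t_pos by (intro mult_left_mono) auto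
    finally show ?thesis using kappa_pos by simp
  qed
  then show ?thesis unfolding cmod_char_Qs[OF \<sigma>(1)] G0_def v_def by simp
qed

lemma tilted_sup:
  assumes \<sigma>: "\<sigma> > 0" "t * H \<sigma> \<ge> 1" and x: "x > 0"
  shows "ps \<sigma> x \<le> CS / sqrt (V \<sigma>)"
proof -
  interpret T: cont_density "ps \<sigma>" "Qs \<sigma>" by (rule tilted) (use \<sigma> in simp)
  have s: "sqrt (V \<sigma>) > 0" using V_pos \<sigma> by simp
  have "ps \<sigma> x \<le> (\<integral>\<xi>. G0 (sqrt (V \<sigma>) * \<xi>) \<partial>lborel) / (2 * pi)"
    by (rule T.p_le_char_integral[OF G0_scaled(1)[OF s] char_tilted_le[OF \<sigma>] x])
  also have "\<dots> \<le> (\<integral>\<xi>. G0 (sqrt (V \<sigma>) * \<xi>) \<partial>lborel)"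
    by (rule div_2pi_le) (auto simp: G0_def intro!: integral_nonneg_AE)
  also have "\<dots> \<le> CS / sqrt (V \<sigma>)" by (rule G0_scaled(2)[OF s])
  finally show ?thesis .
qed

lemma tilted_lipschitz:
  assumes \<sigma>: "\<sigma> > 0" "t * H \<sigma> \<ge> 1" and x: "x > 0" "y > 0"
  shows "\<bar>ps \<sigma> x - ps \<sigma> y\<bar> \<le> CS / V \<sigma> * \<bar>x - y\<bar>"
proof -
  interpret T: cont_density "ps \<sigma>" "Qs \<sigma>" by (rule tilted) (use \<sigma> in simp)
  have s: "sqrt (V \<sigma>) > 0" using V_pos \<sigma> by simp
  have "\<bar>ps \<sigma> x - ps \<sigma> y\<bar> \<le> \<bar>x - y\<bar> * (\<integral>\<xi>. \<bar>\<xi>\<bar> * G0 (sqrt (V \<sigma>) * \<xi>) \<partial>lborel) / (2 * pi)"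
    by (rule T.p_lipschitz_char_integral[OF G0_scaled(3)[OF s] char_tilted_le[OF \<sigma>] x])
  also have "\<dots> \<le> \<bar>x - y\<bar> * (\<integral>\<xi>. \<bar>\<xi>\<bar> * G0 (sqrt (V \<sigma>) * \<xi>) \<partial>lborel)"
    by (rule div_2pi_le) (auto simp: G0_def intro!: integral_nonneg_AE)
  also have "\<dots> \<le> \<bar>x - y\<bar> * (CS / (sqrt (V \<sigma>))\<^sup>2)" by (intro mult_left_mono G0_scaled(4)[OF s]) auto
  finally show ?thesis using V_pos[OF \<sigma>(1)] by (simp add: mult.commute)
qed

text \<open>The characteristic function has been computed for \<sigma> > 0, so the bound is proved
  for tilts \<sigma> < 1/h, uniformly, and \<sigma> then tends to 0. Below frequency 1/h the trivial
  bound on the exponent is enough; above it \<open>H_lower\<close> starts from t H(1/h) = 1.\<close>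

lemma p_sup:
  assumes x: "x > 0"
  shows "p x \<le> CS / h t"
proof -
  note ht = h[OF t_pos]
  have "p x \<le> exp (\<sigma> * x) * (CS / h t)" if \<sigma>: "0 < \<sigma>" "\<sigma> < 1 / h t" for \<sigma>
  proof -
    interpret T: cont_density "ps \<sigma>" "Qs \<sigma>" by (rule tilted) (use \<sigma> in simp)
    have ch: "cmod (char (Qs \<sigma>) \<xi>) \<le> G0 (h t * \<xi>)" for \<xi>
    proof -
      let ?J = "\<integral>s. exp (- (\<sigma> * s)) * (1 - cos (\<xi> * s)) \<partial>N"
      have "\<kappa> / 3 * \<bar>h t * \<xi>\<bar> powr \<gamma> - \<kappa> \<le> t * ?J"
      proof (cases "\<bar>\<xi>\<bar> \<le> 1 / h t")
        case True
        then have "\<bar>h t * \<xi>\<bar> \<le> 1" using ht by (simp add: abs_mult field_simps)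
        then have "\<bar>h t * \<xi>\<bar> powr \<gamma> \<le> 1" using gamma by (simp add: powr_le1)
        then have "\<kappa> / 3 * \<bar>h t * \<xi>\<bar> powr \<gamma> \<le> \<kappa> / 3 * 1" using kappa_pos by (intro mult_left_mono) auto
        moreover have "0 \<le> ?J" by (rule integral_nonneg_AE) auto
        then have "0 \<le> t * ?J" using t_pos by simp
        ultimately show ?thesis using kappa_pos by linarith
      next
        case False
        then have xi: "1 / h t \<le> \<bar>\<xi>\<bar>" "\<sigma> \<le> \<bar>\<xi>\<bar>" using \<sigma> by auto
        have "(\<bar>\<xi>\<bar> / (1 / h t)) powr \<gamma> * H (1 / h t) \<le> H \<bar>\<xi>\<bar>" by (rule H_lower) (use ht xi in auto)
        then have "t * ((\<bar>\<xi>\<bar> / (1 / h t)) powr \<gamma> * H (1 / h t)) \<le> t * H \<bar>\<xi>\<bar>" using t_pos by simp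
        moreover have "t * ((\<bar>\<xi>\<bar> / (1 / h t)) powr \<gamma> * H (1 / h t)) = \<bar>h t * \<xi>\<bar> powr \<gamma> * (t * H (1 / h t))"
          using ht by (simp add: abs_mult mult.commute)
        ultimately have "\<bar>h t * \<xi>\<bar> powr \<gamma> \<le> t * H \<bar>\<xi>\<bar>" unfolding ht(2) by simp
        then have "\<kappa> * \<bar>h t * \<xi>\<bar> powr \<gamma> \<le> \<kappa> * (t * H \<bar>\<xi>\<bar>)" using kappa_pos by (intro mult_left_mono) auto
        also have "\<dots> = t * (\<kappa> * H \<bar>\<xi>\<bar>)" by simp
        also have "\<dots> \<le> t * ?J" using J_ge_far[OF \<sigma>(1) xi(2)] t_pos by (intro mult_left_mono) auto
        finally have "\<kappa> * \<bar>h t * \<xi>\<bar> powr \<gamma> \<le> t * ?J" .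
        moreover have "\<kappa> / 3 * \<bar>h t * \<xi>\<bar> powr \<gamma> \<le> \<kappa> * \<bar>h t * \<xi>\<bar> powr \<gamma>" using kappa_pos by (intro mult_right_mono) auto
        ultimately show ?thesis using kappa_pos by linarith
      qed
      then show ?thesis unfolding cmod_char_Qs[OF \<sigma>(1)] G0_def by simp
    qed
    have "ps \<sigma> x \<le> (\<integral>\<xi>. G0 (h t * \<xi>) \<partial>lborel) / (2 * pi)"
      by (rule T.p_le_char_integral[OF G0_scaled(1)[OF ht(1)] ch x])
    also have "\<dots> \<le> (\<integral>\<xi>. G0 (h t * \<xi>) \<partial>lborel)"
      by (rule div_2pi_le) (auto simp: G0_def intro!: integral_nonneg_AE)
    also have "\<dots> \<le> CS / h t" by (rule G0_scaled(2)[OF ht(1)])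
    finally have ps: "ps \<sigma> x \<le> CS / h t" .
    \<comment> \<open>This allows the normalising factor exp(t \<phi>(\<sigma>)) to be dropped; only
      exp(\<sigma> x) remains, which tends to 1.\<close>
    have "\<phi> \<sigma> \<ge> 0" unfolding \<phi>_def by (rule integral_nonneg_AE) (use N_pos \<sigma> in \<open>auto elim!: eventually_mono\<close>)
    then have "exp (- (\<sigma> * x)) \<le> exp (t * \<phi> \<sigma> - \<sigma> * x)" using t_pos by simp
    then have "exp (- (\<sigma> * x)) * p x \<le> exp (t * \<phi> \<sigma> - \<sigma> * x) * p x" using p_nonneg[OF x] by (intro mult_right_mono) auto
    also have "\<dots> \<le> CS / h t" using ps by (simp add: ps_def)
    finally show ?thesis by (simp add: exp_minus field_simps)
  qed
  then have "eventually (\<lambda>\<sigma>. p x \<le> exp (\<sigma> * x) * (CS / h t)) (at_right 0)"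
    using eventually_at_right_less[of 0] eventually_at_right_real[of 0 "1 / h t"] ht
    by (auto elim!: eventually_mono)
  moreover have "((\<lambda>\<sigma>. exp (\<sigma> * x) * (CS / h t)) \<longlongrightarrow> exp (0 * x) * (CS / h t)) (at_right 0)"
    by (intro tendsto_intros)
  ultimately show ?thesis using tendsto_lowerbound[of _ _ "at_right (0::real)" "p x"] by fastforce
qed

end

section \<open>Propagation of lower bounds\<close>

text \<open>Transfers consequences of the almost everywhere Steutel identity to every point: a
  violation would spread to a ball of positive measure, and the endpoints follow by closure.\<close>

lemma AE_continuous_ge:
  fixes g :: "real \<Rightarrow> real"
  assumes "u < v" and cont: "continuous_on {u..v} g"
    and ae: "AE x in lborel. x \<in> {u<..<v} \<longrightarrow> k \<le> g x" and x: "x \<in> {u..v}"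
  shows "k \<le> g x"
proof -
  have oc: "continuous_on {u<..<v} g" by (rule continuous_on_subset[OF cont]) auto
  have *: "k \<le> g y" if "y \<in> {u<..<v}" for y
  proof (rule ccontr)
    assume "\<not> k \<le> g y"
    define U where "U = {u<..<v} \<inter> g -` {..<k}"
    have "open U" unfolding U_def using continuous_open_preimage[OF oc] by auto
    moreover have "y \<in> U" using that \<open>\<not> k \<le> g y\<close> by (simp add: U_def)
    ultimately obtain e where e: "e > 0" "ball y e \<subseteq> U" using open_contains_ball by blast
    from ae have "AE x in lborel. x \<notin> ball y e"
      by eventually_elim (use e in \<open>force simp: U_def\<close>)
    then have "emeasure lborel {x. \<not> x \<notin> ball y e} = 0" by (subst (asm) AE_iff_measurable[OF _ refl]) auto
    also have "{x. \<not> x \<notin> ball y e} = {y - e<..<y + e}" by (auto simp: ball_def dist_real_def)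
    finally show False using e by (simp add: ennreal_eq_0_iff)
  qed
  have cl: "closure {u<..<v} = {u..v}" using assms(1) by simp
  show ?thesis
    by (rule continuous_ge_on_closure[of "{u<..<v}" g]) (use cl cont x * in auto)
qed

section \<open>Moments of the Esscher transforms and propagation to the right\<close>

context sub_density
begin

lemma integrable_Q_mom:
  assumes "u > 0"
  shows "integrable Q (\<lambda>x. x * exp (- (u * x)))" "integrable Q (\<lambda>x. x\<^sup>2 * exp (- (u * x)))"
proof -
  interpret prob_space Q by (rule prob_Q)
  show "integrable Q (\<lambda>x. x * exp (- (u * x)))"
  proof (rule integrable_const_bound[where B="1/u"])
    show "AE x in Q. norm (x * exp (- (u * x))) \<le> 1 / u"
      using Q_pos by eventually_elim (use s_exp_bound(1)[OF assms] in simp)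
  qed measurable
  show "integrable Q (\<lambda>x. x\<^sup>2 * exp (- (u * x)))"
  proof (rule integrable_const_bound[where B="4/u\<^sup>2"])
    show "AE x in Q. norm (x\<^sup>2 * exp (- (u * x))) \<le> 4 / u\<^sup>2"
      using Q_pos by eventually_elim (use s_exp_bound(2)[OF assms] in simp)
  qed measurable
qed

lemma Q_moments:
  assumes u: "u > 0"
  shows "(\<integral>x. x * exp (- (u * x)) \<partial>Q) = t * \<phi>1 u * exp (- (t * \<phi> u))"
    "(\<integral>x. x\<^sup>2 * exp (- (u * x)) \<partial>Q) = ((t * \<phi>1 u)\<^sup>2 + t * \<phi>2 u) * exp (- (t * \<phi> u))"
proof -
  have op: "open {0::real<..}" by simp
  have 1: "(\<integral>x. x * exp (- (u * x)) \<partial>Q) = t * \<phi>1 u * exp (- (t * \<phi> u))" if u: "u > 0" for u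
  proof -
    have "((\<lambda>u. \<integral>x. exp (- (u * x)) \<partial>Q) has_real_derivative - (\<integral>x. x * exp (- (u * x)) \<partial>Q)) (at u)"
      using laplace_moment_deriv[OF sets_Q Q_pos u, of 0] integrable_Q_exp integrable_Q_mom(1) by simp
    moreover have "((\<lambda>u. exp (- (t * \<phi> u))) has_real_derivative - (t * \<phi>1 u * exp (- (t * \<phi> u)))) (at u)"
      by (auto intro!: derivative_eq_intros phi_deriv u)
    then have "((\<lambda>u. \<integral>x. exp (- (u * x)) \<partial>Q) has_real_derivative - (t * \<phi>1 u * exp (- (t * \<phi> u)))) (at u)"
      by (rule has_field_derivative_transform_within_open[OF _ op]) (use u laplace in auto)
    ultimately have "- (\<integral>x. x * exp (- (u * x)) \<partial>Q) = - (t * \<phi>1 u * exp (- (t * \<phi> u)))" by (rule DERIV_unique)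
    then show ?thesis by simp
  qed
  show "(\<integral>x. x * exp (- (u * x)) \<partial>Q) = t * \<phi>1 u * exp (- (t * \<phi> u))" by (rule 1[OF u])
  have "((\<lambda>u. \<integral>x. x * exp (- (u * x)) \<partial>Q) has_real_derivative - (\<integral>x. x\<^sup>2 * exp (- (u * x)) \<partial>Q)) (at u)"
    using laplace_moment_deriv[OF sets_Q Q_pos u, of 1] integrable_Q_mom by (simp add: numeral_2_eq_2)
  moreover have "((\<lambda>u. t * \<phi>1 u * exp (- (t * \<phi> u))) has_real_derivative - (((t * \<phi>1 u)\<^sup>2 + t * \<phi>2 u) * exp (- (t * \<phi> u)))) (at u)"
    by (auto intro!: derivative_eq_intros phi_deriv phi1_deriv u simp: power2_eq_square algebra_simps)
  then have "((\<lambda>u. \<integral>x. x * exp (- (u * x)) \<partial>Q) has_real_derivative - (((t * \<phi>1 u)\<^sup>2 + t * \<phi>2 u) * exp (- (t * \<phi> u)))) (at u)"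
    by (rule has_field_derivative_transform_within_open[OF _ op]) (use u 1 in auto)
  ultimately have "- (\<integral>x. x\<^sup>2 * exp (- (u * x)) \<partial>Q) = - (((t * \<phi>1 u)\<^sup>2 + t * \<phi>2 u) * exp (- (t * \<phi> u)))"
    by (rule DERIV_unique)
  then show "(\<integral>x. x\<^sup>2 * exp (- (u * x)) \<partial>Q) = ((t * \<phi>1 u)\<^sup>2 + t * \<phi>2 u) * exp (- (t * \<phi> u))" by simp
qed

lemma integrable_Qs_iff:
  fixes f :: "real \<Rightarrow> real"
  assumes "f \<in> borel_measurable borel"
  shows "integrable (Qs \<sigma>) f \<longleftrightarrow> integrable Q (\<lambda>x. f x * exp (- (\<sigma> * x)))"
proof -
  have "integrable (Qs \<sigma>) f \<longleftrightarrow> integrable Q (\<lambda>x. exp (t * \<phi> \<sigma> - \<sigma> * x) *\<^sub>R f x)"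
    unfolding Qs_eq by (rule integrable_density) (use assms in auto)
  also have "(\<lambda>x. exp (t * \<phi> \<sigma> - \<sigma> * x) *\<^sub>R f x) = (\<lambda>x. exp (t * \<phi> \<sigma>) * (f x * exp (- (\<sigma> * x))))"
    by (auto simp: exp_diff exp_minus field_simps)
  finally show ?thesis by simp
qed

lemma integral_Qs_real:
  fixes f :: "real \<Rightarrow> real"
  assumes "f \<in> borel_measurable borel"
  shows "(\<integral>x. f x \<partial>Qs \<sigma>) = exp (t * \<phi> \<sigma>) * (\<integral>x. f x * exp (- (\<sigma> * x)) \<partial>Q)"
proof -
  have "(\<lambda>x. exp (t * \<phi> \<sigma> - \<sigma> * x) *\<^sub>R f x) = (\<lambda>x. exp (t * \<phi> \<sigma>) * (f x * exp (- (\<sigma> * x))))"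
    by (auto simp: exp_diff exp_minus field_simps)
  then show ?thesis unfolding integral_Qs[OF assms] by simp
qed

lemma Qs_moments:
  assumes s: "\<sigma> > 0"
  defines "m \<equiv> t * \<phi>1 \<sigma>"
  shows "integrable (Qs \<sigma>) (\<lambda>x. x)" "(\<integral>x. x \<partial>Qs \<sigma>) = m"
    "integrable (Qs \<sigma>) (\<lambda>x. (x - m)\<^sup>2)" "(\<integral>x. (x - m)\<^sup>2 \<partial>Qs \<sigma>) = t * \<phi>2 \<sigma>"
proof -
  interpret prob_space "Qs \<sigma>" using cont_density.M_dist[OF tilted, of \<sigma>] s by (simp add: real_distribution_def)
  have i1: "integrable (Qs \<sigma>) (\<lambda>x. x)" and i2: "integrable (Qs \<sigma>) (\<lambda>x. x\<^sup>2)"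
    using integrable_Q_mom[OF s] by (subst integrable_Qs_iff; simp)+
  show "integrable (Qs \<sigma>) (\<lambda>x. x)" by (rule i1)
  have e: "exp (t * \<phi> \<sigma>) * (c * exp (- (t * \<phi> \<sigma>))) = c" for c by (simp add: exp_minus)
  have m1: "(\<integral>x. x \<partial>Qs \<sigma>) = m"
    by (subst integral_Qs_real) (simp_all add: Q_moments(1)[OF s] e m_def)
  then show "(\<integral>x. x \<partial>Qs \<sigma>) = m" .
  have m2: "(\<integral>x. x\<^sup>2 \<partial>Qs \<sigma>) = m\<^sup>2 + t * \<phi>2 \<sigma>"
    by (subst integral_Qs_real) (simp_all add: Q_moments(2)[OF s] e m_def)
  have eq: "(\<lambda>x. (x - m)\<^sup>2) = (\<lambda>x. x\<^sup>2 - 2 * m * x + m\<^sup>2)" by (auto simp: power2_eq_square algebra_simps)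
  show "integrable (Qs \<sigma>) (\<lambda>x. (x - m)\<^sup>2)" unfolding eq using i1 i2 by simp
  have "(\<integral>x. (x - m)\<^sup>2 \<partial>Qs \<sigma>) = (\<integral>x. x\<^sup>2 \<partial>Qs \<sigma>) - 2 * m * (\<integral>x. x \<partial>Qs \<sigma>) + m\<^sup>2"
    unfolding eq using i1 i2 by (simp add: prob_space[simplified])
  then show "(\<integral>x. (x - m)\<^sup>2 \<partial>Qs \<sigma>) = t * \<phi>2 \<sigma>"
    unfolding m1 m2 by (simp add: power2_eq_square)
qed

lemma measure_Qs_Icc_le:
  assumes s: "\<sigma> \<ge> 0" and ab: "a \<le> b" and le: "\<And>x. x > 0 \<Longrightarrow> a \<le> x \<Longrightarrow> x \<le> b \<Longrightarrow> ps \<sigma> x \<le> B" and B: "B \<ge> 0"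
  shows "measure (Qs \<sigma>) {a..b} \<le> B * (b - a)"
proof -
  interpret prob_space "Qs \<sigma>" using cont_density.M_dist[OF tilted[OF s]] by (simp add: real_distribution_def)
  have m: "(\<lambda>x. ennreal (indicator {0<..} x * ps \<sigma> x)) \<in> borel_measurable lborel"
    using cont_density.p0_measurable[OF tilted[OF s]] by simp
  have "emeasure (Qs \<sigma>) {a..b} = (\<integral>\<^sup>+x. ennreal (indicator {0<..} x * ps \<sigma> x) * indicator {a..b} x \<partial>lborel)"
    unfolding Qs_def by (rule emeasure_density[OF m]) auto
  also have "\<dots> \<le> (\<integral>\<^sup>+x. ennreal B * indicator {a..b} x \<partial>lborel)"
    by (rule nn_integral_mono) (use le B in \<open>auto simp: indicator_def intro!: ennreal_leI\<close>)
  also have "\<dots> = ennreal (B * (b - a))" using B ab by (simp add: nn_integral_cmult_indicator ennreal_mult)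
  finally show ?thesis using B ab by (simp add: emeasure_eq_measure)
qed

text \<open>For exp(l x) p(x) the identity has the kernel t s exp(l s) \<nu>(s). Dropping the jumps
  above r leaves a weighted integral of values on [x - r, x), where \<open>b\<close> is a lower
  bound.\<close>

lemma steutel_lower:
  assumes r: "r > 0" and xr: "r \<le> x" and b: "b \<ge> 0"
    and id: "ennreal (x * p0 x) = (\<integral>\<^sup>+s. ennreal (t * s * \<nu>0 s * p0 (x - s)) \<partial>lborel)"
    and low: "\<And>y. y \<ge> x - r \<Longrightarrow> y < x \<Longrightarrow> b \<le> exp (l * y) * p0 y"
  shows "b * (t * (\<integral>s. indicator {..r} s * (s * exp (l * s)) \<partial>N)) \<le> exp (l * x) * (x * p0 x)"
proof -
  have x0: "x > 0" using r xr by simp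
  have "ennreal (b * (t * (\<integral>s. indicator {..r} s * (s * exp (l * s)) \<partial>N)) * exp (- (l * x)))
     = ennreal (\<integral>s. indicator {..r} s * (s * exp (l * s)) \<partial>N) * ennreal (b * t * exp (- (l * x)))"
    using s_exp_trunc_nonneg[of r l] by (subst ennreal_mult'[symmetric]) (auto simp: mult_ac)
  also have "ennreal (\<integral>s. indicator {..r} s * (s * exp (l * s)) \<partial>N) = (\<integral>\<^sup>+s. ennreal (indicator {..r} s * (s * exp (l * s))) \<partial>N)"
    by (rule nn_integral_eq_integral[symmetric, OF integrable_s_exp_trunc[OF r]]) (use N_pos in \<open>auto elim!: eventually_mono simp: indicator_def\<close>)
  also have "\<dots> = (\<integral>\<^sup>+s. ennreal (\<nu>0 s) * ennreal (indicator {..r} s * (s * exp (l * s))) \<partial>lborel)"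
    unfolding N_def by (rule nn_integral_density) measurable
  also have "\<dots> * ennreal (b * t * exp (- (l * x))) = (\<integral>\<^sup>+s. ennreal (\<nu>0 s) * ennreal (indicator {..r} s * (s * exp (l * s))) * ennreal (b * t * exp (- (l * x))) \<partial>lborel)"
    by (rule nn_integral_multc[symmetric]) measurable
  also have "\<dots> \<le> (\<integral>\<^sup>+s. ennreal (t * s * \<nu>0 s * p0 (x - s)) \<partial>lborel)"
  proof (rule nn_integral_mono)
    fix s
    show "ennreal (\<nu>0 s) * ennreal (indicator {..r} s * (s * exp (l * s))) * ennreal (b * t * exp (- (l * x)))
        \<le> ennreal (t * s * \<nu>0 s * p0 (x - s))"
    proof (cases "0 < s \<and> s \<le> r")
      case True
      have "b \<le> exp (l * (x - s)) * p0 (x - s)" using low[of "x - s"] True by simp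
      then have "b * (exp (l * s) * exp (- (l * x))) \<le> exp (l * (x - s)) * p0 (x - s) * (exp (l * s) * exp (- (l * x)))"
        by (rule mult_right_mono) simp
      also have "\<dots> = p0 (x - s) * (exp (l * (x - s)) * exp (l * s) * exp (- (l * x)))" by simp
      also have "exp (l * (x - s)) * exp (l * s) * exp (- (l * x)) = 1" unfolding exp_add[symmetric] by (simp add: algebra_simps)
      finally have "(t * s * \<nu>0 s) * (b * (exp (l * s) * exp (- (l * x)))) \<le> (t * s * \<nu>0 s) * p0 (x - s)"
        using True t_pos by (intro mult_left_mono) auto
      then have "\<nu>0 s * (s * exp (l * s)) * (b * t * exp (- (l * x))) \<le> t * s * \<nu>0 s * p0 (x - s)"
        by (simp add: mult_ac)
      then have "ennreal (\<nu>0 s * (s * exp (l * s)) * (b * t * exp (- (l * x)))) \<le> ennreal (t * s * \<nu>0 s * p0 (x - s))"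
        by (rule ennreal_leI)
      moreover have "ennreal (\<nu>0 s) * ennreal (s * exp (l * s)) * ennreal (b * t * exp (- (l * x))) = ennreal (\<nu>0 s * (s * exp (l * s)) * (b * t * exp (- (l * x))))"
        using True b t_pos by (simp add: ennreal_mult)
      ultimately show ?thesis using True by simp
    qed (auto simp: \<nu>0_def)
  qed
  also have "\<dots> = ennreal (x * p0 x)" using id by simp
  finally have "b * (t * (\<integral>s. indicator {..r} s * (s * exp (l * s)) \<partial>N)) * exp (- (l * x)) \<le> x * p0 x"
    using x0 by (simp add: ennreal_le_iff)
  then show ?thesis by (simp add: exp_minus field_simps)
qed

lemma p_cont_sub: "A \<subseteq> {0<..} \<Longrightarrow> continuous_on A p"
  using p_cont continuous_on_subset by blast

text \<open>If the bound failed, consider the first point \<open>y\<close> where the tilted density drops to some level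
  \<open>b < a\<close>: the Steutel identity would give \<open>y * b \<ge> b * t * (\<integral>s\<le>r. s * exp (l * s) dN) > y * b\<close>.\<close>

lemma spread:
  assumes x0: "0 < x0" and r: "0 < r" and a: "0 < a"
    and start: "\<And>x. x0 \<le> x \<Longrightarrow> x \<le> x0 + r \<Longrightarrow> a \<le> exp (l * x) * p x"
    and m: "X < t * (\<integral>s. indicator {..r} s * (s * exp (l * s)) \<partial>N)"
    and x: "x0 \<le> x" "x \<le> X"
  shows "a \<le> exp (l * x) * p x"
proof (rule ccontr)
  assume neg: "\<not> a \<le> exp (l * x) * p x"
  define f where "f x = exp (l * x) * p x" for x
  \<comment> \<open>The half keeps \<open>b\<close> positive, so that it can be cancelled at the
    end.\<close>
  define b where "b = max (f x) (a / 2)"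
  have b: "0 < b" "b < a" "f x \<le> b" using a neg by (auto simp: b_def f_def)
  have fc: "continuous_on {0<..} f" unfolding f_def by (intro continuous_intros p_cont)
  have fcI: "continuous_on A f" if "A \<subseteq> {0<..}" for A using fc that continuous_on_subset by blast
  define S where "S = {x0..x} \<inter> f -` {..b}"
  have "closed S" unfolding S_def
    by (intro continuous_closed_preimage fcI) (use x0 in auto)
  moreover have "bounded S" unfolding S_def by (rule bounded_subset[of "{x0..x}"]) auto
  ultimately have "compact S" by (simp add: compact_eq_bounded_closed)
  moreover have "x \<in> S" using x b by (simp add: S_def)
  ultimately obtain y where y: "y \<in> S" "\<And>z. z \<in> S \<Longrightarrow> y \<le> z" using compact_attains_inf[of S] by blast
  have yx: "x0 \<le> y" "y \<le> x" "f y \<le> b" using y by (auto simp: S_def)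
  have before: "b \<le> f z" if "x0 \<le> z" "z < y" for z
  proof (rule ccontr)
    assume "\<not> b \<le> f z"
    then have "z \<in> S" using that yx by (simp add: S_def)
    then show False using y(2) that by fastforce
  qed
  \<comment> \<open>On the starting interval f >= a > b. Hence the window of length r before y lies
    in [x0, y), where f >= b.\<close>
  have y_gt: "x0 + r < y" using start[of y] b yx by (force simp: f_def)
  let ?m = "t * (\<integral>s. indicator {..r} s * (s * exp (l * s)) \<partial>N)"
  have "b * ?m \<le> y * f y"
  proof (rule AE_continuous_ge[where u="x0 + r" and v=y and g="\<lambda>z. z * f z"])
    show "continuous_on {x0 + r..y} (\<lambda>z. z * f z)" by (intro continuous_intros fcI) (use x0 r in auto)
    show "AE z in lborel. z \<in> {x0 + r<..<y} \<longrightarrow> b * ?m \<le> z * f z"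
      using steutel_identity
    proof eventually_elim
      case (elim z)
      show ?case
      proof
        assume z: "z \<in> {x0 + r<..<y}"
        have "b * ?m \<le> exp (l * z) * (z * p0 z)"
          by (rule steutel_lower[OF r _ _ elim])
             (use z x0 r b before in \<open>auto simp: p0_def f_def\<close>)
        then show "b * ?m \<le> z * f z" using z x0 r by (simp add: p0_def f_def mult_ac)
      qed
    qed
  qed (use y_gt in auto)
  also have "y * f y \<le> y * b" using yx x0 by (intro mult_left_mono) auto
  finally have "?m \<le> y" using b by (simp add: mult.commute)
  then show False using m x yx by simp
qed

end

section \<open>Lower bounds near the mean\<close>

context scaled_dens
begin

text \<open>Lengths are in units of the standard deviation S. \<open>\<delta>0\<close>: by the sup
  bound, radius \<open>\<delta>0 * S\<close> about the mean carries mass at most 1/2.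
  \<open>R0\<close>, \<open>c0\<close>: the parts outside and inside the window each contribute
  \<open>\<delta>0 * S / 16\<close> in \<open>left_window\<close>. \<open>\<delta>1\<close>: over
  \<open>\<delta>1 * S\<close> the Lipschitz bound costs half of c0 / S. \<open>\<delta>2\<close>:
  makes \<open>\<delta>2 / \<sigma>\<close> at most \<open>\<delta>1 * S\<close> and 1 / \<sigma>.
  \<open>c2\<close>: at that scale t K / e is at least \<open>c2 * V \<sigma>\<close>.
  \<open>lamL\<close>, \<open>cL\<close>: the extra tilt in units of 1 / S, and what remains after
  the loss it causes.\<close>

definition "\<delta>0 = 1 / (4 * CS)"
definition "R0 = 16 / \<delta>0"
definition "c0 = \<delta>0 / (16 * R0\<^sup>2)"
definition "\<delta>1 = c0 / (2 * CS)"
definition "\<delta>2 = min 1 (\<delta>1 / sqrt CH)"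
definition "c2 = \<delta>2\<^sup>2 / (2 * exp 1 * CH * CK)"
definition "lamL L = (L + 1 / \<delta>1 + 1) / c2"
definition "cL L = c0 / 2 * exp (- (lamL L * (R0 + L)))"

lemma consts_pos: "\<delta>0 > 0" "R0 > 0" "c0 > 0" "\<delta>1 > 0" "\<delta>2 > 0" "c2 > 0" "cL L > 0"
proof -
  have CH: "CH > 0" and CK: "CK > 0" using CH_ge_1 CK_ge_1 by auto
  show d0: "\<delta>0 > 0" using CS_pos by (simp add: \<delta>0_def)
  then show "R0 > 0" by (simp add: R0_def)
  then show c0: "c0 > 0" using d0 by (simp add: c0_def)
  then show d1: "\<delta>1 > 0" using CS_pos by (simp add: \<delta>1_def)
  then show d2: "\<delta>2 > 0" using CH by (simp add: \<delta>2_def)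
  then show "c2 > 0" using CH CK by (simp add: c2_def)
  show "cL L > 0" using c0 by (simp add: cL_def)
qed

end

context sub_scaled
begin

text \<open>Mass cannot concentrate within \<open>\<delta>0 * S\<close> of the mean, so E|x - m| >=
  \<open>\<delta>0 * S / 2\<close>, and half of this comes from the left because the mean is m. If
  the density stayed below c0 / S on the window, Chebyshev outside and smallness inside would make
  the left part at most \<open>\<delta>0 * S / 8\<close>.\<close>

lemma left_window:
  assumes \<sigma>: "\<sigma> > 0" "t * H \<sigma> \<ge> 1"
  defines "S \<equiv> sqrt (V \<sigma>)" and "m \<equiv> t * \<phi>1 \<sigma>"
  shows "\<exists>x1>0. m - R0 * S \<le> x1 \<and> x1 \<le> m \<and> c0 / S \<le> ps \<sigma> x1"
proof (rule ccontr)
  assume neg: "\<not> (\<exists>x1>0. m - R0 * S \<le> x1 \<and> x1 \<le> m \<and> c0 / S \<le> ps \<sigma> x1)"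
  interpret P: prob_space "Qs \<sigma>" using cont_density.M_dist[OF tilted, of \<sigma>] \<sigma> by (simp add: real_distribution_def)
  have S: "S > 0" using V_pos[OF \<sigma>(1)] by (simp add: S_def)
  have SV: "S\<^sup>2 = V \<sigma>" using V_pos[OF \<sigma>(1)] by (simp add: S_def)
  note c = consts_pos
  note mom = Qs_moments[OF \<sigma>(1), folded m_def]
  have sets[simp, measurable_cong]: "sets (Qs \<sigma>) = sets borel" by (simp add: Qs_def)
  have im: "integrable (Qs \<sigma>) (\<lambda>x. x - m)" using mom(1) by simp
  have iA: "integrable (Qs \<sigma>) (\<lambda>x. indicator {a..b} x :: real)" for a b
    by (rule P.integrable_const_bound[where B=1], simp, measurable)
  have A1: "measure (Qs \<sigma>) {m - \<delta>0 * S..m + \<delta>0 * S} \<le> 1/2"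
  proof -
    have "measure (Qs \<sigma>) {m - \<delta>0 * S..m + \<delta>0 * S} \<le> CS / S * (m + \<delta>0 * S - (m - \<delta>0 * S))"
      by (rule measure_Qs_Icc_le) (use \<sigma> tilted_sup[OF \<sigma>] S c CS_pos in \<open>auto simp: S_def\<close>)
    also have "\<dots> = 1/2" using S CS_pos by (simp add: \<delta>0_def field_simps)
    finally show ?thesis .
  qed
  have A2: "\<delta>0 * S / 2 \<le> (\<integral>x. \<bar>x - m\<bar> \<partial>Qs \<sigma>)"
  proof -
    have "\<delta>0 * S / 2 \<le> \<delta>0 * S * (1 - measure (Qs \<sigma>) {m - \<delta>0 * S..m + \<delta>0 * S})"
    proof -
      have "\<delta>0 * S * (1 / 2) \<le> \<delta>0 * S * (1 - measure (Qs \<sigma>) {m - \<delta>0 * S..m + \<delta>0 * S})"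
        using A1 c S by (intro mult_left_mono) auto
      then show ?thesis by simp
    qed
    also have "\<dots> = (\<integral>x. \<delta>0 * S * (1 - indicator {m - \<delta>0 * S..m + \<delta>0 * S} x) \<partial>Qs \<sigma>)"
      using iA[of "m - \<delta>0 * S" "m + \<delta>0 * S"] by (simp add: P.prob_space[simplified])
    also have "\<dots> \<le> (\<integral>x. \<bar>x - m\<bar> \<partial>Qs \<sigma>)"
    proof (rule integral_mono)
      show "integrable (Qs \<sigma>) (\<lambda>x. \<delta>0 * S * (1 - indicator {m - \<delta>0 * S..m + \<delta>0 * S} x))"
        using iA[of "m - \<delta>0 * S" "m + \<delta>0 * S"] by simp
      show "\<delta>0 * S * (1 - indicator {m - \<delta>0 * S..m + \<delta>0 * S} x) \<le> \<bar>x - m\<bar>" for x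
        by (auto simp: indicator_def abs_if)
    qed (use im in auto)
    finally show ?thesis .
  qed
  have imax: "integrable (Qs \<sigma>) (\<lambda>x. max 0 (m - x))"
    by (rule Bochner_Integration.integrable_bound[OF im]) auto
  have A3: "(\<integral>x. \<bar>x - m\<bar> \<partial>Qs \<sigma>) = 2 * (\<integral>x. max 0 (m - x) \<partial>Qs \<sigma>)"
  proof -
    have "(\<integral>x. \<bar>x - m\<bar> \<partial>Qs \<sigma>) = (\<integral>x. 2 * max 0 (m - x) + (x - m) \<partial>Qs \<sigma>)"
      by (rule Bochner_Integration.integral_cong) (auto simp: max_def abs_if)
    also have "\<dots> = 2 * (\<integral>x. max 0 (m - x) \<partial>Qs \<sigma>) + ((\<integral>x. x \<partial>Qs \<sigma>) - m)"
      using imax mom(1) by (simp add: P.prob_space[simplified])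
    finally show ?thesis using mom(2) by simp
  qed
  have A5: "measure (Qs \<sigma>) {m - R0 * S..m} \<le> c0 * R0"
  proof -
    have "measure (Qs \<sigma>) {m - R0 * S..m} \<le> c0 / S * (m - (m - R0 * S))"
    proof (rule measure_Qs_Icc_le)
      fix x assume "x > 0" "m - R0 * S \<le> x" "x \<le> m"
      then show "ps \<sigma> x \<le> c0 / S" using neg by force
    qed (use \<sigma> S c in auto)
    also have "\<dots> = c0 * R0" using S by simp
    finally show ?thesis .
  qed
  \<comment> \<open>Left of the window m - x >= R0 S, so m - x <= (x - m)^2 / (R0 S); inside it m -
    x <= R0 S.\<close>
  have "(\<integral>x. max 0 (m - x) \<partial>Qs \<sigma>) \<le> (\<integral>x. (x - m)\<^sup>2 / (R0 * S) + R0 * S * indicator {m - R0 * S..m} x \<partial>Qs \<sigma>)"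
  proof (rule integral_mono)
    show "integrable (Qs \<sigma>) (\<lambda>x. (x - m)\<^sup>2 / (R0 * S) + R0 * S * indicator {m - R0 * S..m} x)"
      using mom(3) iA by simp
    fix x
    have RS: "R0 * S > 0" using c S by simp
    have q: "0 \<le> (x - m)\<^sup>2 / (R0 * S)" using RS by simp
    show "max 0 (m - x) \<le> (x - m)\<^sup>2 / (R0 * S) + R0 * S * indicator {m - R0 * S..m} x"
    proof (cases "m - R0 * S \<le> x")
      case True
      show ?thesis
      proof (cases "x \<le> m")
        case a: True
        have "m - x \<le> (x - m)\<^sup>2 / (R0 * S) + R0 * S" using q True by linarith
        then show ?thesis using True a by simp
      qed (use q RS in \<open>auto simp: indicator_def\<close>)
    next
      case False
      then have mx: "R0 * S \<le> m - x" by simp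
      have "(m - x) * (R0 * S) \<le> (m - x) * (m - x)" using mx RS by (intro mult_left_mono) auto
      then have "m - x \<le> (m - x) * (m - x) / (R0 * S)" by (simp only: pos_le_divide_eq[OF RS])
      also have "(m - x) * (m - x) = (x - m)\<^sup>2" by (simp add: power2_eq_square algebra_simps)
      finally have "m - x \<le> (x - m)\<^sup>2 / (R0 * S)" .
      then show ?thesis using False q by simp
    qed
  qed (rule imax)
  also have "\<dots> = V \<sigma> / (R0 * S) + R0 * S * measure (Qs \<sigma>) {m - R0 * S..m}"
    using mom(3,4) iA by (simp add: V_def)
  also have "\<dots> \<le> V \<sigma> / (R0 * S) + R0 * S * (c0 * R0)" using A5 c S by (intro add_left_mono mult_left_mono) auto
  also have "V \<sigma> / (R0 * S) = \<delta>0 * S / 16" unfolding SV[symmetric] using S c by (simp add: R0_def power2_eq_square)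
  also have "R0 * S * (c0 * R0) = \<delta>0 * S / 16" using c by (simp add: c0_def power2_eq_square)
  finally have "(\<integral>x. max 0 (m - x) \<partial>Qs \<sigma>) \<le> \<delta>0 * S / 16 + \<delta>0 * S / 16" .
  then have "\<delta>0 * S / 2 \<le> \<delta>0 * S / 4" using A2 A3 by linarith
  moreover have "\<delta>0 * S > 0" using c S by simp
  ultimately show False by linarith
qed

text \<open>The standard deviation in units of 1 / \<sigma> is of order sqrt (t H(\<sigma>)), by the
  comparability of H and \<open>u\<^sup>2 * \<phi>2 u\<close>.\<close>

lemma sqrt_V:
  assumes \<sigma>: "\<sigma> > 0"
  shows "sqrt (V \<sigma>) \<le> sqrt (2 * (t * H \<sigma>)) / \<sigma>" "sqrt (t * H \<sigma>) / (\<sigma> * sqrt CH) \<le> sqrt (V \<sigma>)"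
proof -
  have "V \<sigma> \<le> 2 * (t * H \<sigma>) / \<sigma>\<^sup>2"
    using mult_left_mono[OF H_ge_phi2[OF \<sigma>], of t] t_pos \<sigma> by (simp add: V_def field_simps)
  then have "sqrt (V \<sigma>) \<le> sqrt (2 * (t * H \<sigma>) / \<sigma>\<^sup>2)" by (rule real_sqrt_le_mono)
  then show "sqrt (V \<sigma>) \<le> sqrt (2 * (t * H \<sigma>)) / \<sigma>" using \<sigma> by (simp add: real_sqrt_divide)
  have "t * H \<sigma> / (\<sigma>\<^sup>2 * CH) \<le> V \<sigma>"
    using mult_left_mono[OF H_le_phi2[OF \<sigma>], of t] t_pos \<sigma> CH_ge_1 by (simp add: V_def field_simps)
  then have "sqrt (t * H \<sigma> / (\<sigma>\<^sup>2 * CH)) \<le> sqrt (V \<sigma>)" by (rule real_sqrt_le_mono)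
  then show "sqrt (t * H \<sigma>) / (\<sigma> * sqrt CH) \<le> sqrt (V \<sigma>)" using \<sigma> by (simp add: real_sqrt_divide real_sqrt_mult)
qed

text \<open>\<open>spread\<close> is applied with l = k - \<sigma>, that is, to the tilted density
  with an additional factor exp(k x). Truncating the jumps at r lowers the mean by at most V / r,
  while k raises it by at least c2 V k; with k of order 1 / S the gain exceeds the loss by at least
  (L + 1) S. Since x1 and x are at a distance of order S, exp(k x) changes only by a constant
  factor.\<close>

lemma center_lower:
  assumes \<sigma>: "\<sigma> > 0" "t * H \<sigma> \<ge> 1" and L: "L \<ge> 0"
  defines "S \<equiv> sqrt (V \<sigma>)" and "m \<equiv> t * \<phi>1 \<sigma>"
  assumes x: "m \<le> x" "x \<le> m + L * S"
  shows "cL L / S \<le> ps \<sigma> x"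
proof -
  note c = consts_pos
  have CH: "CH \<ge> 1" and CK: "CK \<ge> 1" by (rule CH_ge_1, rule CK_ge_1)
  have S: "S > 0" using V_pos[OF \<sigma>(1)] by (simp add: S_def)
  have SV: "S * S = V \<sigma>" using V_pos[OF \<sigma>(1)] by (simp add: S_def)
  obtain x1 where x1: "x1 > 0" "m - R0 * S \<le> x1" "x1 \<le> m" "c0 / S \<le> ps \<sigma> x1"
    using left_window[OF \<sigma>] unfolding S_def m_def by blast
  define r where "r = \<delta>1 * S"
  have r: "r > 0" using c S by (simp add: r_def)
  have start: "c0 / (2 * S) \<le> ps \<sigma> y" if "x1 \<le> y" "y \<le> x1 + r" for y
  proof -
    have "\<bar>ps \<sigma> x1 - ps \<sigma> y\<bar> \<le> CS / V \<sigma> * \<bar>x1 - y\<bar>" by (rule tilted_lipschitz[OF \<sigma>]) (use x1 that in auto)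
    also have "\<dots> \<le> CS / V \<sigma> * r" using that CS_pos V_pos[OF \<sigma>(1)] by (intro mult_left_mono) auto
    also have "\<dots> = c0 / (2 * S)" unfolding SV[symmetric] r_def \<delta>1_def using S CS_pos by (simp add: field_simps)
    finally have "ps \<sigma> x1 - c0 / (2 * S) \<le> ps \<sigma> y" by linarith
    moreover have "c0 / S = c0 / (2 * S) + c0 / (2 * S)" by simp
    ultimately show ?thesis using x1(4) by linarith
  qed
  define k where "k = lamL L / S"
  have lamL: "lamL L > 0" using c L by (simp add: lamL_def add_nonneg_pos)
  have k: "k > 0" using lamL S by (simp add: k_def)
  \<comment> \<open>A scale within 1 / \<sigma>, where the tilt \<sigma> costs at most a factor e,
    and within the truncation r, so that K(\<rho>) can measure the gain from k.\<close>
  define \<rho> where "\<rho> = \<delta>2 / \<sigma>"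
  have \<rho>: "\<rho> > 0" using c \<sigma> by (simp add: \<rho>_def)
  have \<rho>r: "\<rho> \<le> r"
  proof -
    have "1 \<le> sqrt (t * H \<sigma>)" using \<sigma> by simp
    then have "1 / (\<sigma> * sqrt CH) \<le> sqrt (t * H \<sigma>) / (\<sigma> * sqrt CH)" using \<sigma> CH by (intro divide_right_mono) auto
    also have "\<dots> \<le> S" using sqrt_V(2)[OF \<sigma>(1)] by (simp add: S_def)
    finally have "\<delta>1 * (1 / (\<sigma> * sqrt CH)) \<le> r" using c unfolding r_def by (intro mult_left_mono) auto
    moreover have "\<rho> \<le> \<delta>1 / sqrt CH / \<sigma>" unfolding \<rho>_def \<delta>2_def using \<sigma> by (intro divide_right_mono) auto
    ultimately show ?thesis by (simp add: mult.commute)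
  qed
  have KV: "c2 * V \<sigma> \<le> t * (exp (-1) * K \<rho>)"
  proof -
    have d2: "\<delta>2 \<le> 1" by (simp add: \<delta>2_def)
    have "\<phi>2 \<sigma> \<le> 2 * CH * (1/\<rho> / \<sigma>)\<^sup>2 * \<phi>2 (1/\<rho>)"
      by (rule phi2_lower) (use \<sigma> c d2 in \<open>auto simp: \<rho>_def field_simps\<close>)
    also have "1/\<rho> / \<sigma> = 1 / \<delta>2" using \<sigma> by (simp add: \<rho>_def)
    also have "2 * CH * (1 / \<delta>2)\<^sup>2 * \<phi>2 (1/\<rho>) \<le> 2 * CH * (1 / \<delta>2)\<^sup>2 * (CK * K \<rho>)"
      using phi2_le_K[OF \<rho>] CH by (intro mult_left_mono) auto
    finally have "c2 * \<phi>2 \<sigma> \<le> c2 * (2 * CH * (1 / \<delta>2)\<^sup>2 * (CK * K \<rho>))" using c by (intro mult_left_mono) auto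
    also have "\<dots> = exp (-1) * K \<rho>" using c(5) CH CK by (simp add: c2_def exp_minus power_divide field_simps)
    finally have "t * (c2 * \<phi>2 \<sigma>) \<le> t * (exp (-1) * K \<rho>)" using t_pos by (intro mult_left_mono) auto
    then show ?thesis by (simp add: V_def mult_ac)
  qed
  define I where "I = (\<integral>s. indicator {..r} s * (s * exp ((k - \<sigma>) * s)) \<partial>N)"
  \<comment> \<open>Pointwise: beyond r, s <= s^2 / r pays for the truncated jumps; up to r, 1 + k s
    <= exp(k s) yields the gain, counted only up to \<rho>.\<close>
  have "\<phi>1 \<sigma> - \<phi>2 \<sigma> / r + k * (exp (-1) * K \<rho>) \<le> I"
  proof -
    have "\<phi>1 \<sigma> - \<phi>2 \<sigma> / r + k * (exp (-1) * K \<rho>)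
       = (\<integral>s. s * exp (- (\<sigma> * s)) - s\<^sup>2 * exp (- (\<sigma> * s)) / r + k * (exp (-1) * (indicator {..\<rho>} s * s\<^sup>2)) \<partial>N)"
      unfolding \<phi>1_def \<phi>2_def K_def
      using integrable_s_exp[OF \<sigma>(1)] integrable_K[OF \<rho>] by simp
    also have "\<dots> \<le> I"
      unfolding I_def
    proof (rule integral_mono_AE)
      show "AE s in N. s * exp (- (\<sigma> * s)) - s\<^sup>2 * exp (- (\<sigma> * s)) / r + k * (exp (-1) * (indicator {..\<rho>} s * s\<^sup>2))
          \<le> indicator {..r} s * (s * exp ((k - \<sigma>) * s))"
        using N_pos
      proof eventually_elim
        case (elim s)
        show ?case
        proof (cases "s \<le> r")
          case False
          have "s * exp (- (\<sigma> * s)) * 1 \<le> s * exp (- (\<sigma> * s)) * (s / r)"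
            using False r elim by (intro mult_left_mono) auto
          then show ?thesis using False \<rho>r by (simp add: power2_eq_square mult_ac)
        next
          case True
          have "1 + k * s \<le> exp (k * s)" by (rule exp_ge_add_one_self)
          then have "s * exp (- (\<sigma> * s)) * (1 + k * s) \<le> s * exp (- (\<sigma> * s)) * exp (k * s)"
            using elim by (intro mult_left_mono) auto
          also have "\<dots> = s * exp ((k - \<sigma>) * s)" by (simp add: algebra_simps flip: exp_add)
          finally have 1: "s * exp (- (\<sigma> * s)) + k * (s\<^sup>2 * exp (- (\<sigma> * s))) \<le> s * exp ((k - \<sigma>) * s)"
            by (simp add: power2_eq_square algebra_simps)
          have 2: "exp (-1) * (indicator {..\<rho>} s * s\<^sup>2) \<le> s\<^sup>2 * exp (- (\<sigma> * s))"
          proof (cases "s \<le> \<rho>")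
            case a: True
            have "\<sigma> * s \<le> \<sigma> * \<rho>" using a \<sigma> by (intro mult_left_mono) auto
            also have "\<dots> \<le> 1" using \<sigma> by (simp add: \<rho>_def \<delta>2_def)
            finally have "exp (-1) \<le> exp (- (\<sigma> * s))" by simp
            then have "exp (-1) * s\<^sup>2 \<le> exp (- (\<sigma> * s)) * s\<^sup>2" by (rule mult_right_mono) simp
            then show ?thesis using a by (simp add: mult.commute)
          qed simp
          have "k * (exp (-1) * (indicator {..\<rho>} s * s\<^sup>2)) \<le> k * (s\<^sup>2 * exp (- (\<sigma> * s)))"
            using 2 k by (intro mult_left_mono) auto
          moreover have "0 \<le> s\<^sup>2 * exp (- (\<sigma> * s)) / r" using r by simp
          ultimately have "s * exp (- (\<sigma> * s)) - s\<^sup>2 * exp (- (\<sigma> * s)) / r + k * (exp (-1) * (indicator {..\<rho>} s * s\<^sup>2)) \<le> s * exp ((k - \<sigma>) * s)"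
            using 1 by linarith
          then show ?thesis using True by simp
        qed
      qed
    qed (use integrable_s_exp[OF \<sigma>(1)] integrable_K[OF \<rho>] integrable_s_exp_trunc[OF r] in auto)
    finally show ?thesis .
  qed
  then have "t * (\<phi>1 \<sigma> - \<phi>2 \<sigma> / r + k * (exp (-1) * K \<rho>)) \<le> t * I" using t_pos by (intro mult_left_mono) auto
  then have "m - V \<sigma> / r + k * (t * (exp (-1) * K \<rho>)) \<le> t * I"
    by (simp add: m_def V_def algebra_simps)
  moreover have "k * (c2 * V \<sigma>) \<le> k * (t * (exp (-1) * K \<rho>))" using KV k by (intro mult_left_mono) auto
  moreover have "V \<sigma> / r = S / \<delta>1" unfolding SV[symmetric] r_def using S by simp
  moreover have "k * (c2 * V \<sigma>) = (L + 1 / \<delta>1 + 1) * S"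
    unfolding SV[symmetric] k_def lamL_def using S c(6) by simp
  ultimately have "m + L * S + S \<le> t * I" by (simp add: algebra_simps)
  then have big: "m + L * S < t * I" using S by simp
  define a where "a = exp (k * x1 - t * \<phi> \<sigma>) * (c0 / (2 * S))"
  have conv: "exp ((k - \<sigma>) * y) * p y = exp (k * y - t * \<phi> \<sigma>) * ps \<sigma> y" for y
  proof -
    have "exp (k * y - t * \<phi> \<sigma>) * exp (t * \<phi> \<sigma> - \<sigma> * y) = exp ((k - \<sigma>) * y)"
      unfolding exp_add[symmetric] by (simp add: algebra_simps)
    then show ?thesis by (simp add: ps_def mult.assoc[symmetric])
  qed
  have "a \<le> exp ((k - \<sigma>) * x) * p x"
  proof (rule spread[OF x1(1) r])
    show "a > 0" using c S by (simp add: a_def)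
    fix y assume y: "x1 \<le> y" "y \<le> x1 + r"
    show "a \<le> exp ((k - \<sigma>) * y) * p y"
      unfolding conv a_def using start[OF y] y k c S by (intro mult_mono) auto
  next
    show "m + L * S < t * (LINT s|N. indicat_real {..r} s * (s * exp ((k - \<sigma>) * s)))" using big by (simp add: I_def)
  qed (use x x1 in auto)
  then have "exp (k * x1 - t * \<phi> \<sigma>) * (c0 / (2 * S)) \<le> exp (k * x - t * \<phi> \<sigma>) * ps \<sigma> x"
    unfolding conv a_def .
  then have "exp (- (k * x - t * \<phi> \<sigma>)) * (exp (k * x1 - t * \<phi> \<sigma>) * (c0 / (2 * S))) \<le> exp (- (k * x - t * \<phi> \<sigma>)) * (exp (k * x - t * \<phi> \<sigma>) * ps \<sigma> x)"
    by (rule mult_left_mono) simp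
  then have low: "exp (k * x1 - k * x) * (c0 / (2 * S)) \<le> ps \<sigma> x"
    unfolding mult.assoc[symmetric] exp_add[symmetric] by simp
  have "k * (x - x1) \<le> k * ((R0 + L) * S)" using x x1 k by (intro mult_left_mono) (auto simp: distrib_right)
  also have "\<dots> = lamL L * (R0 + L)" using S by (simp add: k_def)
  finally have "exp (- (lamL L * (R0 + L))) \<le> exp (k * x1 - k * x)" by (simp add: algebra_simps)
  then have "exp (- (lamL L * (R0 + L))) * (c0 / (2 * S)) \<le> exp (k * x1 - k * x) * (c0 / (2 * S))"
    using c S by (intro mult_right_mono) auto
  also note low
  finally show ?thesis by (simp add: cL_def mult.commute)
qed

end

section \<open>Comparison principles for the right tail\<close>

context sub_density
begin

lemma nn_integral_p0_shift: "(\<integral>\<^sup>+s. ennreal (p0 (z - s)) \<partial>lborel) = 1"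
proof -
  have "(\<integral>\<^sup>+s. ennreal (p0 (z - s)) \<partial>lborel) = (\<integral>\<^sup>+s. ennreal (p0 s) \<partial>lborel)"
    by (subst (2) nn_integral_real_affine[where c="-1" and t=z]) auto
  also have "\<dots> = emeasure Q UNIV" unfolding Q_eq by (subst emeasure_density) auto
  also have "\<dots> = 1" using prob_space.emeasure_space_1[OF prob_Q] sets_eq_imp_space_eq[OF sets_Q] by simp
  finally show ?thesis .
qed

text \<open>Jumps up to r use the bound \<open>F\<close> on exp(l y) p(y); longer ones use s
  \<nu>(s) <= B and the total mass 1 of p.\<close>

lemma steutel_upper:
  assumes r: "r > 0" and F: "F \<ge> 0" and B: "B \<ge> 0" "\<And>s. s > r \<Longrightarrow> s * \<nu> s \<le> B"
    and id: "ennreal (x * p0 x) = (\<integral>\<^sup>+s. ennreal (t * s * \<nu>0 s * p0 (x - s)) \<partial>lborel)"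
    and up: "\<And>y. 0 < y \<Longrightarrow> y < x \<Longrightarrow> exp (l * y) * p y \<le> F"
  shows "exp (l * x) * (x * p0 x) \<le> F * (t * (\<integral>s. indicator {..r} s * (s * exp (l * s)) \<partial>N)) + exp (l * x) * (t * B)"
proof -
  let ?I = "\<integral>s. indicator {..r} s * (s * exp (l * s)) \<partial>N"
  have up': "p0 y \<le> F * exp (- (l * y))" if "y < x" for y
    using up[of y] that F by (cases "y > 0") (auto simp: p0_def exp_minus field_simps)
  have pt: "ennreal (t * s * \<nu>0 s * p0 (x - s)) \<le>
      ennreal (F * t * exp (- (l * x))) * (ennreal (\<nu>0 s) * ennreal (indicator {..r} s * (s * exp (l * s)))) + ennreal (t * B) * ennreal (p0 (x - s))" for s
  proof (cases "0 < s")
    case s: True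
    show ?thesis
    proof (cases "s \<le> r")
      case True
      have "p0 (x - s) \<le> F * exp (- (l * (x - s)))" by (rule up') (use s in simp)
      also have "exp (- (l * (x - s))) = exp (- (l * x)) * exp (l * s)" by (simp add: algebra_simps flip: exp_add)
      finally have "(t * s * \<nu>0 s) * p0 (x - s) \<le> (t * s * \<nu>0 s) * (F * (exp (- (l * x)) * exp (l * s)))"
        using s t_pos by (intro mult_left_mono) auto
      then have "t * s * \<nu>0 s * p0 (x - s) \<le> F * t * exp (- (l * x)) * (\<nu>0 s * (s * exp (l * s)))" by (simp add: mult_ac)
      then have "ennreal (t * s * \<nu>0 s * p0 (x - s)) \<le> ennreal (F * t * exp (- (l * x)) * (\<nu>0 s * (s * exp (l * s))))" by (rule ennreal_leI)
      also have "\<dots> = ennreal (F * t * exp (- (l * x))) * (ennreal (\<nu>0 s) * ennreal (s * exp (l * s)))"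
        using F t_pos s by (simp add: ennreal_mult)
      finally show ?thesis using True by (simp add: add_increasing2)
    next
      case False
      have "t * (s * \<nu> s) \<le> t * B" using B(2)[of s] False t_pos by (intro mult_left_mono) auto
      then have "t * s * \<nu>0 s * p0 (x - s) \<le> t * B * p0 (x - s)" using s by (intro mult_right_mono) (auto simp: \<nu>0_def)
      then have "ennreal (t * s * \<nu>0 s * p0 (x - s)) \<le> ennreal (t * B * p0 (x - s))" by (rule ennreal_leI)
      also have "\<dots> = ennreal (t * B) * ennreal (p0 (x - s))" using t_pos B by (simp add: ennreal_mult)
      finally show ?thesis by (simp add: add_increasing)
    qed
  qed (simp add: \<nu>0_def)
  have "ennreal (x * p0 x) \<le> (\<integral>\<^sup>+s. ennreal (F * t * exp (- (l * x))) * (ennreal (\<nu>0 s) * ennreal (indicator {..r} s * (s * exp (l * s)))) + ennreal (t * B) * ennreal (p0 (x - s)) \<partial>lborel)"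
    unfolding id by (rule nn_integral_mono) (rule pt)
  also have "\<dots> = ennreal (F * t * exp (- (l * x))) * (\<integral>\<^sup>+s. ennreal (\<nu>0 s) * ennreal (indicator {..r} s * (s * exp (l * s))) \<partial>lborel) + ennreal (t * B) * (\<integral>\<^sup>+s. ennreal (p0 (x - s)) \<partial>lborel)"
    by (subst nn_integral_add; (subst nn_integral_cmult)?; (subst nn_integral_cmult)?; measurable)
  also have "(\<integral>\<^sup>+s. ennreal (\<nu>0 s) * ennreal (indicator {..r} s * (s * exp (l * s))) \<partial>lborel) = (\<integral>\<^sup>+s. ennreal (indicator {..r} s * (s * exp (l * s))) \<partial>N)"
    unfolding N_def by (rule nn_integral_density[symmetric]) measurable
  also have "\<dots> = ennreal ?I"
    by (rule nn_integral_eq_integral[OF integrable_s_exp_trunc[OF r]]) (use N_pos in \<open>auto elim!: eventually_mono simp: indicator_def\<close>)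
  also have "ennreal (F * t * exp (- (l * x))) * ennreal ?I + ennreal (t * B) * (\<integral>\<^sup>+s. ennreal (p0 (x - s)) \<partial>lborel)
      = ennreal (F * t * exp (- (l * x)) * ?I + t * B)"
    unfolding nn_integral_p0_shift using F t_pos B(1) s_exp_trunc_nonneg[of r l]
    by (simp add: ennreal_mult[symmetric] ennreal_plus[symmetric] del: ennreal_plus)
  finally have le: "ennreal (x * p0 x) \<le> ennreal (F * t * exp (- (l * x)) * ?I + t * B)" .
  have "0 \<le> F * t * exp (- (l * x)) * ?I + t * B"
    using F t_pos B(1) s_exp_trunc_nonneg[of r l] by simp
  from iffD1[OF ennreal_le_iff[OF this] le]
  have "x * p0 x \<le> F * t * exp (- (l * x)) * ?I + t * B" .
  then have "exp (l * x) * (x * p0 x) \<le> exp (l * x) * (F * t * exp (- (l * x)) * ?I + t * B)" by (intro mult_left_mono) auto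
  also have "\<dots> = (exp (l * x) * exp (- (l * x))) * (F * (t * ?I)) + exp (l * x) * (t * B)" by (simp add: algebra_simps)
  finally show ?thesis by (simp flip: exp_add)
qed

text \<open>At a point \<open>y \<ge> m + d\<close> where the tilted density is maximal with value \<open>F\<close>, the Steutel identity
  gives \<open>y * F \<le> m * F + exp (l * x) * t * B\<close>, so that \<open>F \<le> exp (l * x) * t * B / d\<close>.\<close>

lemma max_principle:
  assumes r: "r > 0" and l: "l \<ge> 0" and d: "d > 0" and B: "B \<ge> 0" "\<And>s. s > r \<Longrightarrow> s * \<nu> s \<le> B"
    and P: "P \<ge> 0" "\<And>x. x > 0 \<Longrightarrow> p x \<le> P" and x: "x > 0"
  defines "m \<equiv> t * (\<integral>s. indicator {..r} s * (s * exp (l * s)) \<partial>N)"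
  shows "p x \<le> exp (- (l * (x - m - d))) * P + t * B / d"
proof (rule ccontr)
  assume neg: "\<not> ?thesis"
  have m0: "m \<ge> 0" using s_exp_trunc_nonneg t_pos by (simp add: m_def)
  define f where "f x = exp (l * x) * p x" for x
  \<comment> \<open>Up to m + d the crude bound \<open>P\<close> is used; it is the source of the
    exponential term.\<close>
  have low: "f y \<le> exp (l * (m + d)) * P" if "0 < y" "y \<le> m + d" for y
    unfolding f_def using that l P p_nonneg[of y] by (intro mult_mono) (auto intro: mult_left_mono)
  have fx: "f x > exp (l * (m + d)) * P + exp (l * x) * (t * B / d)"
  proof -
    have "exp (l * x) * (exp (- (l * (x - m - d))) * P + t * B / d) < exp (l * x) * p x" using neg by simp
    moreover have "exp (l * x) * exp (- (l * (x - m - d))) = exp (l * (m + d))" by (simp add: algebra_simps flip: exp_add)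
    ultimately show ?thesis unfolding f_def by (simp add: distrib_left mult.assoc[symmetric])
  qed
  have Bd0: "0 \<le> exp (l * x) * (t * B / d)" "0 \<le> exp (l * (m + d)) * P" using t_pos B d P by auto
  have mdx: "m + d < x" using low[of x] fx x Bd0 by linarith
  have fcI: "continuous_on A f" if "A \<subseteq> {0<..}" for A
    unfolding f_def by (intro continuous_intros p_cont_sub that)
  have sub: "{m + d..x} \<subseteq> {0<..}" using m0 d by auto
  obtain y where y: "y \<in> {m + d..x}" "\<And>z. z \<in> {m + d..x} \<Longrightarrow> f z \<le> f y"
    using continuous_attains_sup[of "{m + d..x}" f] fcI[OF sub] mdx by auto
  have fy: "f x \<le> f y" using y(2)[of x] mdx by simp
  have F0: "f y \<ge> 0" using fy fx Bd0 by linarith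
  \<comment> \<open>The maximum over [m + d, x] also bounds f on (0, m + d], because f x already
    exceeds the crude bound there.\<close>
  have F: "f z \<le> f y" if "0 < z" "z \<le> x" for z
    using low[of z] y(2)[of z] that fy fx Bd0 by (cases "z \<le> m + d") auto
  have "y * f y \<le> f y * m + exp (l * x) * (t * B)"
  proof -
    have "0 \<le> f y * m + exp (l * x) * (t * B) - y * f y"
    proof (rule AE_continuous_ge[where u="m + d" and v=x and g="\<lambda>z. f y * m + exp (l * x) * (t * B) - z * f z"])
      show "continuous_on {m + d..x} (\<lambda>z. f y * m + exp (l * x) * (t * B) - z * f z)"
        by (intro continuous_intros fcI sub)
      show "AE z in lborel. z \<in> {m + d<..<x} \<longrightarrow> 0 \<le> f y * m + exp (l * x) * (t * B) - z * f z"
        using steutel_identity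
      proof eventually_elim
        case (elim z)
        show ?case
        proof
          assume z: "z \<in> {m + d<..<x}"
          have z0: "z > 0" using z m0 d by simp
          have "exp (l * z) * (z * p0 z) \<le> f y * (t * (\<integral>s. indicator {..r} s * (s * exp (l * s)) \<partial>N)) + exp (l * z) * (t * B)"
            by (rule steutel_upper[OF r F0 B elim]) (use z F in \<open>auto simp: f_def\<close>)
          moreover have "exp (l * z) * (t * B) \<le> exp (l * x) * (t * B)" using z l t_pos B by (intro mult_right_mono) (auto intro: mult_left_mono)
          ultimately show "0 \<le> f y * m + exp (l * x) * (t * B) - z * f z" using z0 by (simp add: m_def f_def p0_def mult_ac)
        qed
      qed
    qed (use y mdx in auto)
    then show ?thesis by simp
  qed
  then have "(y - m) * f y \<le> exp (l * x) * (t * B)" by (simp add: algebra_simps)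
  moreover have "d * f y \<le> (y - m) * f y" using y F0 by (intro mult_right_mono) auto
  ultimately have "d * f y \<le> exp (l * x) * (t * B)" by linarith
  then have "f y \<le> exp (l * x) * (t * B / d)" using d by (simp add: field_simps)
  then show False using fy fx Bd0 by linarith
qed

text \<open>Two sets of jumps are kept, disjoint since r < u: short ones from [x - r, x), and a
  single jump in [u, v] starting from [x - v, x - u], where p is at least \<open>b'\<close>.\<close>

lemma steutel_lower_jump:
  assumes r: "r > 0" and u: "r < u" "u \<le> v" and b: "b \<ge> 0" and b': "b' \<ge> 0" and k: "k \<ge> 0"
    and id: "ennreal (x * p0 x) = (\<integral>\<^sup>+s. ennreal (t * s * \<nu>0 s * p0 (x - s)) \<partial>lborel)"
    and low: "\<And>y. y \<ge> x - r \<Longrightarrow> y < x \<Longrightarrow> b \<le> p0 y"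
    and low': "\<And>y. y \<ge> x - v \<Longrightarrow> y \<le> x - u \<Longrightarrow> b' \<le> p0 y"
    and kk: "\<And>s. u \<le> s \<Longrightarrow> s \<le> v \<Longrightarrow> k \<le> s * \<nu> s"
    and x0: "x > 0"
  shows "b * (t * (\<integral>s. indicator {..r} s * s \<partial>N)) + t * k * b' * (v - u) \<le> x * p0 x"
proof -
  have int: "integrable N (\<lambda>s. indicator {..r} s * s)" using integrable_s_exp_trunc[OF r, of 0] by simp
  let ?I = "\<integral>s. indicator {..r} s * s \<partial>N"
  have I0: "?I \<ge> 0" using s_exp_trunc_nonneg[of r 0] by simp
  have "ennreal (b * (t * ?I) + t * k * b' * (v - u)) = ennreal (b * t) * ennreal ?I + ennreal (t * k * b') * ennreal (v - u)"
    using b b' k t_pos I0 u by (simp add: ennreal_mult[symmetric] ennreal_plus[symmetric] mult.assoc del: ennreal_plus)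
  also have "ennreal ?I = (\<integral>\<^sup>+s. ennreal (indicator {..r} s * s) \<partial>N)"
    by (rule nn_integral_eq_integral[symmetric, OF int]) (use N_pos in \<open>auto elim!: eventually_mono simp: indicator_def\<close>)
  also have "\<dots> = (\<integral>\<^sup>+s. ennreal (\<nu>0 s) * ennreal (indicator {..r} s * s) \<partial>lborel)"
    unfolding N_def by (rule nn_integral_density) measurable
  also have "ennreal (v - u) = (\<integral>\<^sup>+s. indicator {u..v} s \<partial>lborel)" using u by simp
  also have "ennreal (b * t) * (\<integral>\<^sup>+s. ennreal (\<nu>0 s) * ennreal (indicator {..r} s * s) \<partial>lborel) + ennreal (t * k * b') * (\<integral>\<^sup>+s. indicator {u..v} s \<partial>lborel)
     = (\<integral>\<^sup>+s. ennreal (b * t) * (ennreal (\<nu>0 s) * ennreal (indicator {..r} s * s)) + ennreal (t * k * b') * indicator {u..v} s \<partial>lborel)"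
    by (subst nn_integral_add; (subst nn_integral_cmult)?; (subst nn_integral_cmult)?; measurable)
  also have "\<dots> \<le> (\<integral>\<^sup>+s. ennreal (t * s * \<nu>0 s * p0 (x - s)) \<partial>lborel)"
  proof (rule nn_integral_mono)
    fix s
    show "ennreal (b * t) * (ennreal (\<nu>0 s) * ennreal (indicator {..r} s * s)) + ennreal (t * k * b') * indicator {u..v} s
      \<le> ennreal (t * s * \<nu>0 s * p0 (x - s))"
    proof (cases "0 < s \<and> s \<le> r")
      case True
      have "(t * s * \<nu>0 s) * b \<le> (t * s * \<nu>0 s) * p0 (x - s)"
        using low[of "x - s"] True t_pos by (intro mult_left_mono) auto
      then have "ennreal (b * t * (\<nu>0 s * s)) \<le> ennreal (t * s * \<nu>0 s * p0 (x - s))" by (intro ennreal_leI) (simp add: mult_ac)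
      moreover have "ennreal (b * t) * (ennreal (\<nu>0 s) * ennreal s) = ennreal (b * t * (\<nu>0 s * s))"
        using True b t_pos by (simp add: ennreal_mult)
      ultimately show ?thesis using True u by simp
    next
      case False
      show ?thesis
      proof (cases "u \<le> s \<and> s \<le> v")
        case a: True
        then have s: "s > 0" using u r by simp
        have "t * (k * b') \<le> t * ((s * \<nu> s) * p0 (x - s))"
          using low'[of "x - s"] kk[of s] a t_pos k b' nu_nonneg[OF s] s by (intro mult_left_mono mult_mono) auto
        then have "ennreal (t * k * b') \<le> ennreal (t * s * \<nu>0 s * p0 (x - s))" using s by (intro ennreal_leI) (simp add: \<nu>0_def mult_ac)
        then show ?thesis using a u False s by simp
      next
        case b: False
        then show ?thesis using False by (auto simp: indicator_def \<nu>0_def)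
      qed
    qed
  qed
  also have "\<dots> = ennreal (x * p0 x)" using id by simp
  finally show ?thesis using x0 by (simp add: ennreal_le_iff)
qed

end

context scaled_dens
begin

text \<open>In \<open>cB\<close>, exp(-1) is exp(-t H(1/h)), \<open>sqrt CH\<close> converts
  multiples of h into multiples of the standard deviation, and the 2 comes from sqrt V <= 2 h.
  \<open>C1\<close> bounds t \<theta> \<nu>(\<theta>) wherever t w(\<theta>) <= 2e.
  \<open>cJ\<close> takes the worse of the two cases in \<open>jump_lower\<close>.\<close>

definition "cB L = exp (- 1) * cL (L * sqrt CH) / 2"
definition "C1 = 2 * exp 1 * a\<^sub>2 * 2 powr (1 + \<alpha>\<^sub>2)"
definition "cJ = min (cB 2 * a\<^sub>1 / C1) (cB 2 * a\<^sub>1 / 10)"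

lemma consts_pos2: "cB L > 0" "C1 > 0" "cJ > 0"
proof -
  show b: "cB L > 0" for L using consts_pos(7) by (simp add: cB_def)
  show c: "C1 > 0" using a2 by (simp add: C1_def)
  show "cJ > 0" using b[of 2] c a1 by (simp add: cJ_def)
qed

lemma t_nu_le:
  assumes t: "t > 0" and \<theta>: "\<theta> > 0" and w: "t * w \<theta> \<le> 2 * exp 1"
  shows "t * (\<theta> * \<nu> \<theta>) \<le> C1"
proof -
  have "t * (\<theta> * \<nu> \<theta> / (a\<^sub>2 * 2 powr (1 + \<alpha>\<^sub>2))) \<le> t * w \<theta>" using w_ge[OF \<theta>] t by (intro mult_left_mono) auto
  also note w
  finally show ?thesis using a2 by (simp add: C1_def field_simps)
qed

lemma t_w_h: assumes t: "t > 0" shows "t * w (h t) \<le> 2 * exp 1"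
proof -
  note ht = h[OF t]
  have "t * w (h t) \<le> t * (2 * exp 1 * H (1 / h t))" using w_le_H[of "h t"] ht t by (intro mult_left_mono) auto
  also have "\<dots> = 2 * exp 1 * (t * H (1 / h t))" by simp
  finally show ?thesis unfolding ht by simp
qed

lemma t_w_mono: assumes t: "t > 0" and \<theta>: "w_inv \<nu> (2 * exp 1 / t) \<le> \<theta>" shows "t * w \<theta> \<le> 2 * exp 1"
proof -
  note wi = w_inv[OF t]
  have "w \<theta> \<le> w (w_inv \<nu> (2 * exp 1 / t))"
    using w_strict[of "w_inv \<nu> (2 * exp 1 / t)" \<theta>] wi \<theta> by (cases "w_inv \<nu> (2 * exp 1 / t) = \<theta>") auto
  then show ?thesis unfolding wi using t by (simp add: field_simps)
qed

end

context sub_scaled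
begin

abbreviation "b \<equiv> \<phi>1 (1 / h t)"

lemma b_pos: "b > 0" using phi1_pos h[OF t_pos] by simp

text \<open>\<open>center_lower\<close> at \<sigma> = 1/h, the tilt with mean t b(t). At t b(t) + y
  the tilting factor is exp(1 - y/h) <= e.\<close>

lemma base_lower:
  assumes y: "0 \<le> y" "y \<le> L * h t"
  shows "cB L / h t \<le> p (t * b + y)"
proof -
  note ht = h[OF t_pos]
  let ?s = "1 / h t"
  have s: "?s > 0" "t * H ?s \<ge> 1" using ht by auto
  have sV: "sqrt (V ?s) \<le> sqrt 2 * h t" "h t / sqrt CH \<le> sqrt (V ?s)"
    using sqrt_V[OF s(1)] unfolding ht(2) by (auto simp: field_simps)
  have sV': "sqrt (V ?s) \<le> 2 * h t"
  proof -
    have "sqrt 2 \<le> (2::real)" by (rule real_le_lsqrt) auto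
    then have "sqrt 2 * h t \<le> 2 * h t" using ht by (intro mult_right_mono) auto
    then show ?thesis using sV(1) by linarith
  qed
  have S: "sqrt (V ?s) > 0" using V_pos s by simp
  have L: "L \<ge> 0" using y ht by (metis mult_neg_pos not_le order_trans)
  have CH: "CH > 0" using CH_ge_1 by simp
  have "y \<le> L * sqrt CH * sqrt (V ?s)"
  proof -
    have "L * sqrt CH * (h t / sqrt CH) \<le> L * sqrt CH * sqrt (V ?s)" using sV(2) L CH by (intro mult_left_mono) auto
    then show ?thesis using y CH by simp
  qed
  then have "cL (L * sqrt CH) / sqrt (V ?s) \<le> ps ?s (t * b + y)"
    by (intro center_lower[OF s]) (use L CH y in auto)
  moreover have "cL (L * sqrt CH) / (2 * h t) \<le> cL (L * sqrt CH) / sqrt (V ?s)"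
    using sV' S consts_pos(7) ht(1) by (intro divide_left_mono mult_pos_pos) (auto intro: less_imp_le)
  ultimately have q: "cL (L * sqrt CH) / (2 * h t) \<le> ps ?s (t * b + y)" by linarith
  have H1: "\<phi> ?s - ?s * b = H ?s" using H_eq[OF s(1)] by simp
  have "t * \<phi> ?s - ?s * (t * b + y) = t * (\<phi> ?s - ?s * b) - y / h t" by (simp add: algebra_simps)
  also have "\<dots> = 1 - y / h t" unfolding H1 ht(2) ..
  finally have e: "ps ?s (t * b + y) = exp (1 - y / h t) * p (t * b + y)" by (simp add: ps_def)
  have "ps ?s (t * b + y) \<le> exp 1 * p (t * b + y)"
    unfolding e
  proof (rule mult_right_mono)
    have "0 < t * b + y" using y b_pos t_pos by (intro add_pos_nonneg mult_pos_pos) auto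
    then show "0 \<le> p (t * b + y)" by (rule p_nonneg)
  qed (use y ht in simp)
  then have "cL (L * sqrt CH) / (2 * h t) \<le> exp 1 * p (t * b + y)" using q by linarith
  then have "exp (-1) * (cL (L * sqrt CH) / (2 * h t)) \<le> exp (-1) * (exp 1 * p (t * b + y))" by (intro mult_left_mono) auto
  then show ?thesis by (simp add: cB_def mult.assoc[symmetric] exp_add[symmetric] mult_ac)
qed

text \<open>s exp(-s/h) is at most s and at most h, so truncation at \<theta> in place of damping
  loses at most h for each jump above \<theta>, in total h t w(\<theta>).\<close>

lemma b_diff_le:
  assumes \<theta>: "0 < \<theta>" and w: "t * w \<theta> \<le> 2 * exp 1"
  shows "t * b - t * (\<integral>s. indicator {..\<theta>} s * s \<partial>N) \<le> 2 * exp 1 * h t"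
proof -
  note ht = h[OF t_pos]
  have i: "integrable N (\<lambda>s. indicator {..\<theta>} s * s)" using integrable_s_exp_trunc[OF \<theta>, of 0] by simp
  have ib: "integrable N (\<lambda>s. s * exp (- (1 / h t * s)))" using integrable_s_exp(1)[of "1 / h t"] ht by simp
  have "b - (\<integral>s. indicator {..\<theta>} s * s \<partial>N) = (\<integral>s. s * exp (- (1 / h t * s)) - indicator {..\<theta>} s * s \<partial>N)"
    unfolding \<phi>1_def using i ib by simp
  also have "\<dots> \<le> (\<integral>s. h t * indicator {\<theta><..} s \<partial>N)"
  proof (rule integral_mono_AE)
    show "AE s in N. s * exp (- (1 / h t * s)) - indicator {..\<theta>} s * s \<le> h t * indicator {\<theta><..} s"
      using N_pos
    proof eventually_elim
      case (elim s)
      have "s * exp (- (1 / h t * s)) \<le> h t" using s_exp_bound(1)[of "1 / h t" s] elim ht by simp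
      moreover have "s * exp (- (1 / h t * s)) \<le> s * 1" using elim ht by (intro mult_left_mono) auto
      ultimately show ?case by (auto simp: indicator_def)
    qed
  qed (use i ib integrable_w[OF \<theta>] in auto)
  also have "\<dots> = h t * w \<theta>" by (simp add: w_def)
  finally have "t * (b - (\<integral>s. indicator {..\<theta>} s * s \<partial>N)) \<le> t * (h t * w \<theta>)" using t_pos by (intro mult_left_mono) auto
  also have "\<dots> = (t * w \<theta>) * h t" by simp
  also have "\<dots> \<le> (2 * exp 1) * h t" using w ht by (intro mult_right_mono) auto
  finally show ?thesis by (simp add: right_diff_distrib)
qed

lemma exp_1_le: "exp 1 \<le> (3::real)"
  using exp_le by simp

text \<open>Let p be minimal on [t b, t b + Y] at x = t b + y. Short jumps into x start where the
  density is at least p(x), and one jump of size about y starts in [t b, t b + h], where the density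
  is at least of order 1/h. The short jumps return p(x) times their truncated mean, which by
  \<open>b_diff_le\<close> falls short of x by at most a multiple of y. Cancelling y leaves the jump
  term.\<close>

lemma jump_lower:
  assumes Y: "Y \<ge> h t"
  shows "cJ * (t * \<nu> Y) \<le> p (t * b + Y)"
proof -
  note ht = h[OF t_pos]
  have c: "cB 2 > 0" using consts_pos2 by simp
  have nuY: "\<nu> Y > 0" using nu_pos Y ht by simp
  \<comment> \<open>Settles a minimiser within 2 h of t b(t): there \<open>base_lower\<close> gives
    order 1/h, and almost monotonicity makes the jump term no larger.\<close>
  have small: "cJ * (t * \<nu> Y) \<le> cB 2 / h t"
  proof -
    have "t * (h t * \<nu> (h t)) \<le> C1" by (rule t_nu_le[OF t_pos ht(1) t_w_h[OF t_pos]])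
    moreover have "a\<^sub>1 * \<nu> Y \<le> \<nu> (h t)" by (rule nu_antimono[OF ht(1) Y])
    then have "t * (h t * (a\<^sub>1 * \<nu> Y)) \<le> t * (h t * \<nu> (h t))" using t_pos ht by (intro mult_left_mono) auto
    ultimately have *: "t * (h t * (a\<^sub>1 * \<nu> Y)) \<le> C1" by linarith
    have "cJ * (t * \<nu> Y) * h t \<le> cB 2 * a\<^sub>1 / C1 * (t * \<nu> Y) * h t"
      using t_pos nuY ht by (intro mult_right_mono) (auto simp: cJ_def)
    also have "\<dots> = cB 2 / C1 * (t * (h t * (a\<^sub>1 * \<nu> Y)))" by simp
    also have "\<dots> \<le> cB 2 / C1 * C1" using * c consts_pos2 by (intro mult_left_mono) (auto intro: less_imp_le)
    also have "\<dots> = cB 2" using consts_pos2(2) by simp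
    finally show ?thesis using ht by (simp add: pos_le_divide_eq)
  qed
  have tb: "t * b > 0" using t_pos b_pos by simp
  have sub: "{t * b..t * b + Y} \<subseteq> {0<..}" using tb by auto
  obtain x where x: "x \<in> {t * b..t * b + Y}" "\<And>z. z \<in> {t * b..t * b + Y} \<Longrightarrow> p x \<le> p z"
    using continuous_attains_inf[of "{t * b..t * b + Y}" p] p_cont_sub[OF sub] Y ht by auto
  define y where "y = x - t * b"
  have y: "0 \<le> y" "y \<le> Y" using x by (auto simp: y_def)
  have px: "p x \<ge> 0" using p_nonneg[of x] x tb by simp
  have "cJ * (t * \<nu> Y) \<le> p x"
  proof (cases "y \<le> 2 * h t")
    case True
    then show ?thesis using base_lower[of y 2] y small by (simp add: y_def)
  next
    case False
    then have y2: "2 * h t < y" by simp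
    let ?I = "\<integral>s. indicator {..h t} s * s \<partial>N"
    have "0 \<le> x * p x - (p x * (t * ?I) + t * ((x - t * b) / 2 * (a\<^sub>1 * \<nu> Y)) * cB 2)"
    proof (rule AE_continuous_ge[where u="t * b + 2 * h t" and v=x and
          g="\<lambda>z. z * p z - (p x * (t * ?I) + t * ((z - t * b) / 2 * (a\<^sub>1 * \<nu> Y)) * cB 2)"])
      show "continuous_on {t * b + 2 * h t..x} (\<lambda>z. z * p z - (p x * (t * ?I) + t * ((z - t * b) / 2 * (a\<^sub>1 * \<nu> Y)) * cB 2))"
        by (intro continuous_intros p_cont_sub) (use tb ht in auto)
      show "AE z in lborel. z \<in> {t * b + 2 * h t<..<x} \<longrightarrow> 0 \<le> z * p z - (p x * (t * ?I) + t * ((z - t * b) / 2 * (a\<^sub>1 * \<nu> Y)) * cB 2)"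
        using steutel_identity
      proof eventually_elim
        case (elim z)
        show ?case
        proof
          assume z: "z \<in> {t * b + 2 * h t<..<x}"
          define u where "u = z - t * b"
          have u: "2 * h t < u" "u < y" using z by (auto simp: u_def y_def)
          have z0: "z > 0" using z tb ht by simp
          \<comment> \<open>The jump lengths [u - h, u] are those that start in [t b, t b + h]; the
            length h of this range cancels the 1/h of the density.\<close>
          have "p x * (t * ?I) + t * (u / 2 * (a\<^sub>1 * \<nu> Y)) * (cB 2 / h t) * (u - (u - h t)) \<le> z * p0 z"
          proof (rule steutel_lower_jump[OF ht(1) _ _ px _ _ elim])
            show "p x \<le> p0 w" if "z - h t \<le> w" "w < z" for w
              using x(2)[of w] that z tb ht x(1) by (simp add: p0_def)
            show "cB 2 / h t \<le> p0 w" if "z - u \<le> w" "w \<le> z - (u - h t)" for w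
            proof -
              have "cB 2 / h t \<le> p (t * b + (w - t * b))" by (rule base_lower) (use that ht in \<open>auto simp: u_def\<close>)
              moreover have "w > 0" using that tb by (simp add: u_def)
              ultimately show ?thesis by (simp add: p0_def)
            qed
            show "u / 2 * (a\<^sub>1 * \<nu> Y) \<le> s * \<nu> s" if s: "u - h t \<le> s" "s \<le> u" for s
            proof (rule mult_mono)
              show "u / 2 \<le> s" using u s by linarith
              show "a\<^sub>1 * \<nu> Y \<le> \<nu> s" by (rule nu_antimono) (use u s y ht in auto)
            qed (use u ht a1 nuY s in auto)
          qed (use u ht c z0 a1 nuY in \<open>auto intro!: mult_nonneg_nonneg\<close>)
          then have "p x * (t * ?I) + t * (u / 2 * (a\<^sub>1 * \<nu> Y)) * cB 2 \<le> z * p z" using ht z0 by (simp add: p0_def)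
          then show "0 \<le> z * p z - (p x * (t * ?I) + t * ((z - t * b) / 2 * (a\<^sub>1 * \<nu> Y)) * cB 2)" by (simp add: u_def)
        qed
      qed
    qed (use y2 in \<open>auto simp: y_def\<close>)
    then have "p x * (t * ?I) + t * (y / 2 * (a\<^sub>1 * \<nu> Y)) * cB 2 \<le> (y + t * b) * p x" by (simp add: y_def)
    then have "t * (y / 2 * (a\<^sub>1 * \<nu> Y)) * cB 2 \<le> (y + (t * b - t * ?I)) * p x" by (simp add: algebra_simps)
    \<comment> \<open>y > 2 h gives 2 e h <= 6 h <= 3 y.\<close>
    also have "\<dots> \<le> (5 * y) * p x"
    proof (rule mult_right_mono[OF _ px])
      have "2 * exp 1 * h t \<le> 2 * 3 * h t" using exp_1_le ht by (intro mult_right_mono) auto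
      then show "y + (t * b - t * ?I) \<le> 5 * y" using b_diff_le[OF ht(1) t_w_h[OF t_pos]] y2 ht(1) by linarith
    qed
    finally have "y * (t * (a\<^sub>1 * \<nu> Y) * cB 2) \<le> y * (10 * p x)" by (simp add: mult_ac)
    then have "t * (a\<^sub>1 * \<nu> Y) * cB 2 \<le> 10 * p x" using y2 ht by simp
    then have "cB 2 * a\<^sub>1 / 10 * (t * \<nu> Y) \<le> p x" by (simp add: mult_ac)
    moreover have "cJ * (t * \<nu> Y) \<le> cB 2 * a\<^sub>1 / 10 * (t * \<nu> Y)"
      using t_pos nuY by (intro mult_right_mono) (simp_all only: cJ_def min.cobounded2, simp)
    ultimately show ?thesis by linarith
  qed
  also have "p x \<le> p (t * b + Y)" using x(2)[of "t * b + Y"] Y ht by simp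
  finally show ?thesis .
qed

text \<open>Here \<open>\<theta> = \<theta>(t, y / (8 e\<^sup>2))\<close>; the tilt \<open>c\<^sub>4 / \<theta>\<close> moves the truncated mean beyond \<open>t b + y\<close>.\<close>

lemma middle_lower:
  assumes \<theta>: "w_inv \<nu> (2 * exp 1 / t) \<le> \<theta>" "\<theta> \<le> h t" and y: "t * \<theta> * H (1 / \<theta>) = y / (8 * exp 2)" "8 * exp 2 * h t \<le> y"
  shows "cB 1 / h t * exp (- (16 * exp 2 * CK * y / \<theta>)) \<le> p (t * b + y)"
proof -
  note ht = h[OF t_pos]
  note wi = w_inv[OF t_pos]
  have \<theta>0: "\<theta> > 0" using \<theta> wi by linarith
  have y0: "y > 0" using y ht by (meson exp_gt_zero less_le_trans mult_pos_pos zero_less_numeral)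
  have tb: "t * b > 0" using t_pos b_pos by simp
  \<comment> \<open>The level equation for \<theta> and \<open>H_le_K\<close> give t l K(\<theta>)
    >= 2 y: one y is the distance to cover, the other pays for the loss 2 e h of truncating.\<close>
  define l where "l = 16 * exp 2 * CK / \<theta>"
  have CK: "CK > 0" using CK_ge_1 by simp
  have l: "l > 0" using CK \<theta>0 by (simp add: l_def)
  let ?J = "\<integral>s. indicator {..\<theta>} s * s \<partial>N"
  let ?I = "\<integral>s. indicator {..\<theta>} s * (s * exp (l * s)) \<partial>N"
  have i0: "integrable N (\<lambda>s. indicator {..\<theta>} s * s)" using integrable_s_exp_trunc[OF \<theta>0, of 0] by simp
  have "?J + l * K \<theta> = (\<integral>s. indicator {..\<theta>} s * s + l * (indicator {..\<theta>} s * s\<^sup>2) \<partial>N)"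
    unfolding K_def using i0 integrable_K[OF \<theta>0] by simp
  also have "\<dots> \<le> ?I"
  proof (rule integral_mono_AE)
    show "AE s in N. indicator {..\<theta>} s * s + l * (indicator {..\<theta>} s * s\<^sup>2) \<le> indicator {..\<theta>} s * (s * exp (l * s))"
      using N_pos
    proof eventually_elim
      case (elim s)
      have "s * (1 + l * s) \<le> s * exp (l * s)" using elim by (intro mult_left_mono exp_ge_add_one_self) auto
      then show ?case by (auto simp: indicator_def power2_eq_square algebra_simps)
    qed
  qed (use i0 integrable_K[OF \<theta>0] integrable_s_exp_trunc[OF \<theta>0] in auto)
  finally have "t * (?J + l * K \<theta>) \<le> t * ?I" using t_pos by (intro mult_left_mono) auto
  then have 1: "t * ?J + t * (l * K \<theta>) \<le> t * ?I" by (simp add: distrib_left)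
  have 2: "t * b - t * ?J \<le> 2 * exp 1 * h t" by (rule b_diff_le[OF \<theta>0 t_w_mono[OF t_pos \<theta>(1)]])
  have 3: "2 * y \<le> t * (l * K \<theta>)"
  proof -
    have "t * \<theta> * H (1 / \<theta>) \<le> t * \<theta> * (CK * K \<theta> / \<theta>\<^sup>2)" using H_le_K[OF \<theta>0] t_pos \<theta>0 by (intro mult_left_mono) auto
    then have "y / (8 * exp 2) \<le> CK * t * K \<theta> / \<theta>" unfolding y(1) using \<theta>0 by (simp add: power2_eq_square mult_ac)
    then have "16 * exp 2 * (y / (8 * exp 2)) \<le> 16 * exp 2 * (CK * t * K \<theta> / \<theta>)" by (intro mult_left_mono) auto
    then show ?thesis by (simp add: l_def mult_ac)
  qed
  have 4: "2 * exp 1 * h t < y"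
  proof -
    have "exp 1 < exp (2::real)" by simp
    then have "2 * exp 1 < 8 * exp (2::real)" using exp_gt_zero[of "2::real"] by linarith
    then have "2 * exp 1 * h t < 8 * exp 2 * h t" using ht(1) by (rule mult_strict_right_mono)
    then show ?thesis using y by linarith
  qed
  have big: "t * b + y < t * ?I" using 1 2 3 4 by linarith
  have "exp (l * (t * b)) * (cB 1 / h t) \<le> exp (l * (t * b + y)) * p (t * b + y)"
  proof (rule spread[OF tb \<theta>0 _ _ big])
    show "0 < exp (l * (t * b)) * (cB 1 / h t)" using consts_pos2 ht by simp
    fix x assume x: "t * b \<le> x" "x \<le> t * b + \<theta>"
    have "cB 1 / h t \<le> p (t * b + (x - t * b))" by (rule base_lower) (use x \<theta> in auto)
    then show "exp (l * (t * b)) * (cB 1 / h t) \<le> exp (l * x) * p x"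
      using x l consts_pos2 ht by (intro mult_mono) (auto intro!: mult_left_mono less_imp_le)
  qed (use y0 in auto)
  then have "exp (- (l * (t * b + y))) * (exp (l * (t * b)) * (cB 1 / h t)) \<le> exp (- (l * (t * b + y))) * (exp (l * (t * b + y)) * p (t * b + y))"
    by (rule mult_left_mono) simp
  moreover have "exp (- (l * (t * b + y))) * exp (l * (t * b)) = exp (- (l * y))" unfolding exp_add[symmetric] by (simp add: algebra_simps)
  moreover have "exp (- (l * (t * b + y))) * exp (l * (t * b + y)) = 1" unfolding exp_add[symmetric] by simp
  ultimately have "exp (- (l * y)) * (cB 1 / h t) \<le> p (t * b + y)" by (simp only: mult.assoc[symmetric] mult_1)
  then show ?thesis by (simp add: l_def mult.commute)
qed

end

section \<open>The upper bound for the right tail\<close>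

context scaled_dens
begin

text \<open>\<beta> <= 1/2 bounds 1 / (1 - \<beta>) by 2. \<epsilon> satisfies
  \<open>2 * \<epsilon> * (1 + \<alpha>\<^sub>2) = \<beta> / 2\<close>, so under the cap on the tilt
  exp(l \<epsilon> y) contributes only the power (y/\<theta>)^(\<beta>/2), half of the decay
  (y/\<theta>)^(-\<beta>) of the truncated first moment relative to y. \<open>A0\<close> makes
  \<theta> <= \<epsilon> y and the remaining power small. \<open>C\<nu>\<close> collects the large
  jumps, the second term of \<open>CU\<close> the capped tilt.\<close>

definition "\<beta> = min \<alpha>\<^sub>1 (1/2)"
definition "\<epsilon> = \<beta> / (4 * (1 + \<alpha>\<^sub>2))"
definition "A0 = max (1 / \<epsilon>) ((16 * C1 / a\<^sub>1) powr (2 / \<beta>))"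
definition "C\<nu> = 8 * \<epsilon> / a\<^sub>1 * (a\<^sub>2 * (1 / \<epsilon>) powr (1 + \<alpha>\<^sub>2))"
definition "CU = C\<nu> + CS * a\<^sub>2 / C1"

lemma consts3: "0 < \<beta>" "\<beta> \<le> 1/2" "\<beta> \<le> \<alpha>\<^sub>1" "0 < \<epsilon>" "2 * \<epsilon> \<le> 1" "\<epsilon> \<le> 1" "2 * \<epsilon> * (1 + \<alpha>\<^sub>2) = \<beta> / 2" "A0 \<ge> 1" "C\<nu> > 0" "CU > 0"
proof -
  have al: "\<alpha>\<^sub>2 > 0" using al1 al2 by simp
  show b: "0 < \<beta>" "\<beta> \<le> 1/2" "\<beta> \<le> \<alpha>\<^sub>1" using al1 by (auto simp: \<beta>_def)
  show e: "0 < \<epsilon>" using b al by (simp add: \<epsilon>_def)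
  show eb: "2 * \<epsilon> * (1 + \<alpha>\<^sub>2) = \<beta> / 2" using al by (simp add: \<epsilon>_def field_simps)
  have "2 * \<epsilon> * 1 \<le> 2 * \<epsilon> * (1 + \<alpha>\<^sub>2)" using e al by (intro mult_left_mono) auto
  then show "2 * \<epsilon> \<le> 1" "\<epsilon> \<le> 1" using eb b e by auto
  then have "1 / \<epsilon> \<ge> 1" using e by simp
  then show "A0 \<ge> 1" by (simp add: A0_def le_max_iff_disj)
  show C: "C\<nu> > 0" using e a1 a2 by (simp add: C\<nu>_def)
  then show "CU > 0" using CS_pos a2 consts_pos2 by (simp add: CU_def add_pos_pos)
qed

text \<open>The first bound is \<open>K_le_H\<close>. For the second, \<open>H_upper\<close> makes
  \<theta>^2 H(1/\<theta>) at most h^2 H(1/h) = h^2 / t.\<close>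

lemma K_le_theta:
  assumes t: "t > 0" and \<theta>: "\<theta> > 0" "\<theta> \<le> h t"
  shows "t * K \<theta> / \<theta> \<le> 2 * exp 1 * (t * \<theta> * H (1 / \<theta>))" "t * K \<theta> / h t \<le> 2 * exp 1 * h t"
proof -
  note ht = h[OF t]
  have 1: "t * K \<theta> \<le> t * (2 * exp 1 * \<theta>\<^sup>2 * H (1 / \<theta>))" using K_le_H[OF \<theta>(1)] t by (intro mult_left_mono) auto
  then show "t * K \<theta> / \<theta> \<le> 2 * exp 1 * (t * \<theta> * H (1 / \<theta>))" using \<theta> by (simp add: field_simps power2_eq_square)
  have "H (1 / \<theta>) \<le> (1 / \<theta> / (1 / h t))\<^sup>2 * H (1 / h t)" by (rule H_upper) (use \<theta> ht in \<open>auto simp: field_simps\<close>)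
  then have "t * (2 * exp 1 * \<theta>\<^sup>2 * H (1 / \<theta>)) \<le> t * (2 * exp 1 * \<theta>\<^sup>2 * ((1 / \<theta> / (1 / h t))\<^sup>2 * H (1 / h t)))"
    using t by (intro mult_left_mono) auto
  also have "\<dots> = 2 * exp 1 * (h t)\<^sup>2 * (t * H (1 / h t))" using \<theta> by (simp add: power_divide power_mult_distrib)
  also have "\<dots> = 2 * exp 1 * (h t)\<^sup>2" unfolding ht(2) by simp
  finally have "t * K \<theta> \<le> 2 * exp 1 * (h t)\<^sup>2" using 1 by linarith
  then show "t * K \<theta> / h t \<le> 2 * exp 1 * h t" using ht by (simp add: field_simps power2_eq_square)
qed

text \<open>Up to \<open>a\<^sub>1\<close>, s \<nu>(s) is dominated by its value at \<theta> times
  (\<theta>/s)^\<beta>, which is integrated over all of [0, r], where the primitive is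
  simple.\<close>

lemma int_s_le:
  assumes \<theta>: "\<theta> > 0" "\<theta> \<le> r"
  shows "integrable N (\<lambda>s. indicator {\<theta><..r} s * s)" "(\<integral>s. indicator {\<theta><..r} s * s \<partial>N) \<le> 2 / a\<^sub>1 * (\<theta> * \<nu> \<theta>) * r * (\<theta> / r) powr \<beta>"
proof -
  note c = consts3
  have r: "r > 0" using \<theta> by simp
  let ?g = "\<lambda>s. \<theta> * \<nu> \<theta> / a\<^sub>1 * \<theta> powr \<beta> * s powr (- \<beta>)"
  have "((\<lambda>s. s powr (- \<beta>)) has_integral r powr (- \<beta> + 1) / (- \<beta> + 1)) {0..r}"
    by (rule has_integral_powr_from_0) (use c r in auto)
  then have I: "(?g has_integral \<theta> * \<nu> \<theta> / a\<^sub>1 * \<theta> powr \<beta> * (r powr (- \<beta> + 1) / (- \<beta> + 1))) {0..r}"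
    by (rule has_integral_mult_right)
  have *: "s * \<nu> s \<le> ?g s" if "s \<in> {\<theta><..r}" for s
  proof -
    have s: "s > 0" "\<theta> \<le> s" using that \<theta> by auto
    have "s * \<nu> s \<le> \<theta> * \<nu> \<theta> * (\<theta> / s) powr \<beta> / a\<^sub>1" using s_nu_le[of \<theta> s \<beta>] s \<theta> c by simp
    also have "(\<theta> / s) powr \<beta> = \<theta> powr \<beta> * s powr (- \<beta>)"
      using \<theta> s by (simp add: powr_divide powr_minus_divide)
    finally show ?thesis by simp
  qed
  show "integrable N (\<lambda>s. indicator {\<theta><..r} s * s)"
    by (rule N_integral_le(1)[OF _ _ _ _ _ _ I _ _ *]) (use \<theta> nu_pos[of \<theta>] a1 in auto)
  have "(\<integral>s. indicator {\<theta><..r} s * s \<partial>N) \<le> \<theta> * \<nu> \<theta> / a\<^sub>1 * \<theta> powr \<beta> * (r powr (- \<beta> + 1) / (- \<beta> + 1))"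
    by (rule N_integral_le(2)[OF _ _ _ _ _ _ I _ _ *]) (use \<theta> nu_pos[of \<theta>] a1 in auto)
  also have "\<dots> \<le> \<theta> * \<nu> \<theta> / a\<^sub>1 * \<theta> powr \<beta> * (2 * r powr (- \<beta> + 1))"
  proof (rule mult_left_mono)
    have "r powr (- \<beta> + 1) * 1 \<le> r powr (- \<beta> + 1) * (2 * (- \<beta> + 1))" using c by (intro mult_left_mono) auto
    then show "r powr (- \<beta> + 1) / (- \<beta> + 1) \<le> 2 * r powr (- \<beta> + 1)" using c by (simp add: pos_divide_le_eq algebra_simps)
  qed (use \<theta> nu_pos[of \<theta>] a1 in auto)
  also have "\<dots> = 2 / a\<^sub>1 * (\<theta> * \<nu> \<theta>) * r * (\<theta> / r) powr \<beta>"
    using r \<theta> by (simp add: powr_divide powr_diff)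
  finally show "(\<integral>s. indicator {\<theta><..r} s * s \<partial>N) \<le> 2 / a\<^sub>1 * (\<theta> * \<nu> \<theta>) * r * (\<theta> / r) powr \<beta>" .
qed

end

context sub_scaled
begin

text \<open>The tilt \<open>l\<close> is \<open>k / \<theta>\<close>, capped so that \<open>exp (- l * y / 2)\<close> does not fall below the order of \<open>h t * t * \<nu> y\<close>.
  The cap keeps the contribution of the jumps in \<open>(\<theta>, \<epsilon> y]\<close> to the truncated tilted mean below \<open>y / 8\<close>.\<close>

lemma upper:
  assumes \<theta>: "w_inv \<nu> (2 * exp 1 / t) \<le> \<theta>" "\<theta> \<le> h t" and k: "0 < k" "k \<le> 1/2"
    and y: "16 * exp 1 * h t \<le> y" "4 * exp 1 * k * (t * \<theta> * H (1 / \<theta>)) \<le> y / 8" "A0 * \<theta> \<le> y"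
  shows "p (t * b + y) \<le> CU * (t * \<nu> y) + CS / h t * exp (- (k / 2 * (y / \<theta>)))"
proof -
  note ht = h[OF t_pos] and wi = w_inv[OF t_pos] and c = consts3
  have al: "\<alpha>\<^sub>2 > 0" using al1 al2 by simp
  have \<theta>0: "\<theta> > 0" using \<theta> wi by linarith
  have y0: "y > 0" using c(8) y(3) \<theta>0 by (meson less_le_trans mult_pos_pos zero_less_one)
  have nuy: "\<nu> y > 0" and nut: "\<nu> \<theta> > 0" using nu_pos y0 \<theta>0 by auto
  define A where "A = y / \<theta>"
  have "A \<ge> A0" using y(3) \<theta>0 by (simp add: A_def pos_le_divide_eq)
  then have A: "A \<ge> A0" "A \<ge> 1" using c(8) by auto
  define B where "B = t * (\<theta> * \<nu> \<theta>) / C1"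
  have B: "0 < B" "B \<le> 1"
    using t_nu_le[OF t_pos \<theta>0 t_w_mono[OF t_pos \<theta>(1)]] t_pos \<theta>0 nut consts_pos2(2) by (auto simp: B_def)
  \<comment> \<open>exp(-E/2) is \<open>B / A powr (1 + \<alpha>\<^sub>2)\<close>, which by the
    upper scaling is at most \<open>a\<^sub>2 / C1 * (t * \<theta> * \<nu> y)\<close>. The tilt E /
    y therefore leaves a term no larger than the jump term.\<close>
  define E where "E = 2 * ln (A powr (1 + \<alpha>\<^sub>2) / B)"
  have E: "E \<ge> 0" "exp E = (A powr (1 + \<alpha>\<^sub>2) / B)\<^sup>2"
  proof -
    have "1 \<le> A powr (1 + \<alpha>\<^sub>2)" using A al by (intro ge_one_powr_ge_zero) auto
    then have "1 \<le> A powr (1 + \<alpha>\<^sub>2) / B" using B by (simp add: pos_le_divide_eq)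
    then show "E \<ge> 0" by (simp add: E_def)
    have "exp E = exp (ln (A powr (1 + \<alpha>\<^sub>2) / B)) ^ 2" unfolding E_def by (simp flip: exp_of_nat_mult)
    also have "exp (ln (A powr (1 + \<alpha>\<^sub>2) / B)) = A powr (1 + \<alpha>\<^sub>2) / B" using A B by simp
    finally show "exp E = (A powr (1 + \<alpha>\<^sub>2) / B)\<^sup>2" .
  qed
  define l where "l = min (k / \<theta>) (E / y)"
  have l: "0 \<le> l" "l * \<theta> \<le> k" "l * y \<le> E"
  proof -
    show "0 \<le> l" using k \<theta>0 E y0 by (simp add: l_def)
    have "l \<le> k / \<theta>" "l \<le> E / y" by (auto simp: l_def)
    then show "l * \<theta> \<le> k" "l * y \<le> E" using \<theta>0 y0 by (auto simp: field_simps)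
  qed
  define r where "r = \<epsilon> * y"
  have r: "r > 0" "\<theta> \<le> r" "r \<le> y"
  proof -
    have "1 / \<epsilon> \<le> A" using A by (simp add: A0_def)
    then show "\<theta> \<le> r" using c(4) \<theta>0 by (simp add: r_def A_def field_simps)
  qed (use c y0 in \<open>auto simp: r_def mult_le_cancel_right1\<close>)
  define B1 where "B1 = r * \<nu> r / a\<^sub>1"
  have B1: "B1 \<ge> 0" "\<And>s. s > r \<Longrightarrow> s * \<nu> s \<le> B1"
    using s_nu_le'[of r] r nu_pos[of r] a1 by (auto simp: B1_def)
  define I where "I = (\<integral>s. indicator {..r} s * (s * exp (l * s)) \<partial>N)"
  let ?J = "\<integral>s. indicator {\<theta><..r} s * s \<partial>N"
  have ib: "integrable N (\<lambda>s. s * exp (- (1 / h t * s)))" using integrable_s_exp(1)[of "1 / h t"] ht by simp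
  \<comment> \<open>Up to \<theta>, exp(l s) is linearised and compared with the damping exp(-s/h);
    in (\<theta>, r] it is at most exp(l r). After multiplication by t, the three excess terms over
    t b are at most y/8 each.\<close>
  have "I \<le> (\<integral>s. s * exp (- (1 / h t * s)) + (2 * l + 1 / h t) * (indicator {..\<theta>} s * s\<^sup>2) + exp (l * r) * (indicator {\<theta><..r} s * s) \<partial>N)"
    unfolding I_def
  proof (rule integral_mono_AE)
    show "AE s in N. indicator {..r} s * (s * exp (l * s)) \<le> s * exp (- (1 / h t * s)) + (2 * l + 1 / h t) * (indicator {..\<theta>} s * s\<^sup>2) + exp (l * r) * (indicator {\<theta><..r} s * s)"
      using N_pos
    proof eventually_elim
      case (elim s)
      show ?case
      proof (cases "s \<le> \<theta>")
        case True
        have "l * s \<le> l * \<theta>" using True l by (intro mult_left_mono) auto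
        then have ls: "0 \<le> l * s" "l * s \<le> 1" using l k elim by auto
        \<comment> \<open>l s <= k <= 1/2, so the quadratic term is at most l s.\<close>
        have "exp (l * s) \<le> 1 + l * s + (l * s)\<^sup>2" by (rule exp_bound) (use ls in auto)
        moreover have "(l * s)\<^sup>2 \<le> l * s" using ls by (simp add: power2_eq_square mult_left_le)
        ultimately have "exp (l * s) \<le> 1 + 2 * l * s" by simp
        moreover have "1 - s / h t \<le> exp (- (1 / h t * s))" using exp_ge_add_one_self[of "- (1 / h t * s)"] by simp
        ultimately have "exp (l * s) \<le> exp (- (1 / h t * s)) + (2 * l + 1 / h t) * s" by (simp add: algebra_simps)
        then have "s * exp (l * s) \<le> s * (exp (- (1 / h t * s)) + (2 * l + 1 / h t) * s)" using elim by (intro mult_left_mono) auto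
        then show ?thesis using True r by (simp add: power2_eq_square algebra_simps)
      next
        case False
        show ?thesis
        proof (cases "s \<le> r")
          case a: True
          have "s * exp (l * s) \<le> s * exp (l * r)" using a l elim by (intro mult_left_mono) (auto intro: mult_left_mono)
          moreover have "0 \<le> s * exp (- (1 / h t * s))" using elim by simp
          ultimately show ?thesis using a False by (simp add: mult.commute)
        qed (use elim False in auto)
      qed
    qed
  qed (use integrable_s_exp_trunc[OF r(1)] ib integrable_K[OF \<theta>0] int_s_le(1)[OF \<theta>0 r(2)] in auto)
  also have "\<dots> = b + (2 * l + 1 / h t) * K \<theta> + exp (l * r) * ?J"
    unfolding \<phi>1_def K_def using ib integrable_K[OF \<theta>0] int_s_le(1)[OF \<theta>0 r(2)] by simp
  finally have "t * I \<le> t * (b + (2 * l + 1 / h t) * K \<theta> + exp (l * r) * ?J)" using t_pos by (intro mult_left_mono) auto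
  then have I1: "t * I \<le> t * b + 2 * l * (t * K \<theta>) + t * K \<theta> / h t + t * (exp (l * r) * ?J)" by (simp add: algebra_simps)
  have I2: "2 * l * (t * K \<theta>) \<le> y / 8"
  proof -
    have "2 * l * (t * K \<theta>) = 2 * (l * \<theta>) * (t * K \<theta> / \<theta>)" using \<theta>0 by simp
    also have "\<dots> \<le> 2 * k * (2 * exp 1 * (t * \<theta> * H (1 / \<theta>)))"
      using K_le_theta(1)[OF t_pos \<theta>0 \<theta>(2)] l k t_pos \<theta>0 K_nonneg[of \<theta>] by (intro mult_mono) auto
    also have "\<dots> = 4 * exp 1 * k * (t * \<theta> * H (1 / \<theta>))" by simp
    also note y(2)
    finally show ?thesis .
  qed
  have I3: "t * K \<theta> / h t \<le> y / 8" using K_le_theta(2)[OF t_pos \<theta>0 \<theta>(2)] y(1) by linarith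
  have I4: "t * (exp (l * r) * ?J) \<le> y / 8"
  proof -
    have Ab: "A powr (- \<beta> / 2) \<le> a\<^sub>1 / (16 * C1)"
    proof -
      have "16 * C1 / a\<^sub>1 \<le> A powr (\<beta> / 2)"
      proof -
        have "((16 * C1 / a\<^sub>1) powr (2 / \<beta>)) powr (\<beta> / 2) \<le> A powr (\<beta> / 2)"
          using A(1) c by (intro powr_mono2) (auto simp: A0_def)
        then show ?thesis using c a1 consts_pos2(2) by (simp add: powr_powr)
      qed
      moreover have "0 < 16 * C1 / a\<^sub>1" using a1 consts_pos2(2) by simp
      ultimately have "1 / A powr (\<beta> / 2) \<le> 1 / (16 * C1 / a\<^sub>1)" by (intro divide_left_mono mult_pos_pos) auto
      then show ?thesis using A by (simp add: powr_minus_divide)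
    qed
    have e1: "exp (l * r) \<le> A powr (\<beta> / 2) / B"
    proof -
      have "l * r = (l * y) * \<epsilon>" by (simp add: r_def)
      also have "\<dots> \<le> E * \<epsilon>" using l c by (intro mult_right_mono) auto
      finally have "exp (l * r) \<le> exp (E * \<epsilon>)" by simp
      also have "\<dots> = (exp E) powr \<epsilon>" by (simp add: powr_def mult.commute)
      also have "\<dots> = (A powr (1 + \<alpha>\<^sub>2) / B) powr (2 * \<epsilon>)"
      proof -
        have "X\<^sup>2 powr \<epsilon> = X powr (2 * \<epsilon>)" if "X > 0" for X :: real
          using powr_powr[of X 2 \<epsilon>] that by simp
        then show ?thesis unfolding E(2) using A B by simp
      qed
      also have "\<dots> = A powr (\<beta> / 2) / B powr (2 * \<epsilon>)"
      proof -
        have "(1 + \<alpha>\<^sub>2) * (2 * \<epsilon>) = \<beta> / 2" using c(7) by (simp only: mult_ac)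
        moreover have "(A powr (1 + \<alpha>\<^sub>2) / B) powr (2 * \<epsilon>) = (A powr (1 + \<alpha>\<^sub>2)) powr (2 * \<epsilon>) / B powr (2 * \<epsilon>)"
          using A B by (intro powr_divide)
        ultimately show ?thesis by (simp only: powr_powr)
      qed
      \<comment> \<open>B <= 1 and 2 \<epsilon> <= 1, so the power of B may be replaced by B itself,
        which then cancels against t \<theta> \<nu>(\<theta>).\<close>
      also have "\<dots> \<le> A powr (\<beta> / 2) / B"
      proof (rule divide_left_mono)
        have "B powr 1 \<le> B powr (2 * \<epsilon>)" using B c by (intro powr_mono') auto
        then show "B \<le> B powr (2 * \<epsilon>)" using B by simp
      qed (use B in auto)
      finally show ?thesis .
    qed
    have "?J \<le> 2 / a\<^sub>1 * (\<theta> * \<nu> \<theta>) * r * (\<theta> / r) powr \<beta>" by (rule int_s_le(2)[OF \<theta>0 r(2)])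
    also have "\<dots> = 2 / a\<^sub>1 * (\<theta> * \<nu> \<theta>) * \<theta> powr \<beta> * r powr (1 - \<beta>)"
      using r \<theta>0 by (simp add: powr_divide powr_diff)
    also have "\<dots> \<le> 2 / a\<^sub>1 * (\<theta> * \<nu> \<theta>) * \<theta> powr \<beta> * y powr (1 - \<beta>)"
      using r \<theta>0 c a1 nut by (intro mult_left_mono powr_mono2) auto
    also have "\<dots> = 2 / a\<^sub>1 * (\<theta> * \<nu> \<theta>) * y * A powr (- \<beta>)"
      using y0 \<theta>0 by (simp add: A_def powr_divide powr_diff powr_minus_divide)
    finally have J: "t * ?J \<le> t * (2 / a\<^sub>1 * (\<theta> * \<nu> \<theta>) * y * A powr (- \<beta>))" using t_pos by (intro mult_left_mono) auto
    have "t * (exp (l * r) * ?J) = exp (l * r) * (t * ?J)" by simp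
    also have "\<dots> \<le> (A powr (\<beta> / 2) / B) * (t * (2 / a\<^sub>1 * (\<theta> * \<nu> \<theta>) * y * A powr (- \<beta>)))"
    proof (rule mult_mono[OF e1 J])
      have "0 \<le> ?J" by (rule integral_nonneg_AE) (use N_pos in \<open>auto elim!: eventually_mono simp: indicator_def\<close>)
      then show "0 \<le> t * ?J" using t_pos by simp
    qed (use B in auto)
    also have "\<dots> = (2 / a\<^sub>1 * C1 * y) * (A powr (\<beta> / 2) * A powr (- \<beta>))"
      using t_pos \<theta>0 nut consts_pos2(2) by (simp add: B_def)
    also have "A powr (\<beta> / 2) * A powr (- \<beta>) = A powr (- \<beta> / 2)" by (simp flip: powr_add)
    also have "(2 / a\<^sub>1 * C1 * y) * A powr (- \<beta> / 2) \<le> (2 / a\<^sub>1 * C1 * y) * (a\<^sub>1 / (16 * C1))"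
      using Ab a1 consts_pos2(2) y0 by (intro mult_left_mono) auto
    also have "\<dots> = y / 8" using a1 consts_pos2(2) by simp
    finally show ?thesis .
  qed
  have mean: "t * I \<le> t * b + 3 * (y / 8)" using I1 I2 I3 I4 by linarith
  \<comment> \<open>Here d = y/8: the distance left for the exponential is at least y - 3y/8 - y/8 =
    y/2.\<close>
  have "p (t * b + y) \<le> exp (- (l * (t * b + y - t * I - y / 8))) * (CS / h t) + t * B1 / (y / 8)"
    unfolding I_def
  proof (rule max_principle[OF r(1) l(1) _ B1])
    show "0 < t * b + y" using t_pos b_pos y0 by (simp add: add_pos_pos)
  qed (use y0 CS_pos ht p_sup in auto)
  also have "exp (- (l * (t * b + y - t * I - y / 8))) * (CS / h t) \<le> (exp (- (k / 2 * (y / \<theta>))) + a\<^sub>2 / C1 * (t * h t * \<nu> y)) * (CS / h t)"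
  proof (rule mult_right_mono)
    have "l * (y / 2) \<le> l * (t * b + y - t * I - y / 8)" using mean l by (intro mult_left_mono) auto
    then have "exp (- (l * (t * b + y - t * I - y / 8))) \<le> exp (- (l * (y / 2)))" by simp
    also have "\<dots> \<le> exp (- (k / 2 * (y / \<theta>))) + a\<^sub>2 / C1 * (t * h t * \<nu> y)"
    proof (cases "k / \<theta> \<le> E / y")
      case True
      then have "l = k / \<theta>" by (simp add: l_def)
      then have "exp (- (l * (y / 2))) = exp (- (k / 2 * (y / \<theta>)))" by simp
      moreover have "0 \<le> a\<^sub>2 / C1 * (t * h t * \<nu> y)" using a2 consts_pos2(2) t_pos ht nuy by simp
      ultimately show ?thesis by linarith
    next
      case False
      then have "l = E / y" by (simp add: l_def)
      then have "l * (y / 2) = ln (A powr (1 + \<alpha>\<^sub>2) / B)" using y0 by (simp add: E_def)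
      then have "exp (- (l * (y / 2))) = B / A powr (1 + \<alpha>\<^sub>2)" using A B by (simp add: exp_minus)
      also have "\<dots> = t * \<theta> / C1 * (\<nu> \<theta> / A powr (1 + \<alpha>\<^sub>2))" by (simp add: B_def)
      also have "\<dots> \<le> t * \<theta> / C1 * (a\<^sub>2 * \<nu> y)"
      proof (rule mult_left_mono)
        have "\<nu> \<theta> \<le> a\<^sub>2 * A powr (1 + \<alpha>\<^sub>2) * \<nu> y" unfolding A_def by (rule nu_le[OF \<theta>0]) (use r in linarith)
        then show "\<nu> \<theta> / A powr (1 + \<alpha>\<^sub>2) \<le> a\<^sub>2 * \<nu> y" using A by (simp add: pos_divide_le_eq mult_ac)
      qed (use t_pos \<theta>0 consts_pos2(2) in auto)
      also have "\<dots> \<le> t * h t / C1 * (a\<^sub>2 * \<nu> y)"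
        using \<theta> t_pos consts_pos2(2) a2 nuy by (intro mult_right_mono divide_right_mono mult_left_mono) auto
      also have "\<dots> = a\<^sub>2 / C1 * (t * h t * \<nu> y)" by simp
      finally show ?thesis by (simp add: add_increasing)
    qed
    finally show "exp (- (l * (t * b + y - t * I - y / 8))) \<le> exp (- (k / 2 * (y / \<theta>))) + a\<^sub>2 / C1 * (t * h t * \<nu> y)" .
  qed (use CS_pos ht in simp)
  also have "\<dots> = CS / h t * exp (- (k / 2 * (y / \<theta>))) + CS * a\<^sub>2 / C1 * (t * \<nu> y)" using ht by (simp add: field_simps)
  also have "t * B1 / (y / 8) \<le> C\<nu> * (t * \<nu> y)"
  proof -
    have "\<nu> r \<le> a\<^sub>2 * (y / r) powr (1 + \<alpha>\<^sub>2) * \<nu> y" by (rule nu_le[OF r(1) r(3)])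
    also have "y / r = 1 / \<epsilon>" using y0 by (simp add: r_def)
    finally have "8 * \<epsilon> / a\<^sub>1 * t * \<nu> r \<le> 8 * \<epsilon> / a\<^sub>1 * t * (a\<^sub>2 * (1 / \<epsilon>) powr (1 + \<alpha>\<^sub>2) * \<nu> y)"
      using c a1 t_pos by (intro mult_left_mono) auto
    moreover have "t * B1 / (y / 8) = 8 * \<epsilon> / a\<^sub>1 * t * \<nu> r" using y0 by (simp add: B1_def r_def)
    ultimately show ?thesis by (simp add: C\<nu>_def mult_ac)
  qed
  finally show ?thesis by (simp add: CU_def algebra_simps)
qed

end

section \<open>The functions D and theta, and the left tail\<close>

lemma powr_exp_bounded:
  fixes q c :: real
  assumes "q > 0" "c > 0"
  shows "\<exists>M>0. \<forall>x\<ge>0. x powr q * exp (- (c * x)) \<le> M"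
proof -
  have "((\<lambda>x::real. x powr q * exp (- (c * x))) \<longlongrightarrow> 0) at_top"
    using assms by real_asymp
  then have "eventually (\<lambda>x::real. x powr q * exp (- (c * x)) < 1) at_top"
    by (rule order_tendstoD) simp
  then obtain X where X: "\<And>x. x \<ge> X \<Longrightarrow> x powr q * exp (- (c * x)) < 1"
    by (auto simp: eventually_at_top_linorder)
  have "x powr q * exp (- (c * x)) \<le> 1 + \<bar>X\<bar> powr q" if x: "x \<ge> 0" for x
  proof (cases "x \<ge> X")
    case True
    then show ?thesis using X[of x] powr_ge_zero[of "\<bar>X\<bar>" q] by linarith
  next
    case False
    have "x powr q * exp (- (c * x)) \<le> \<bar>X\<bar> powr q * 1"
      using x False assms by (intro mult_mono powr_mono2) auto
    then show ?thesis by simp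
  qed
  moreover have "1 + \<bar>X\<bar> powr q > 0" using powr_ge_zero[of "\<bar>X\<bar>" q] by linarith
  ultimately show ?thesis by blast
qed

context scaled_dens
begin

abbreviation \<theta>0 :: "real \<Rightarrow> real" where "\<theta>0 t \<equiv> w_inv \<nu> (2 * exp 1 / t)"

lemma isCont_sH: assumes "s > 0" shows "isCont (\<lambda>s. s * H (1 / s)) s"
proof -
  have "isCont (\<lambda>s. 1 / s) s" using assms by (intro continuous_intros) auto
  then have "isCont (\<lambda>s. H (1 / s)) s" by (rule isCont_o2) (use H_isCont assms in simp)
  then show ?thesis by (intro continuous_intros)
qed

lemma continuous_sH: "A \<subseteq> {0<..} \<Longrightarrow> continuous_on A (\<lambda>s. s * H (1 / s))"
  by (intro continuous_at_imp_continuous_on ballI isCont_sH) auto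

text \<open>The maximum is attained by continuity on a compact interval, which gives
  \<open>GREATEST\<close> its meaning. The endpoint s = h has value h, because t H(1/h) = 1.\<close>

lemma D_props:
  assumes t: "t > 0"
  shows "\<And>s. \<theta>0 t \<le> s \<Longrightarrow> s \<le> h t \<Longrightarrow> t * s * H (1 / s) \<le> D_fun \<nu> t"
    "\<exists>s\<ge>\<theta>0 t. s \<le> h t \<and> t * s * H (1 / s) = D_fun \<nu> t" "h t \<le> D_fun \<nu> t"
proof -
  note ht = h[OF t] and wi = w_inv[OF t]
  have sub: "{\<theta>0 t..h t} \<subseteq> {0<..}" using wi by auto
  obtain s where s: "s \<in> {\<theta>0 t..h t}" "\<And>s'. s' \<in> {\<theta>0 t..h t} \<Longrightarrow> s' * H (1 / s') \<le> s * H (1 / s)"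
    using continuous_attains_sup[of "{\<theta>0 t..h t}" "\<lambda>s. s * H (1 / s)"] continuous_sH[OF sub] wi by auto
  have im: "(\<lambda>s. s * H_fun \<nu> (inverse s)) ` {\<theta>0 t..inverse (H_inv \<nu> (1 / t))} = (\<lambda>s. s * H (1 / s)) ` {\<theta>0 t..h t}"
  proof (rule image_cong)
    show "{\<theta>0 t..inverse (H_inv \<nu> (1 / t))} = {\<theta>0 t..h t}" by (simp add: h_def inverse_eq_divide)
    show "x * H_fun \<nu> (inverse x) = x * H (1 / x)" if "x \<in> {\<theta>0 t..h t}" for x
      using H_fun_eq[of "1 / x"] that wi by (auto simp: inverse_eq_divide)
  qed
  have "(GREATEST v. v \<in> (\<lambda>s. s * H (1 / s)) ` {\<theta>0 t..h t}) = s * H (1 / s)"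
    by (rule Greatest_equality) (use s in auto)
  then have D: "D_fun \<nu> t = t * (s * H (1 / s))" unfolding D_fun_def im by simp
  show 1: "t * s' * H (1 / s') \<le> D_fun \<nu> t" if "\<theta>0 t \<le> s'" "s' \<le> h t" for s'
    using s(2)[of s'] that t unfolding D by (simp add: mult.assoc)
  show "\<exists>s\<ge>\<theta>0 t. s \<le> h t \<and> t * s * H (1 / s) = D_fun \<nu> t" using s D by (auto simp: mult.assoc)
  have "t * h t * H (1 / h t) \<le> D_fun \<nu> t" by (rule 1) (use wi in auto)
  moreover have "t * h t * H (1 / h t) = h t * (t * H (1 / h t))" by simp
  ultimately show "h t \<le> D_fun \<nu> t" unfolding ht(2) by simp
qed

lemma theta_low: "t > 0 \<Longrightarrow> y < h t \<Longrightarrow> theta_fun \<nu> t y = h t"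
  by (simp add: theta_fun_def h_def inverse_eq_divide)

lemma theta_high: "t > 0 \<Longrightarrow> D_fun \<nu> t < y \<Longrightarrow> theta_fun \<nu> t y = \<theta>0 t"
  using D_props(3)[of t] by (simp add: theta_fun_def h_def inverse_eq_divide)

text \<open>The level set is compact, so \<open>LEAST\<close> is a minimum; it is nonempty because
  the function equals h <= y at the right end and D(t) >= y at its maximiser.\<close>

lemma theta_mid:
  assumes t: "t > 0" and y: "h t \<le> y" "y \<le> D_fun \<nu> t"
  shows "\<theta>0 t \<le> theta_fun \<nu> t y" "theta_fun \<nu> t y \<le> h t"
    "t * theta_fun \<nu> t y * H (1 / theta_fun \<nu> t y) = y"
proof -
  note ht = h[OF t] and wi = w_inv[OF t]
  define S where "S = {\<theta>0 t..h t} \<inter> (\<lambda>s. t * (s * H (1 / s))) -` {y}"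
  have sub: "{\<theta>0 t..h t} \<subseteq> {0<..}" using wi by auto
  have co: "continuous_on {\<theta>0 t..h t} (\<lambda>s. t * (s * H (1 / s)))"
    by (intro continuous_intros continuous_sH sub)
  have "closed S" unfolding S_def by (intro continuous_closed_preimage co) auto
  moreover have "bounded S" unfolding S_def by (rule bounded_subset[of "{\<theta>0 t..h t}"]) auto
  ultimately have "compact S" by (simp add: compact_eq_bounded_closed)
  moreover have "S \<noteq> {}"
  proof -
    obtain s where s: "\<theta>0 t \<le> s" "s \<le> h t" "t * s * H (1 / s) = D_fun \<nu> t" using D_props(2)[OF t] by blast
    have "t * (h t * H (1 / h t)) = h t * (t * H (1 / h t))" by simp
    then have "t * (h t * H (1 / h t)) = h t" unfolding ht(2) by simp
    then have "t * (h t * H (1 / h t)) \<le> y" "y \<le> t * (s * H (1 / s))" using y s(3) by (simp_all only: mult.assoc)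
    then have "\<exists>x\<ge>s. x \<le> h t \<and> t * (x * H (1 / x)) = y"
      by (intro IVT2' continuous_on_subset[OF co]) (use s in auto)
    then obtain x where "s \<le> x" "x \<le> h t" "t * (x * H (1 / x)) = y" by blast
    then have "x \<in> S" using s by (simp add: S_def)
    then show ?thesis by blast
  qed
  ultimately obtain m where m: "m \<in> S" "\<And>z. z \<in> S \<Longrightarrow> m \<le> z" using compact_attains_inf[of S] by blast
  have mem: "s \<in> {\<theta>0 t..inverse (H_inv \<nu> (1 / t))} \<and> t * s * H_fun \<nu> (inverse s) = y \<longleftrightarrow> s \<in> S" for s
    using H_fun_eq[of "1 / s"] wi by (auto simp: S_def h_def inverse_eq_divide mult.assoc)
  have "theta_fun \<nu> t y = (LEAST s. s \<in> S)"
    using y unfolding theta_fun_def mem by (simp add: h_def inverse_eq_divide)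
  also have "\<dots> = m" by (rule Least_equality) (use m in auto)
  finally have "theta_fun \<nu> t y = m" .
  then show "\<theta>0 t \<le> theta_fun \<nu> t y" "theta_fun \<nu> t y \<le> h t" "t * theta_fun \<nu> t y * H (1 / theta_fun \<nu> t y) = y"
    using m(1) by (auto simp: S_def mult.assoc)
qed

text \<open>Beyond D(t) the equation for \<theta> is lost, but the inequality survives because D(t)
  is a maximum; \<open>upper\<close> uses only the inequality.\<close>

lemma theta_general:
  assumes t: "t > 0" and y: "h t \<le> y"
  shows "\<theta>0 t \<le> theta_fun \<nu> t y" "theta_fun \<nu> t y \<le> h t"
    "t * theta_fun \<nu> t y * H (1 / theta_fun \<nu> t y) \<le> y"
proof -
  have "\<theta>0 t \<le> theta_fun \<nu> t y \<and> theta_fun \<nu> t y \<le> h t \<and> t * theta_fun \<nu> t y * H (1 / theta_fun \<nu> t y) \<le> y"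
  proof (cases "y \<le> D_fun \<nu> t")
    case True
    then show ?thesis using theta_mid[OF t y True] by simp
  next
    case False
    then show ?thesis using theta_high[OF t, of y] D_props(1)[OF t, of "\<theta>0 t"] w_inv[OF t] by simp
  qed
  then show "\<theta>0 t \<le> theta_fun \<nu> t y" "theta_fun \<nu> t y \<le> h t"
    "t * theta_fun \<nu> t y * H (1 / theta_fun \<nu> t y) \<le> y" by auto
qed

definition "C6 = 2 * exp 1 * a\<^sub>1 * \<alpha>\<^sub>1 / a\<^sub>2"

lemma C6_pos: "C6 > 0" using a1 a2 al1 by (simp add: C6_def)

text \<open>At \<open>\<theta>0 t\<close> one has t w = 2e exactly, so t s \<nu>(s) is bounded below
  there, and the upper scaling carries this to y. In units of 1/h the jump term thus decays at most
  polynomially in y / \<open>\<theta>0 t\<close>.\<close>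

lemma t_nu_h_ge:
  assumes t: "t > 0" and y: "\<theta>0 t \<le> y"
  shows "C6 * (y / \<theta>0 t) powr (- (1 + \<alpha>\<^sub>2)) \<le> h t * (t * \<nu> y)"
proof -
  note wi = w_inv[OF t]
  let ?q = "\<theta>0 t"
  have y0: "y > 0" using y wi by linarith
  have "2 * exp 1 = t * w ?q" unfolding wi using t by simp
  also have "\<dots> \<le> t * (?q * \<nu> ?q / (a\<^sub>1 * \<alpha>\<^sub>1))" using w_le[OF wi(1)] t by (intro mult_left_mono) auto
  also have "\<dots> \<le> t * (?q * (a\<^sub>2 * (y / ?q) powr (1 + \<alpha>\<^sub>2) * \<nu> y) / (a\<^sub>1 * \<alpha>\<^sub>1))"
    using nu_le[OF wi(1) y] t a1 al1 wi by (intro mult_left_mono divide_right_mono) auto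
  also have "\<dots> \<le> t * (h t * (a\<^sub>2 * (y / ?q) powr (1 + \<alpha>\<^sub>2) * \<nu> y) / (a\<^sub>1 * \<alpha>\<^sub>1))"
    using wi t a1 a2 al1 nu_pos[OF y0] by (intro mult_left_mono divide_right_mono mult_right_mono) auto
  finally have *: "2 * exp 1 \<le> t * (h t * (a\<^sub>2 * (y / ?q) powr (1 + \<alpha>\<^sub>2) * \<nu> y) / (a\<^sub>1 * \<alpha>\<^sub>1))" .
  have "C6 * (y / ?q) powr (- (1 + \<alpha>\<^sub>2)) = (a\<^sub>1 * \<alpha>\<^sub>1 / a\<^sub>2 * (y / ?q) powr (- (1 + \<alpha>\<^sub>2))) * (2 * exp 1)"
    by (simp add: C6_def)
  also have "\<dots> \<le> (a\<^sub>1 * \<alpha>\<^sub>1 / a\<^sub>2 * (y / ?q) powr (- (1 + \<alpha>\<^sub>2))) * (t * (h t * (a\<^sub>2 * (y / ?q) powr (1 + \<alpha>\<^sub>2) * \<nu> y) / (a\<^sub>1 * \<alpha>\<^sub>1)))"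
    using * a1 a2 al1 by (intro mult_left_mono) auto
  also have "\<dots> = h t * (t * \<nu> y) * ((y / ?q) powr (- (1 + \<alpha>\<^sub>2)) * (y / ?q) powr (1 + \<alpha>\<^sub>2))"
    using a1 a2 al1 by simp
  also have "(y / ?q) powr (- (1 + \<alpha>\<^sub>2)) * (y / ?q) powr (1 + \<alpha>\<^sub>2) = 1"
    unfolding powr_add[symmetric] using y0 wi by simp
  finally show ?thesis by simp
qed

text \<open>If \<open>D(t)\<close> is at most of order \<open>h t\<close>, then the variance up to \<open>\<theta>0 t\<close> is negligible against \<open>h t ^ 2 / t\<close>,
  and \<open>\<nu>\<close> decays too fast on \<open>(\<theta>0 t, h t)\<close> to produce it unless \<open>\<theta>0 t\<close> and \<open>h t\<close> are comparable.\<close>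

lemma h_le_theta0: "\<exists>C>0. \<forall>t>0. D_fun \<nu> t < 16 * exp 1 * h t \<longrightarrow> h t \<le> C * \<theta>0 t"
proof -
  \<comment> \<open>2e from \<open>K_le_theta\<close> times 16e gives 32 e^2 for the variance up to
    \<open>\<theta>0 t\<close>; the second summand is h times the first moment between
    \<open>\<theta>0 t\<close> and h.\<close>
  define C5 where "C5 = CK * (32 * exp 2 + 2 / a\<^sub>1 * C1)"
  note c = consts3
  have C5: "C5 > 0" using CK_ge_1 a1 consts_pos2(2) by (simp add: C5_def add_pos_pos)
  have "h t \<le> C5 powr (1 / \<beta>) * \<theta>0 t" if t: "t > 0" and D: "D_fun \<nu> t < 16 * exp 1 * h t" for t
  proof -
    note ht = h[OF t] and wi = w_inv[OF t]
    let ?q = "\<theta>0 t"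
    define z where "z = ?q / h t"
    have z: "0 < z" "z \<le> 1" using wi ht by (auto simp: z_def)
    have q: "?q = z * h t" using ht by (simp add: z_def)
    have "t * K ?q / ?q \<le> 2 * exp 1 * (t * ?q * H (1 / ?q))" by (rule K_le_theta(1)[OF t wi(1) wi(3)])
    also have "\<dots> \<le> 2 * exp 1 * (16 * exp 1 * h t)" using D_props(1)[OF t, of ?q] wi D by (intro mult_left_mono) auto
    also have "\<dots> = 32 * exp 2 * h t" by (simp flip: exp_add)
    finally have K1: "t * K ?q \<le> 32 * exp 2 * (h t)\<^sup>2 * z" using wi unfolding z_def by (simp add: field_simps power2_eq_square)
    have "K (h t) = (\<integral>s. indicator {..?q} s * s\<^sup>2 + indicator {?q<..h t} s * s\<^sup>2 \<partial>N)"
      unfolding K_def using wi by (intro Bochner_Integration.integral_cong) (auto simp: indicator_def)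
    also have "\<dots> \<le> (\<integral>s. indicator {..?q} s * s\<^sup>2 + h t * (indicator {?q<..h t} s * s) \<partial>N)"
    proof (rule integral_mono_AE)
      have "integrable N (\<lambda>s. indicator {..h t} s * s\<^sup>2 - indicator {..?q} s * s\<^sup>2)"
        using integrable_K[OF ht(1)] integrable_K[OF wi(1)] by simp
      also have "(\<lambda>s. indicator {..h t} s * s\<^sup>2 - indicator {..?q} s * s\<^sup>2) = (\<lambda>s. indicator {?q<..h t} s * s\<^sup>2)"
        using wi by (auto simp: indicator_def fun_eq_iff)
      finally show "integrable N (\<lambda>s. indicator {..?q} s * s\<^sup>2 + indicator {?q<..h t} s * s\<^sup>2)"
        using integrable_K[OF wi(1)] by simp
      show "AE s in N. indicator {..?q} s * s\<^sup>2 + indicator {?q<..h t} s * s\<^sup>2 \<le> indicator {..?q} s * s\<^sup>2 + h t * (indicator {?q<..h t} s * s)"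
        using N_pos by eventually_elim (auto simp: indicator_def power2_eq_square intro: mult_right_mono)
    qed (use integrable_K[OF wi(1)] int_s_le(1)[OF wi(1) wi(3)] in auto)
    also have "\<dots> = K ?q + h t * (\<integral>s. indicator {?q<..h t} s * s \<partial>N)"
      unfolding K_def using integrable_K[OF wi(1)] int_s_le(1)[OF wi(1) wi(3)] by simp
    also have "\<dots> \<le> K ?q + h t * (2 / a\<^sub>1 * (?q * \<nu> ?q) * h t * z powr \<beta>)"
      using int_s_le(2)[OF wi(1) wi(3)] ht by (intro add_left_mono mult_left_mono) (auto simp: z_def)
    finally have "t * K (h t) \<le> t * (K ?q + h t * (2 / a\<^sub>1 * (?q * \<nu> ?q) * h t * z powr \<beta>))" using t by (intro mult_left_mono) auto
    also have "\<dots> = t * K ?q + (t * (?q * \<nu> ?q)) * (2 / a\<^sub>1 * (h t)\<^sup>2 * z powr \<beta>)" by (simp add: algebra_simps power2_eq_square)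
    also have "\<dots> \<le> 32 * exp 2 * (h t)\<^sup>2 * z + C1 * (2 / a\<^sub>1 * (h t)\<^sup>2 * z powr \<beta>)"
      using K1 t_nu_le[OF t wi(1) t_w_mono[OF t order_refl]] a1 by (intro add_mono mult_right_mono) auto
    also have "\<dots> \<le> 32 * exp 2 * (h t)\<^sup>2 * z powr \<beta> + C1 * (2 / a\<^sub>1 * (h t)\<^sup>2 * z powr \<beta>)"
    proof -
      have "z powr 1 \<le> z powr \<beta>" using z c by (intro powr_mono') auto
      then have "z \<le> z powr \<beta>" using z by simp
      then show ?thesis by (intro add_right_mono mult_left_mono) auto
    qed
    finally have tK: "t * K (h t) \<le> (h t)\<^sup>2 * ((32 * exp 2 + 2 / a\<^sub>1 * C1) * z powr \<beta>)" by (simp add: algebra_simps)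
    \<comment> \<open>The normalisation of h forces t K(h) to be at least h^2 / \<open>CK\<close>,
      so the ratio z cannot be small.\<close>
    have "1 = t * H (1 / h t)" using ht by simp
    also have "\<dots> \<le> t * (CK * K (h t) / (h t)\<^sup>2)" using H_le_K[OF ht(1)] t by (intro mult_left_mono) auto
    also have "\<dots> = CK / (h t)\<^sup>2 * (t * K (h t))" by simp
    also have "\<dots> \<le> CK / (h t)\<^sup>2 * ((h t)\<^sup>2 * ((32 * exp 2 + 2 / a\<^sub>1 * C1) * z powr \<beta>))"
      using tK CK_ge_1 by (intro mult_left_mono) auto
    also have "\<dots> = C5 * z powr \<beta>" using ht by (simp add: C5_def)
    finally have "1 powr (1 / \<beta>) \<le> (C5 * z powr \<beta>) powr (1 / \<beta>)" using c by (intro powr_mono2) auto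
    also have "\<dots> = C5 powr (1 / \<beta>) * z" using C5 z c by (simp add: powr_mult powr_powr)
    finally have "1 * h t \<le> C5 powr (1 / \<beta>) * z * h t" using ht by (intro mult_right_mono) auto
    then show ?thesis unfolding q by simp
  qed
  moreover have "C5 powr (1 / \<beta>) > 0" using C5 by simp
  ultimately show ?thesis by blast
qed

end

section \<open>The left tail by the saddle point\<close>

context sub_scaled
begin

text \<open>\<sigma> is the saddle point: the tilted mean is x, so t \<phi>(\<sigma>) - \<sigma> x =
  t H(\<sigma>), and p(x) is exactly exp(-t H(\<sigma>)) times the tilted density at its mean. The
  condition x <= t b(t) gives \<sigma> >= 1/h, hence t H(\<sigma>) >= 1, as the bounds at the mean
  require.\<close>

lemma left_tail:
  assumes x: "0 < x" "x \<le> t * b"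
  defines "\<sigma> \<equiv> sigma_fun \<nu> t x"
  shows "cL 0 / sqrt (V \<sigma>) * exp (- (t * H \<sigma>)) \<le> p x" "p x \<le> CS / sqrt (V \<sigma>) * exp (- (t * H \<sigma>))"
    "\<sigma> \<ge> 1 / h t"
proof -
  note ht = h[OF t_pos]
  have s: "\<sigma> \<ge> 1 / h t" "t * \<phi>1 \<sigma> = x" unfolding \<sigma>_def using sigma_fun[OF t_pos x(1) _ x(2)] ht by auto
  then show "\<sigma> \<ge> 1 / h t" by simp
  have s0: "\<sigma> > 0" using s(1) ht by (meson less_le_trans zero_less_divide_1_iff)
  have "H (1 / h t) \<le> H \<sigma>" using H_strict_mono[of "1 / h t" \<sigma>] s ht by (cases "1 / h t = \<sigma>") auto
  then have tH: "t * H \<sigma> \<ge> 1" using ht(2) t_pos by (metis mult_le_cancel_left_pos)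
  have "t * \<phi> \<sigma> - \<sigma> * x = t * H \<sigma>" unfolding H_eq[OF s0] s(2)[symmetric] by (simp add: algebra_simps)
  then have px: "p x = ps \<sigma> x * exp (- (t * H \<sigma>))" by (simp add: ps_def exp_minus field_simps)
  have "cL 0 / sqrt (V \<sigma>) \<le> ps \<sigma> x" by (rule center_lower[OF s0 tH]) (use s in auto)
  then show "cL 0 / sqrt (V \<sigma>) * exp (- (t * H \<sigma>)) \<le> p x" unfolding px by (intro mult_right_mono) auto
  have "ps \<sigma> x \<le> CS / sqrt (V \<sigma>)" by (rule tilted_sup[OF s0 tH x(1)])
  then show "p x \<le> CS / sqrt (V \<sigma>) * exp (- (t * H \<sigma>))" unfolding px by (intro mult_right_mono) auto
qed

text \<open>With z = t H(\<sigma>), sqrt V lies between multiples of sqrt z / \<sigma>, and 1 <=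
  \<sigma> h <= z^(1/\<gamma>). Exchanging 1 / sqrt V for 1/h thus costs only powers of z, absorbed
  by exp(z) in the lower bound and by exp(z/2) in the upper one.\<close>

lemma left_tail_H:
  assumes M: "\<And>z. z \<ge> 0 \<Longrightarrow> z powr (1 / \<gamma>) * exp (- (1/2 * z)) \<le> M"
    and \<sigma>: "\<sigma> \<ge> 1 / h t"
  shows "1 / h t * exp (- (2 * t * H \<sigma>)) \<le> 1 / sqrt (V \<sigma>) * exp (- (t * H \<sigma>))"
    "1 / sqrt (V \<sigma>) * exp (- (t * H \<sigma>)) \<le> sqrt CH * M * (1 / h t) * exp (- (t / 2 * H \<sigma>))"
proof -
  note ht = h[OF t_pos]
  have s0: "\<sigma> > 0" using \<sigma> ht by (meson less_le_trans zero_less_divide_1_iff)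
  have "H (1 / h t) \<le> H \<sigma>" using H_strict_mono[of "1 / h t" \<sigma>] \<sigma> ht by (cases "1 / h t = \<sigma>") auto
  then have tH: "t * H \<sigma> \<ge> 1" using ht(2) t_pos by (metis mult_le_cancel_left_pos)
  define z where "z = t * H \<sigma>"
  have z: "z \<ge> 1" using tH by (simp add: z_def)
  have V0: "sqrt (V \<sigma>) > 0" using V_pos[OF s0] by simp
  have "sqrt (2 * z) \<le> exp z"
  proof (rule real_le_lsqrt)
    have "2 * z \<le> exp (2 * z)" using exp_ge_add_one_self[of "2 * z"] by linarith
    then show "2 * z \<le> (exp z)\<^sup>2" by (simp flip: exp_of_nat_mult)
  qed auto
  then have "sqrt (V \<sigma>) \<le> exp z / \<sigma>" using sqrt_V(1)[OF s0] s0 unfolding z_def[symmetric]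
    by (meson divide_right_mono less_imp_le order_trans)
  also have "\<dots> \<le> exp z / (1 / h t)" using \<sigma> ht s0 by (intro divide_left_mono) auto
  finally have "sqrt (V \<sigma>) * (1 / h t) \<le> exp z" using ht by (simp add: field_simps)
  then have "exp (- (2 * z)) * (sqrt (V \<sigma>) * (1 / h t)) \<le> exp (- (2 * z)) * exp z" by (intro mult_left_mono) auto
  also have "\<dots> = exp (- z)" by (simp flip: exp_add)
  finally show "1 / h t * exp (- (2 * t * H \<sigma>)) \<le> 1 / sqrt (V \<sigma>) * exp (- (t * H \<sigma>))"
    using V0 by (simp add: z_def field_simps)
  have "(\<sigma> / (1 / h t)) powr \<gamma> * H (1 / h t) \<le> H \<sigma>" by (rule H_lower) (use \<sigma> ht in auto)
  then have "t * ((\<sigma> / (1 / h t)) powr \<gamma> * H (1 / h t)) \<le> z" using t_pos by (simp add: z_def)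
  moreover have "t * ((\<sigma> / (1 / h t)) powr \<gamma> * H (1 / h t)) = (\<sigma> * h t) powr \<gamma> * (t * H (1 / h t))" by simp
  ultimately have "(\<sigma> * h t) powr \<gamma> * (t * H (1 / h t)) \<le> z" by linarith
  then have "(\<sigma> * h t) powr \<gamma> \<le> z" unfolding ht(2) by simp
  then have "((\<sigma> * h t) powr \<gamma>) powr (1 / \<gamma>) \<le> z powr (1 / \<gamma>)" using gamma by (intro powr_mono2) auto
  then have sh: "\<sigma> * h t \<le> z powr (1 / \<gamma>)" using gamma s0 ht by (simp add: powr_powr)
  have CH: "CH > 0" using CH_ge_1 by simp
  have "1 / (\<sigma> * sqrt CH) \<le> sqrt z / (\<sigma> * sqrt CH)" using z s0 CH by (intro divide_right_mono) auto
  also have "\<dots> \<le> sqrt (V \<sigma>)" using sqrt_V(2)[OF s0] by (simp add: z_def)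
  finally have "1 / sqrt (V \<sigma>) \<le> sqrt CH * \<sigma>" using V0 s0 CH by (simp add: field_simps)
  also have "\<dots> = sqrt CH * (\<sigma> * h t) * (1 / h t)" using ht by simp
  also have "\<dots> \<le> sqrt CH * z powr (1 / \<gamma>) * (1 / h t)" using sh CH ht by (intro mult_right_mono mult_left_mono) auto
  finally have "1 / sqrt (V \<sigma>) * exp (- z) \<le> sqrt CH * z powr (1 / \<gamma>) * (1 / h t) * exp (- z)" by (rule mult_right_mono) simp
  also have "sqrt CH * z powr (1 / \<gamma>) * (1 / h t) * exp (- z)
      = sqrt CH * (1 / h t) * exp (- (1/2 * z)) * (z powr (1 / \<gamma>) * exp (- (1/2 * z)))"
  proof -
    have "exp (- z) = exp (- (1/2 * z)) * exp (- (1/2 * z))" by (simp flip: exp_add)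
    then show ?thesis by (simp only: mult_ac)
  qed
  also have "\<dots> \<le> sqrt CH * (1 / h t) * exp (- (1/2 * z)) * M"
    using M[of z] z CH ht by (intro mult_left_mono) auto
  finally show "1 / sqrt (V \<sigma>) * exp (- (t * H \<sigma>)) \<le> sqrt CH * M * (1 / h t) * exp (- (t / 2 * H \<sigma>))"
    by (simp add: z_def mult_ac)
qed

end

section \<open>Two-sided estimates\<close>

context scaled_dens
begin

text \<open>The tilt \<open>l\<close> of \<open>middle_lower\<close> multiplied by \<theta>.\<close>

definition "c4 = 16 * exp 2 * CK"

lemma c4_pos: "c4 > 0" using CK_ge_1 by (simp add: c4_def)

text \<open>For \<theta> = \<open>\<theta>0 t\<close> the jump term decays at most polynomially in y
  / \<theta>, hence dominates any exponential. This removes the exponential from (iii), and handles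
  it in the lower bound of (ii) where y / (8 e^2) exceeds D(t).\<close>

lemma exp_le_jump:
  assumes c: "c > 0"
  shows "\<exists>M>0. \<forall>t>0. \<forall>y\<ge>\<theta>0 t. exp (- (c * (y / \<theta>0 t))) \<le> M * (h t * (t * \<nu> y))"
proof -
  have al: "1 + \<alpha>\<^sub>2 > 0" using al1 al2 by simp
  obtain M where M: "M > 0" "\<And>x. x \<ge> 0 \<Longrightarrow> x powr (1 + \<alpha>\<^sub>2) * exp (- (c * x)) \<le> M"
    using powr_exp_bounded[OF al c] by blast
  have "exp (- (c * (y / \<theta>0 t))) \<le> M / C6 * (h t * (t * \<nu> y))" if t: "t > 0" and y: "y \<ge> \<theta>0 t" for t y
  proof -
    define A where "A = y / \<theta>0 t"
    have A: "A > 0" using y w_inv[OF t] by (simp add: A_def)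
    have "A powr (- (1 + \<alpha>\<^sub>2)) * A powr (1 + \<alpha>\<^sub>2) = 1"
      unfolding powr_add[symmetric] using A by simp
    then have "exp (- (c * A)) = A powr (- (1 + \<alpha>\<^sub>2)) * (A powr (1 + \<alpha>\<^sub>2) * exp (- (c * A)))"
      by (simp only: mult.assoc[symmetric] mult_1)
    also have "\<dots> \<le> A powr (- (1 + \<alpha>\<^sub>2)) * M" using M(2)[of A] A by (intro mult_left_mono) auto
    also have "\<dots> = M / C6 * (C6 * A powr (- (1 + \<alpha>\<^sub>2)))" using C6_pos by simp
    also have "\<dots> \<le> M / C6 * (h t * (t * \<nu> y))"
      using t_nu_h_ge[OF t y] M C6_pos by (intro mult_left_mono) (auto simp: A_def)
    finally show ?thesis by (simp add: A_def)
  qed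
  moreover have "M / C6 > 0" using M C6_pos by simp
  ultimately show ?thesis by blast
qed

end

lemma e_ge_2: "exp 1 \<ge> (2::real)"
  using exp_ge_add_one_self[of 1] by simp

lemma exp_2_eq: "exp 2 = exp 1 * exp (1::real)"
  by (simp flip: exp_add)

lemma exp_2_ge: "2 * exp 1 \<le> exp (2::real)"
  unfolding exp_2_eq using e_ge_2 by (intro mult_right_mono) auto

context sub_scaled
begin

text \<open>While y is at most a multiple of \<theta>, the exponential term is bounded below and
  \<open>p_sup\<close> suffices; otherwise \<open>upper\<close> applies with k = 1/2. The case y = 0
  is kept apart because the real number \<nu> 0 carries no information.\<close>

lemma right_upper:
  assumes y: "y \<ge> 0"
  defines "\<theta> \<equiv> theta_fun \<nu> t (y / (8 * exp 2))"
  shows "p (t * b + y) \<le> max (CS * exp (exp 2)) (max (CS * exp (A0 / 8)) (CU + CS)) * (1 / h t) * (h t * (t * \<nu> y) + exp (- (y / (8 * \<theta>)))) \<or> y = 0"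
proof (cases "y = 0")
  case False
  note ht = h[OF t_pos] and wi = w_inv[OF t_pos]
  define C where "C = max (CS * exp (exp 2)) (max (CS * exp (A0 / 8)) (CU + CS))"
  have y0: "y > 0" using y False by simp
  have nuy: "\<nu> y > 0" by (rule nu_pos[OF y0])
  have sup: "p (t * b + y) \<le> CS / h t"
    by (rule p_sup) (use t_pos b_pos y0 in \<open>simp add: add_pos_pos\<close>)
  have C0: "C > 0" using CS_pos consts3 by (simp add: C_def less_max_iff_disj)
  have easy: "p (t * b + y) \<le> C * (1 / h t) * (h t * (t * \<nu> y) + exp (- (y / (8 * \<theta>))))"
    if E: "y / (8 * \<theta>) \<le> E" "CS * exp E \<le> C" for E
  proof -
    have "CS \<le> C * exp (- E)"
    proof -
      have "CS * exp E * exp (- E) \<le> C * exp (- E)" using E by (intro mult_right_mono) auto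
      then show ?thesis by (simp add: mult.assoc flip: exp_add)
    qed
    also have "\<dots> \<le> C * exp (- (y / (8 * \<theta>)))" using E C0 by (intro mult_left_mono) auto
    also have "\<dots> \<le> C * (h t * (t * \<nu> y) + exp (- (y / (8 * \<theta>))))" using C0 ht t_pos nuy by (intro mult_left_mono) auto
    finally have "CS * (1 / h t) \<le> C * (h t * (t * \<nu> y) + exp (- (y / (8 * \<theta>)))) * (1 / h t)" using ht by (intro mult_right_mono) auto
    then show ?thesis using sup by (simp add: mult_ac)
  qed
  have "p (t * b + y) \<le> C * (1 / h t) * (h t * (t * \<nu> y) + exp (- (y / (8 * \<theta>))))"
  proof (cases "y / (8 * exp 2) < h t")
    case True
    then have "\<theta> = h t" unfolding \<theta>_def by (rule theta_low[OF t_pos])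
    moreover have "y / (8 * h t) \<le> exp 2" using True ht by (simp add: field_simps)
    ultimately show ?thesis by (intro easy[of "exp 2"]) (auto simp: C_def)
  next
    case False
    then have hy: "h t \<le> y / (8 * exp 2)" by simp
    have th: "\<theta>0 t \<le> \<theta>" "\<theta> \<le> h t" "t * \<theta> * H (1 / \<theta>) \<le> y / (8 * exp 2)"
      unfolding \<theta>_def by (rule theta_general[OF t_pos hy])+
    have th0: "\<theta> > 0" using th wi by linarith
    have yb: "8 * exp 2 * h t \<le> y" using hy by (simp add: field_simps)
    show ?thesis
    proof (cases "A0 * \<theta> \<le> y")
      case False
      then have "y / (8 * \<theta>) \<le> A0 / 8" using th0 by (simp add: field_simps)
      then show ?thesis by (intro easy[of "A0 / 8"]) (auto simp: C_def)
    next
      case True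
      have "p (t * b + y) \<le> CU * (t * \<nu> y) + CS / h t * exp (- (1/2 / 2 * (y / \<theta>)))"
      proof (rule upper[OF th(1,2) _ _ _ _ True])
        have "16 * exp 1 * h t \<le> 8 * exp 2 * h t" using exp_2_ge ht by (intro mult_right_mono) auto
        then show "16 * exp 1 * h t \<le> y" using yb by linarith
        \<comment> \<open>The right side is y / (4e), and e >= 2.\<close>
        have "4 * exp 1 * (1/2) * (t * \<theta> * H (1 / \<theta>)) \<le> 4 * exp 1 * (1/2) * (y / (8 * exp 2))" using th(3) by (intro mult_left_mono) auto
        also have "\<dots> = y / 8 * (2 / exp 1)" unfolding exp_2_eq by simp
        also have "\<dots> \<le> y / 8 * 1" using e_ge_2 y0 by (intro mult_left_mono) auto
        finally show "4 * exp 1 * (1/2) * (t * \<theta> * H (1 / \<theta>)) \<le> y / 8" by simp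
      qed auto
      also have "\<dots> \<le> CU * (t * \<nu> y) + CS / h t * exp (- (y / (8 * \<theta>)))"
      proof -
        have "y / (8 * \<theta>) \<le> 1/2 / 2 * (y / \<theta>)" using y0 th0 by (simp add: field_simps)
        then show ?thesis using CS_pos ht by (intro add_left_mono mult_left_mono) auto
      qed
      also have "\<dots> \<le> C * (t * \<nu> y) + C / h t * exp (- (y / (8 * \<theta>)))"
      proof -
        have "CU + CS \<le> C" by (simp add: C_def le_max_iff_disj)
        then have "CU \<le> C" "CS \<le> C" using consts3(10) CS_pos by linarith+
        then show ?thesis using ht t_pos nuy by (intro add_mono mult_right_mono divide_right_mono) auto
      qed
      also have "\<dots> = C * (1 / h t) * (h t * (t * \<nu> y) + exp (- (y / (8 * \<theta>))))" using ht by (simp add: field_simps)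
      finally show ?thesis .
    qed
  qed
  then show ?thesis by (simp add: C_def)
qed simp

text \<open>The jump term and the exponential term are each bounded with the constant 2c, so their
  sum is bounded with c. Where y / (8 e^2) exceeds D(t), the exponential does not come from
  propagation; it is dominated by the jump term through \<open>M\<close>.\<close>

lemma right_lower:
  assumes y: "y > 0"
    and M: "\<forall>y\<ge>\<theta>0 t. exp (- (c4 * (y / \<theta>0 t))) \<le> M * (h t * (t * \<nu> y))" "M > 0"
    and c: "c > 0" "c \<le> cB (8 * exp 2)" "c \<le> cJ / 2" "c \<le> cJ / (2 * M)" "c \<le> cB 1 / 2"
  defines "\<theta> \<equiv> theta_fun \<nu> t (y / (8 * exp 2))"
  shows "c * (1 / h t) * min 1 (h t * (t * \<nu> y) + exp (- (c4 * y / \<theta>))) \<le> p (t * b + y)"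
proof (cases "y / (8 * exp 2) < h t")
  case True
  note ht = h[OF t_pos]
  have "cB (8 * exp 2) / h t \<le> p (t * b + y)" by (rule base_lower) (use y True in \<open>auto simp: field_simps\<close>)
  moreover have "c * (1 / h t) * min 1 (h t * (t * \<nu> y) + exp (- (c4 * y / \<theta>))) \<le> c * (1 / h t) * 1"
    using c ht by (intro mult_left_mono) auto
  moreover have "c * (1 / h t) * 1 \<le> cB (8 * exp 2) / h t" using c ht by (simp add: divide_right_mono)
  ultimately show ?thesis by linarith
next
  case False
  note ht = h[OF t_pos] and wi = w_inv[OF t_pos]
  have hy: "h t \<le> y / (8 * exp 2)" using False by simp
  then have yb: "8 * exp 2 * h t \<le> y" by (simp add: field_simps)
  have "1 * h t \<le> 8 * exp 2 * h t" using ht exp_2_ge e_ge_2 by (intro mult_right_mono) auto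
  then have yh: "h t \<le> y" using yb by linarith
  define X where "X = h t * (t * \<nu> y)"
  have X0: "X \<ge> 0" using ht t_pos nu_pos[OF y] by (simp add: X_def)
  define e where "e = exp (- (c4 * y / \<theta>))"
  have "cJ * (t * \<nu> y) \<le> p (t * b + y)" by (rule jump_lower[OF yh])
  then have J: "cJ * X \<le> h t * p (t * b + y)" using ht by (simp add: X_def mult_ac)
  have pe: "2 * c * e \<le> h t * p (t * b + y)"
  proof (cases "y / (8 * exp 2) \<le> D_fun \<nu> t")
    case True
    note th = theta_mid[OF t_pos hy True, folded \<theta>_def]
    have "cB 1 / h t * e \<le> p (t * b + y)"
      using middle_lower[OF th(1,2) th(3) yb] by (simp add: e_def c4_def)
    then have "cB 1 * e \<le> h t * p (t * b + y)" using ht by (simp add: field_simps)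
    moreover have "2 * c * e \<le> cB 1 * e" using c by (intro mult_right_mono) (auto simp: e_def)
    ultimately show ?thesis by linarith
  next
    case False
    then have "\<theta> = \<theta>0 t" unfolding \<theta>_def by (intro theta_high[OF t_pos]) simp
    then have "e \<le> M * X" using M(1)[rule_format, of y] yh wi(3) by (simp add: e_def X_def)
    then have "2 * c * e \<le> 2 * c * (M * X)" using c by (intro mult_left_mono) auto
    also have "\<dots> \<le> 2 * (cJ / (2 * M)) * (M * X)" using c M X0 by (intro mult_right_mono mult_left_mono) auto
    also have "\<dots> = cJ * X" using M by simp
    finally show ?thesis using J by linarith
  qed
  have "2 * c * X \<le> cJ * X" using c X0 by (intro mult_right_mono) auto
  then have "c * (X + e) \<le> h t * p (t * b + y)" using J pe by (simp add: algebra_simps)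
  moreover have "c * min 1 (X + e) \<le> c * (X + e)" using c by (intro mult_left_mono) auto
  ultimately have "c * min 1 (X + e) \<le> h t * p (t * b + y)" by linarith
  then show ?thesis using ht unfolding X_def e_def by (simp add: field_simps)
qed

text \<open>At s = \<open>\<theta>0 t\<close> only t s H(1/s) <= D(t) < y is known, without the
  factor 1 / (8 e^2), so the tilt is reduced to k = 1/100, with 4e/100 <= 1/8; the exponential is
  then absorbed by the jump term. For y up to a multiple of \<open>\<theta>0 t\<close> the jump term
  itself is at least of order 1/h.\<close>

lemma far_upper:
  assumes D: "D_fun \<nu> t < y"
    and M: "\<forall>y\<ge>\<theta>0 t. exp (- (1 / 200 * (y / \<theta>0 t))) \<le> M * (h t * (t * \<nu> y))" "M > 0"
    and C: "D_fun \<nu> t < 16 * exp 1 * h t \<longrightarrow> h t \<le> C * \<theta>0 t" "C > 0"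
  shows "p (t * b + y) \<le> (CU + CS * M * exp (1 / 200 * max A0 (16 * exp 1 * C))) * (t * \<nu> y)"
proof -
  note ht = h[OF t_pos] and wi = w_inv[OF t_pos] and Dp = D_props[OF t_pos]
  \<comment> \<open>The second entry secures 16 e h <= y: otherwise D(t) < 16 e h, so h <= C
    \<open>\<theta>0 t\<close>, and y would be below A1 \<open>\<theta>0 t\<close>.\<close>
  define A1 where "A1 = max A0 (16 * exp 1 * C)"
  have yh: "h t \<le> y" "\<theta>0 t \<le> y" using D Dp(3) wi by linarith+
  have y0: "y > 0" using yh ht by linarith
  have X: "exp (- (1 / 200 * (y / \<theta>0 t))) \<le> M * (h t * (t * \<nu> y))" using M(1) yh by blast
  have tnu: "t * \<nu> y > 0" using t_pos nu_pos[OF y0] by simp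
  show ?thesis
  proof (cases "y \<le> A1 * \<theta>0 t")
    case True
    have "p (t * b + y) \<le> CS / h t"
      by (rule p_sup) (use t_pos b_pos y0 in \<open>simp add: add_pos_pos\<close>)
    also have "\<dots> = CS / h t * exp (1 / 200 * A1) * exp (- (1 / 200 * A1))" by (simp add: mult.assoc flip: exp_add)
    also have "\<dots> \<le> CS / h t * exp (1 / 200 * A1) * (M * (h t * (t * \<nu> y)))"
    proof (rule mult_left_mono)
      have "y / \<theta>0 t \<le> A1" using True wi by (simp add: pos_divide_le_eq)
      then have "exp (- (1 / 200 * A1)) \<le> exp (- (1 / 200 * (y / \<theta>0 t)))" by simp
      then show "exp (- (1 / 200 * A1)) \<le> M * (h t * (t * \<nu> y))" using X by linarith
    qed (use CS_pos ht in simp)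
    also have "\<dots> = CS * M * exp (1 / 200 * A1) * (t * \<nu> y)" using ht by simp
    also have "\<dots> \<le> (CU + CS * M * exp (1 / 200 * A1)) * (t * \<nu> y)" using tnu consts3 by (intro mult_right_mono) auto
    finally show ?thesis by (simp add: A1_def)
  next
    case False
    have A1: "A0 \<le> A1" "16 * exp 1 * C \<le> A1" by (auto simp: A1_def)
    have y16: "16 * exp 1 * h t \<le> y"
    proof (rule ccontr)
      assume n: "\<not> 16 * exp 1 * h t \<le> y"
      then have "h t \<le> C * \<theta>0 t" using C D by simp
      then have "16 * exp 1 * h t \<le> 16 * exp 1 * (C * \<theta>0 t)" by (intro mult_left_mono) auto
      also have "\<dots> \<le> A1 * \<theta>0 t" using A1(2) wi by (simp add: mult.assoc[symmetric] mult_right_mono)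
      finally show False using n False by linarith
    qed
    have A1y: "A0 * \<theta>0 t \<le> y" using mult_right_mono[OF A1(1), of "\<theta>0 t"] wi False by linarith
    have "p (t * b + y) \<le> CU * (t * \<nu> y) + CS / h t * exp (- (1 / 100 / 2 * (y / \<theta>0 t)))"
    proof (rule upper[OF order_refl wi(3) _ _ y16 _ A1y])
      have "t * \<theta>0 t * H (1 / \<theta>0 t) \<le> y" using Dp(1)[of "\<theta>0 t"] wi D by simp
      then have "4 * exp 1 * (1 / 100) * (t * \<theta>0 t * H (1 / \<theta>0 t)) \<le> 4 * exp 1 * (1 / 100) * y" by (intro mult_left_mono) auto
      also have "\<dots> \<le> 4 * 3 * (1 / 100) * y" using exp_1_le y0 by (intro mult_right_mono) auto
      also have "\<dots> \<le> y / 8" using y0 by simp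
      finally show "4 * exp 1 * (1 / 100) * (t * \<theta>0 t * H (1 / \<theta>0 t)) \<le> y / 8" .
    qed auto
    also have "\<dots> \<le> CU * (t * \<nu> y) + CS / h t * (M * (h t * (t * \<nu> y)))"
      using X CS_pos ht by (intro add_left_mono mult_left_mono) auto
    also have "\<dots> = (CU + CS * M * 1) * (t * \<nu> y)" using ht by (simp add: field_simps)
    also have "\<dots> \<le> (CU + CS * M * exp (1 / 200 * A1)) * (t * \<nu> y)"
      using tnu CS_pos M A1 consts3(8) by (intro mult_right_mono add_left_mono mult_left_mono) auto
    finally show ?thesis by (simp add: A1_def)
  qed
qed

end

text \<open>The passage from the process to the analytic setting: the law of \<open>S t\<close> has
  the density \<open>p t\<close> and the Laplace transform given by the exponent.\<close>

lemma sub_scaled_transition_density: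
  fixes M :: "'a measure"
  assumes drift: "driftless_subordinator M S \<nu>" and td: "transition_density M S p"
    and sc: "scaled_dens \<nu> a\<^sub>1 a\<^sub>2 \<alpha>\<^sub>1 \<alpha>\<^sub>2" and t: "t > 0"
  shows "sub_scaled \<nu> (p t) (density lborel (\<lambda>x. ennreal (indicator {0<..} x * p t x))) t a\<^sub>1 a\<^sub>2 \<alpha>\<^sub>1 \<alpha>\<^sub>2"
proof -
  interpret scaled_dens \<nu> a\<^sub>1 a\<^sub>2 \<alpha>\<^sub>1 \<alpha>\<^sub>2 by (rule sc)
  define Q where "Q = density lborel (\<lambda>x. ennreal (indicator {0<..} x * p t x))"
  have p: "\<And>x. x > 0 \<Longrightarrow> p t x \<ge> 0" "continuous_on {0<..} (p t)"
    "distributed M lborel (S t) (\<lambda>x. ennreal (indicator {0<..} x * p t x))"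
    using td t by (auto simp: transition_density_def)
  have D: "distr M lborel (S t) = Q" "S t \<in> measurable M lborel" using p(3) by (auto simp: distributed_def Q_def)
  have pM: "prob_space M" using drift by (simp add: driftless_subordinator_def subordinator_def levy_process_def)
  have RQ: "real_distribution Q"
    using prob_space.prob_space_distr[OF pM D(2)] unfolding D(1)
    by (simp add: real_distribution_def real_distribution_axioms_def Q_def)
  have C: "cont_density (p t) Q"
    by (rule cont_density.intro) (use p RQ in \<open>auto simp: Q_def\<close>)
  have "sub_density_axioms \<nu> Q t"
  proof
    fix u :: real assume u: "u \<ge> 0"
    have "(\<integral>x. exp (- (u * x)) \<partial>Q) = (\<integral>\<omega>. exp (- (u * S t \<omega>)) \<partial>M)"
      unfolding D(1)[symmetric] by (rule integral_distr[OF D(2)]) simp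
    also have "\<dots> = exp (- (t * laplace_exponent \<nu> u))" using drift u t by (simp add: driftless_subordinator_def)
    finally show "(\<integral>x. exp (- (u * x)) \<partial>Q) = exp (- (t * \<phi> u))" by (simp add: laplace_exponent_eq)
  qed (rule t)
  then have "sub_density \<nu> (p t) Q t" using C levy_dens_axioms by (simp add: sub_density_def)
  then show ?thesis using sc by (simp add: sub_scaled_def Q_def)
qed

text \<open>At y = 0 the convention \<nu>(0) = \<infinity> makes the minimum 1, so the extended
  statement splits into two real ones.\<close>

lemma min_one_nu_ext:
  assumes "t > 0" "k > 0"
  shows "min 1 (ereal t * nu_ext \<nu> y / ereal k + ereal e) = ereal (if y = 0 then 1 else min 1 (t * \<nu> y / k + e))"
proof (cases "y = 0")
  case True
  have "ereal t * \<infinity> / ereal k + ereal e = \<infinity>" using assms by simp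
  then show ?thesis using True by (simp add: nu_ext_def)
next
  case False
  have "ereal t * nu_ext \<nu> y / ereal k + ereal e = ereal (t * \<nu> y / k + e)"
    using False assms by (simp add: nu_ext_def)
  then show ?thesis using False by (simp only: one_ereal_def ereal_min if_False)
qed

theorem corollary1p5:
  fixes M :: "'a measure"
    and S :: "real \<Rightarrow> 'a \<Rightarrow> real"
    and \<nu> :: "real \<Rightarrow> real"
    and p :: "real \<Rightarrow> real \<Rightarrow> real"
    and a\<^sub>1 a\<^sub>2 \<alpha>\<^sub>1 \<alpha>\<^sub>2 :: real
  assumes "driftless_subordinator M S \<nu>"
    and "transition_density M S p"
    and "\<And>r. 0 < r \<Longrightarrow> \<nu> r > 0"
    and "a\<^sub>1 > 0" and "a\<^sub>2 > 0" and "\<alpha>\<^sub>1 > 0" and "\<alpha>\<^sub>2 \<ge> \<alpha>\<^sub>1"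
    and "\<And>r R. 0 < r \<Longrightarrow> r \<le> R \<Longrightarrow> a\<^sub>1 * (R / r) powr (1 + \<alpha>\<^sub>1) \<le> \<nu> r / \<nu> R"
    and "\<And>r R. 0 < r \<Longrightarrow> r \<le> R \<Longrightarrow> \<nu> r / \<nu> R \<le> a\<^sub>2 * (R / r) powr (1 + \<alpha>\<^sub>2)"
  shows "\<exists>c\<^sub>1 c\<^sub>2 c\<^sub>3 c\<^sub>4 c\<^sub>5 :: real.
    c\<^sub>1 > 1 \<and> c\<^sub>2 > 1 \<and> c\<^sub>3 > 1 \<and> c\<^sub>5 > 1 \<and> c\<^sub>4 > 0 \<and>
    (\<forall>t>0.
      (\<forall>x. 0 < x \<and> x \<le> t * b_fun \<nu> t \<longrightarrow>
        (let \<sigma> = sigma_fun \<nu> t x; \<phi>'' = deriv (deriv (laplace_exponent \<nu>)) in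
          inverse c\<^sub>1 / sqrt (t * (- \<phi>'' \<sigma>)) * exp (- (t * H_fun \<nu> \<sigma>)) \<le> p t x \<and>
          p t x \<le> c\<^sub>1 / sqrt (t * (- \<phi>'' \<sigma>)) * exp (- (t * H_fun \<nu> \<sigma>)) \<and>
          inverse c\<^sub>2 * H_inv \<nu> (1 / t) * exp (- (2 * t * H_fun \<nu> \<sigma>)) \<le> p t x \<and>
          p t x \<le> c\<^sub>2 * H_inv \<nu> (1 / t) * exp (- (t / 2 * H_fun \<nu> \<sigma>)))) \<and>
      (\<forall>y\<ge>0.
        ereal (inverse c\<^sub>3 * H_inv \<nu> (1 / t)) *
          min 1 (ereal t * nu_ext \<nu> y / ereal (H_inv \<nu> (1 / t)) +
                 ereal (exp (- (c\<^sub>4 * y / theta_fun \<nu> t (y / (8 * exp 2))))))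
          \<le> ereal (p t (t * b_fun \<nu> t + y)) \<and>
        ereal (p t (t * b_fun \<nu> t + y))
          \<le> ereal (c\<^sub>3 * H_inv \<nu> (1 / t)) *
            min 1 (ereal t * nu_ext \<nu> y / ereal (H_inv \<nu> (1 / t)) +
                   ereal (exp (- (y / (8 * theta_fun \<nu> t (y / (8 * exp 2)))))))) \<and>
      (\<forall>y. D_fun \<nu> t < y \<longrightarrow>
        inverse c\<^sub>5 * (t * \<nu> y) \<le> p t (t * b_fun \<nu> t + y) \<and>
        p t (t * b_fun \<nu> t + y) \<le> c\<^sub>5 * (t * \<nu> y)))"
proof -
  have levy: "levy_density \<nu>" using assms(1) by (simp add: driftless_subordinator_def)
  have sc: "scaled_dens \<nu> a\<^sub>1 a\<^sub>2 \<alpha>\<^sub>1 \<alpha>\<^sub>2"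
    using levy assms by (unfold_locales) auto
  \<comment> \<open>Interpreted before t is chosen, with \<open>sub_scaled\<close> only inside the
    three parts; the constants obtained here are therefore independent of t.\<close>
  interpret scaled_dens \<nu> a\<^sub>1 a\<^sub>2 \<alpha>\<^sub>1 \<alpha>\<^sub>2 by (rule sc)
  note SC = sub_scaled_transition_density[OF assms(1,2) sc]
  obtain M1 where M1: "M1 > 0" "\<And>z. z \<ge> 0 \<Longrightarrow> z powr (1 / \<gamma>) * exp (- (1/2 * z)) \<le> M1"
    using powr_exp_bounded[of "1 / \<gamma>" "1/2"] gamma by auto
  obtain M2 where M2: "M2 > 0" "\<And>t. t > 0 \<Longrightarrow> \<forall>y\<ge>\<theta>0 t. exp (- (c4 * (y / \<theta>0 t))) \<le> M2 * (h t * (t * \<nu> y))"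
    using exp_le_jump[OF c4_pos] by blast
  obtain M3 where M3: "M3 > 0" "\<And>t. t > 0 \<Longrightarrow> \<forall>y\<ge>\<theta>0 t. exp (- (1 / 200 * (y / \<theta>0 t))) \<le> M3 * (h t * (t * \<nu> y))"
    using exp_le_jump[of "1 / 200"] by auto
  obtain C where C: "C > 0" "\<And>t. t > 0 \<Longrightarrow> D_fun \<nu> t < 16 * exp 1 * h t \<longrightarrow> h t \<le> C * \<theta>0 t"
    using h_le_theta0 by blast
  have inv_le: "inverse c \<le> x" if "0 < x" "1 / x \<le> c" for c x :: real
  proof -
    have "0 < 1 / x" using that by simp
    moreover from this have "0 < c" using that by linarith
    ultimately have "1 / c \<le> 1 / (1 / x)" using that by (intro divide_left_mono mult_pos_pos) auto
    then show ?thesis by (simp add: inverse_eq_divide)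
  qed
  \<comment> \<open>Each constant serves as an upper factor and, inverted, as a lower one; the 2
    makes it larger than 1.\<close>
  define c1 where "c1 = max 2 (max CS (1 / cL 0))"
  define c2' where "c2' = max 2 (max (CS * (sqrt CH * M1)) (1 / cL 0))"
  define cu where "cu = max (CS * exp (exp 2)) (max (CS * exp (A0 / 8)) (CU + CS))"
  define cl where "cl = min (min (cB (8 * exp 2)) (cJ / 2)) (min (cJ / (2 * M2)) (cB 1 / 2))"
  define c3 where "c3 = max 2 (max cu (1 / cl))"
  define cf where "cf = CU + CS * M3 * exp (1 / 200 * max A0 (16 * exp 1 * C))"
  define c5 where "c5 = max 2 (max cf (1 / cJ))"
  have cl: "cl > 0" "cl \<le> cB (8 * exp 2)" "cl \<le> cJ / 2" "cl \<le> cJ / (2 * M2)" "cl \<le> cB 1 / 2"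
    using consts_pos2 M2(1) by (auto simp: cl_def)
  have cLp: "cL 0 > 0" by (rule consts_pos(7))
  have cus: "CS \<le> cu" using consts3(10) by (simp add: cu_def le_max_iff_disj)
  have b1: "c1 > 1" "CS \<le> c1" "inverse c1 \<le> cL 0"
    using inv_le[OF cLp, of c1] by (auto simp: c1_def)
  have b2: "c2' > 1" "CS * (sqrt CH * M1) \<le> c2'" "inverse c2' \<le> cL 0"
    using inv_le[OF cLp, of c2'] by (auto simp: c2'_def)
  have b3: "c3 > 1" "cu \<le> c3" "inverse c3 \<le> cl"
    using inv_le[OF cl(1), of c3] by (auto simp: c3_def)
  have b5: "c5 > 1" "cf \<le> c5" "inverse c5 \<le> cJ"
    using inv_le[OF consts_pos2(3), of c5] by (auto simp: c5_def)
  have part1: "inverse c1 / sqrt (t * (- deriv (deriv (laplace_exponent \<nu>)) (sigma_fun \<nu> t x))) * exp (- (t * H_fun \<nu> (sigma_fun \<nu> t x))) \<le> p t x \<and>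
      p t x \<le> c1 / sqrt (t * (- deriv (deriv (laplace_exponent \<nu>)) (sigma_fun \<nu> t x))) * exp (- (t * H_fun \<nu> (sigma_fun \<nu> t x))) \<and>
      inverse c2' * H_inv \<nu> (1 / t) * exp (- (2 * t * H_fun \<nu> (sigma_fun \<nu> t x))) \<le> p t x \<and>
      p t x \<le> c2' * H_inv \<nu> (1 / t) * exp (- (t / 2 * H_fun \<nu> (sigma_fun \<nu> t x)))"
    if t: "t > 0" and x: "0 < x" "x \<le> t * b_fun \<nu> t" for t x
  proof -
    interpret X: sub_scaled \<nu> "p t" "density lborel (\<lambda>x. ennreal (indicator {0<..} x * p t x))" t a\<^sub>1 a\<^sub>2 \<alpha>\<^sub>1 \<alpha>\<^sub>2
      by (rule SC[OF t])
    define \<sigma> where "\<sigma> = sigma_fun \<nu> t x"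
    have xb: "x \<le> t * \<phi>1 (1 / h t)" using x h[OF t] by simp
    note L = X.left_tail[OF x(1) xb, folded \<sigma>_def]
    have s0: "\<sigma> > 0" using L(3) h[OF t] by (meson less_le_trans zero_less_divide_1_iff)
    note LH = X.left_tail_H[OF M1(2) L(3)]
    define F where "F = 1 / sqrt (X.V \<sigma>) * exp (- (t * H \<sigma>))"
    have F0: "F \<ge> 0" using X.V_pos[OF s0] by (simp add: F_def)
    have p1: "cL 0 * F \<le> p t x" "p t x \<le> CS * F" using L by (simp_all add: F_def)
    have "inverse c1 * F \<le> p t x" using mult_right_mono[OF b1(3) F0] p1 by linarith
    moreover have "p t x \<le> c1 * F" using mult_right_mono[OF b1(2) F0] p1 by linarith
    moreover have "inverse c2' * (1 / h t * exp (- (2 * t * H \<sigma>))) \<le> p t x"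
    proof -
      have "inverse c2' * (1 / h t * exp (- (2 * t * H \<sigma>))) \<le> cL 0 * F"
        using LH(1) b2 h[OF t] cLp by (intro mult_mono) (auto simp: F_def)
      then show ?thesis using p1 by linarith
    qed
    moreover have "p t x \<le> c2' * (1 / h t * exp (- (t / 2 * H \<sigma>)))"
    proof -
      have "CS * F \<le> CS * (sqrt CH * M1 * (1 / h t) * exp (- (t / 2 * H \<sigma>)))"
        using LH(2) CS_pos by (intro mult_left_mono) (auto simp: F_def)
      also have "\<dots> = (CS * (sqrt CH * M1)) * (1 / h t * exp (- (t / 2 * H \<sigma>)))" by simp
      also have "\<dots> \<le> c2' * (1 / h t * exp (- (t / 2 * H \<sigma>)))" using b2 h[OF t] by (intro mult_right_mono) auto
      finally show ?thesis using p1 by linarith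
    qed
    moreover have "t * (- deriv (deriv (laplace_exponent \<nu>)) \<sigma>) = X.V \<sigma>"
      by (simp add: deriv2_laplace[OF s0] X.V_def)
    ultimately show ?thesis
      unfolding \<sigma>_def[symmetric] H_fun_eq[OF s0] h(3)[OF t] F_def by simp
  qed
  have part2: "ereal (inverse c3 * H_inv \<nu> (1 / t)) *
          min 1 (ereal t * nu_ext \<nu> y / ereal (H_inv \<nu> (1 / t)) + ereal (exp (- (c4 * y / theta_fun \<nu> t (y / (8 * exp 2))))))
          \<le> ereal (p t (t * b_fun \<nu> t + y)) \<and>
        ereal (p t (t * b_fun \<nu> t + y))
          \<le> ereal (c3 * H_inv \<nu> (1 / t)) *
            min 1 (ereal t * nu_ext \<nu> y / ereal (H_inv \<nu> (1 / t)) + ereal (exp (- (y / (8 * theta_fun \<nu> t (y / (8 * exp 2)))))))"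
    if t: "t > 0" and y: "y \<ge> 0" for t y
  proof -
    interpret X: sub_scaled \<nu> "p t" "density lborel (\<lambda>x. ennreal (indicator {0<..} x * p t x))" t a\<^sub>1 a\<^sub>2 \<alpha>\<^sub>1 \<alpha>\<^sub>2
      by (rule SC[OF t])
    note ht = h[OF t]
    have Hp: "H_inv \<nu> (1 / t) > 0" unfolding ht using ht(1) by simp
    let ?q = "p t (t * \<phi>1 (1 / h t) + y)"
    let ?\<theta> = "theta_fun \<nu> t (y / (8 * exp 2))"
    have sup: "?q \<le> CS / h t"
      by (rule X.p_sup) (use t X.b_pos y in \<open>simp add: add_pos_nonneg\<close>)
    have up: "?q \<le> c3 * (1 / h t) * (if y = 0 then 1 else min 1 (t * \<nu> y / (1 / h t) + exp (- (y / (8 * ?\<theta>)))))"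
    proof -
      have "CS / h t \<le> c3 * (1 / h t)" using cus b3 ht(1) by (simp add: divide_right_mono)
      then have "?q \<le> c3 * (1 / h t)" using sup by linarith
      moreover have "?q \<le> c3 * (1 / h t) * (t * \<nu> y / (1 / h t) + exp (- (y / (8 * ?\<theta>))))" if "y \<noteq> 0"
      proof -
        have "?q \<le> cu * (1 / h t) * (h t * (t * \<nu> y) + exp (- (y / (8 * ?\<theta>))))"
          using X.right_upper[OF y] that by (auto simp: cu_def)
        also have "\<dots> \<le> c3 * (1 / h t) * (h t * (t * \<nu> y) + exp (- (y / (8 * ?\<theta>))))"
          using b3 ht(1) t y that nu_nonneg[of y] by (intro mult_right_mono) auto
        finally show ?thesis by (simp add: mult_ac)
      qed
      ultimately show ?thesis by (cases "y = 0") (simp_all add: min_def)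
    qed
    have low: "inverse c3 * (1 / h t) * (if y = 0 then 1 else min 1 (t * \<nu> y / (1 / h t) + exp (- (c4 * y / ?\<theta>)))) \<le> ?q"
    proof (cases "y = 0")
      case True
      have "cB (8 * exp 2) / h t \<le> ?q" by (rule X.base_lower) (use True ht in auto)
      moreover have "inverse c3 * (1 / h t) \<le> cB (8 * exp 2) * (1 / h t)" using b3 cl ht by (intro mult_right_mono) auto
      ultimately show ?thesis using True by simp
    next
      case False
      then have y0: "y > 0" using y by simp
      have "cl * (1 / h t) * min 1 (h t * (t * \<nu> y) + exp (- (c4 * y / ?\<theta>))) \<le> ?q"
        by (rule X.right_lower[OF y0 M2(2)[OF t] M2(1) cl])
      moreover have "inverse c3 * (1 / h t) * min 1 (h t * (t * \<nu> y) + exp (- (c4 * y / ?\<theta>)))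
          \<le> cl * (1 / h t) * min 1 (h t * (t * \<nu> y) + exp (- (c4 * y / ?\<theta>)))"
        using b3 ht(1) t nu_nonneg[OF y0] by (intro mult_right_mono) (auto simp: min_def)
      ultimately show ?thesis using False by (simp add: mult_ac)
    qed
    show ?thesis
      unfolding min_one_nu_ext[OF t Hp] times_ereal.simps ereal_less_eq
      unfolding ht using low up by blast
  qed
  have part3: "inverse c5 * (t * \<nu> y) \<le> p t (t * b_fun \<nu> t + y) \<and> p t (t * b_fun \<nu> t + y) \<le> c5 * (t * \<nu> y)"
    if t: "t > 0" and y: "D_fun \<nu> t < y" for t y
  proof -
    interpret X: sub_scaled \<nu> "p t" "density lborel (\<lambda>x. ennreal (indicator {0<..} x * p t x))" t a\<^sub>1 a\<^sub>2 \<alpha>\<^sub>1 \<alpha>\<^sub>2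
      by (rule SC[OF t])
    note ht = h[OF t]
    have hy: "h t \<le> y" using D_props(3)[OF t] y by simp
    have tnu: "t * \<nu> y \<ge> 0" using t nu_nonneg[of y] hy ht by simp
    have "cJ * (t * \<nu> y) \<le> p t (t * b_fun \<nu> t + y)" unfolding ht by (rule X.jump_lower[OF hy])
    moreover have "p t (t * b_fun \<nu> t + y) \<le> cf * (t * \<nu> y)"
      unfolding ht cf_def by (rule X.far_upper[OF y M3(2)[OF t] M3(1) C(2)[OF t] C(1)])
    ultimately show ?thesis
      using mult_right_mono[OF b5(3) tnu] mult_right_mono[OF b5(2) tnu] by linarith
  qed
  show ?thesis
    unfolding Let_def
  proof (intro exI conjI allI impI)
    show "c1 > 1" "c2' > 1" "c3 > 1" "c5 > 1" "c4 > 0" using b1 b2 b3 b5 c4_pos by auto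
  qed (use part1 part2 part3 in simp_all)
qed

end
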